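(* Let $m\ge 2$ be a natural number, let $\delta>2$ be a real number, and let $F:\mathbb{C}^2\to\mathbb{C}^2$ be the automorphism $F(z,w)=\left(e^{-z^m}+\delta e^{\frac{2\pi i}{m}}\,w,\ z\right)$. Then there are $m^2$ distinct escaping Fatou components of $F$ that are organized in cycles under $F$, with the following properties. (1) If $m$ is even, they form $\frac m2$ cycles, each of period $2m$. If $m$ is odd, they form $\frac{m-1}{2}$ cycles of period $2m$ and exactly one cycle of period $m$. (2) Each cycle has exactly two distinct limit functions $h_1,h_2$, and both have generic rank $1$. (3) For each Fatou component $V$ in a cycle of period $2m$, the two limit sets $h_1(V)$ and $h_2(V)$ are disjoint and hyperbolic. For each Fatou component $V$ in the cycle of period $m$ (which occurs exactly when $m$ is odd), the two limit sets coincide, $h_1(V)=h_2(V)$, and this set is hyperbolic. (4) Let $\Omega$ be the union of these $m^2$ components. Then $F$ is conjugate on $\Omega$ to the linear map $L(z,w)=(\delta e^{\frac{2\pi i}{m}}w,\,z)$; that is, there is a biholomorphism $\phi$ from $\Omega$ onto its image $\phi(\Omega)\subset\mathbb{C}^2$ with $\phi\circ F=L\circ\phi$ on $\Omega$. (5) Each of these Fatou components is biholomorphic to $\mathbb{H}\times\mathbb{H}$.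
   Context: $\mathbb{P}^2$ is the compactification of $\mathbb{C}^2$ by the line at infinity $\ell_\infty$, and $F^n$ denotes the $n$-th iterate of $F$. A family of holomorphic maps from an open set $U\subset\mathbb{C}^2$ to $\mathbb{C}^2$ is normal if every sequence in it has a subsequence converging uniformly on compact subsets to a holomorphic map $U\to\mathbb{P}^2$. The Fatou set of $F$ is the set of points of $\mathbb{C}^2$ having a neighborhood $U$ on which $\{F^n|_U\}_{n\in\mathbb{N}}$ is normal; a Fatou component is a connected component of the Fatou set. A limit function for a Fatou component (or for a union of Fatou components) $V$ is a holomorphic map $h:V\to\mathbb{P}^2$ such that $F^{n_j}\to h$ uniformly on compact subsets of $V$ for some $n_j\to\infty$; $h(V)$ is the corresponding limit set. The (generic) rank of $h$ is the maximal rank of its differential. A Fatou component $V$ is escaping if $h(V)\subset\ell_\infty$ for its limit functions $h$, i.e. its orbits converge to $\ell_\infty$. A cycle of period $p$ is a family of $p$ distinct Fatou components $V_0,\dots,V_{p-1}$ with $F(V_i)=V_{i+1 \bmod p}$; a limit function of a cycle is a limit function for the union of its components. A limit set contained in $\ell_\infty\cong\mathbb{P}^1$ is hyperbolic if it is a hyperbolic Riemann surface (its universal cover is the unit disk). $\mathbb{H}$ denotes a half plane in $\mathbb{C}$. *)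

theory Defs
  imports "HOL-Analysis.Analysis"
begin

section \<open>The complex projective plane\<close>

definition same_line :: "complex^3 \<Rightarrow> complex^3 \<Rightarrow> bool" where
  "same_line u v \<longleftrightarrow> u \<noteq> 0 \<and> v \<noteq> 0 \<and> (\<exists>c. v = c *s u)"

quotient_type cp2 = "complex^3" / partial: same_line
proof (rule part_equivpI)
  have "same_line 1 1"
    unfolding same_line_def by (auto intro: exI[of _ 1])
  then show "\<exists>x. same_line x x" ..
  show "symp same_line"
  proof (rule sympI)
    fix u v assume "same_line u v"
    then obtain c where c: "u \<noteq> 0" "v \<noteq> 0" "v = c *s u"
      unfolding same_line_def by blast
    then have "c \<noteq> 0" by auto
    then have "u = inverse c *s v"
      by (simp add: c(3) vector_smult_assoc)
    with c show "same_line v u"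
      unfolding same_line_def by blast
  qed
  show "transp same_line"
  proof (rule transpI)
    fix u v w assume "same_line u v" "same_line v w"
    then show "same_line u w"
      unfolding same_line_def by (metis vector_smult_assoc)
  qed
qed

lemma same_line_refl: "same_line v v \<longleftrightarrow> v \<noteq> 0"
  unfolding same_line_def by (auto intro: exI[of _ 1])

text \<open>The point with homogeneous coordinates \<open>v\<close>, meaningful for \<open>v \<noteq> 0\<close>, is
  \<^term>\<open>abs_cp2 v\<close>.\<close>

lemma abs_cp2_eq_iff: "u \<noteq> 0 \<Longrightarrow> v \<noteq> 0 \<Longrightarrow> abs_cp2 u = abs_cp2 v \<longleftrightarrow> (\<exists>c. v = c *s u)"
  by (metis Quotient_rel[OF Quotient_cp2] same_line_refl same_line_def)

lemma cp2_cases: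
  obtains v where "v \<noteq> 0" "norm v = 1" "x = abs_cp2 v"
proof -
  have r: "same_line (rep_cp2 x) (rep_cp2 x)" "abs_cp2 (rep_cp2 x) = x"
    by (rule Quotient_rep_reflp[OF Quotient_cp2], rule Quotient_abs_rep[OF Quotient_cp2])
  define u where "u = rep_cp2 x"
  have u: "u \<noteq> 0" "x = abs_cp2 u"
    using r by (auto simp: same_line_refl u_def)
  define v where "v = complex_of_real (inverse (norm u)) *s u"
  have veq: "v = inverse (norm u) *\<^sub>R u"
    unfolding v_def vec_eq_iff by (simp add: scaleR_conv_of_real[where 'a = complex])
  then have n: "norm v = 1" using u by simp
  then have v: "v \<noteq> 0" by auto
  then have "abs_cp2 u = abs_cp2 v"
    using u v_def by (subst abs_cp2_eq_iff) auto
  with n u v show ?thesis using that by simp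
qed

text \<open>The standard charts: on the set of points whose \<open>i\<close>-th homogeneous coordinate is nonzero,
  \<open>affine_coords i\<close> gives the representative whose \<open>i\<close>-th coordinate is \<open>1\<close>. So the chart takes
  values in the affine hyperplane \<open>{v. v $ i = 1}\<close> of \<open>\<C>\<^sup>3\<close>, a copy of \<open>\<C>\<^sup>2\<close>.\<close>

lift_definition in_chart :: "3 \<Rightarrow> cp2 \<Rightarrow> bool" is "\<lambda>i v. v $ i \<noteq> 0"
  by (auto simp: same_line_def)

lift_definition affine_coords :: "3 \<Rightarrow> cp2 \<Rightarrow> complex^3" is "\<lambda>i v. \<chi> j. v $ j / v $ i"
  by (auto simp: same_line_def vec_eq_iff)

text \<open>We metrise \<open>\<P>\<^sup>2\<close> by identifying a line with the Hermitian projection onto it;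
  this is the chordal metric up to a constant factor. The lemma \<open>open_cp2_iff\<close> below shows
  that it induces the quotient topology. As \<open>\<P>\<^sup>2\<close> is compact, uniform convergence
  does not depend on the choice of such a metric.\<close>

lift_definition line_projector :: "cp2 \<Rightarrow> complex^3^3" is
  "\<lambda>v. \<chi> i j. v $ i * cnj (v $ j) / complex_of_real ((norm v)\<^sup>2)"
proof -
  fix u v :: "complex^3"
  assume "same_line u v"
  then obtain c where c: "u \<noteq> 0" "v \<noteq> 0" "v = c *s u" by (auto simp: same_line_def)
  have c0: "c \<noteq> 0" using c by auto
  have n: "(norm v)\<^sup>2 = (norm c)\<^sup>2 * (norm u)\<^sup>2"
    by (simp add: c(3) norm_vec_def L2_set_def norm_mult power_mult_distrib sum_nonneg
        flip: sum_distrib_left)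
  have "v $ i * cnj (v $ j) / complex_of_real ((norm v)\<^sup>2) =
        u $ i * cnj (u $ j) / complex_of_real ((norm u)\<^sup>2)" for i j
  proof -
    have "v $ i * cnj (v $ j) / complex_of_real ((norm v)\<^sup>2) =
       (c * cnj c) * (u $ i * cnj (u $ j)) / ((c * cnj c) * complex_of_real ((norm u)\<^sup>2))"
      unfolding n of_real_mult complex_norm_square[of c] by (simp add: c(3) mult_ac)
    also have "\<dots> = u $ i * cnj (u $ j) / complex_of_real ((norm u)\<^sup>2)"
      using c0 by simp
    finally show ?thesis .
  qed
  then show "(\<chi> i j. u $ i * cnj (u $ j) / complex_of_real ((norm u)\<^sup>2)) =
     (\<chi> i j. v $ i * cnj (v $ j) / complex_of_real ((norm v)\<^sup>2))"
    by simp
qed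

lemma line_projector_abs: "v \<noteq> 0 \<Longrightarrow>
    line_projector (abs_cp2 v) = (\<chi> i j. v $ i * cnj (v $ j) / complex_of_real ((norm v)\<^sup>2))"
  by (rule line_projector.abs_eq) (simp add: eq_onp_def same_line_refl)

lemma line_projector_inject: "line_projector x = line_projector y \<longleftrightarrow> x = y"
proof
  assume eq: "line_projector x = line_projector y"
  obtain u where u: "u \<noteq> 0" "norm u = 1" "x = abs_cp2 u" by (rule cp2_cases)
  obtain v where v: "v \<noteq> 0" "norm v = 1" "y = abs_cp2 v" by (rule cp2_cases)
  have e: "u $ i * cnj (u $ j) = v $ i * cnj (v $ j)" for i j
    using eq u v by (simp add: line_projector_abs vec_eq_iff)
  obtain k where k: "v $ k \<noteq> 0" using v by (auto simp: vec_eq_iff)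
  have "v = (cnj (u $ k) / cnj (v $ k)) *s u"
    unfolding vec_eq_iff
  proof
    fix i
    have "v $ i = v $ i * cnj (v $ k) / cnj (v $ k)" using k by simp
    also have "\<dots> = u $ i * cnj (u $ k) / cnj (v $ k)" by (simp only: e)
    finally show "v $ i = ((cnj (u $ k) / cnj (v $ k)) *s u) $ i" by (simp add: mult.commute)
  qed
  then have "\<exists>c. v = c *s u" ..
  then show "x = y" unfolding u(3) v(3) abs_cp2_eq_iff[OF u(1) v(1)] .
qed simp

instantiation cp2 :: metric_space
begin

definition "dist x y = dist (line_projector x) (line_projector y)"

definition "(uniformity :: (cp2 \<times> cp2) filter) = (INF e\<in>{0 <..}. principal {(x, y). dist x y < e})"

definition "open (U :: cp2 set) = (\<forall>x\<in>U. \<forall>\<^sub>F (x', y) in uniformity. x' = x \<longrightarrow> y \<in> U)"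

instance
proof
  fix x y z :: cp2
  show "dist x y = 0 \<longleftrightarrow> x = y"
    by (simp add: dist_cp2_def line_projector_inject)
  show "dist x y \<le> dist x z + dist y z"
    unfolding dist_cp2_def by (rule dist_triangle2)
qed (rule uniformity_cp2_def open_cp2_def)+

end

lemma continuous_on_abs_cp2: "continuous_on (- {0}) abs_cp2"
proof -
  have *: "continuous_on (- {0}) (\<lambda>v. (\<chi> i j. v $ i * cnj (v $ j) / complex_of_real ((norm v)\<^sup>2)) :: complex^3^3)"
    by (intro continuous_intros) auto
  have "continuous_on (- {0}) (\<lambda>v. line_projector (abs_cp2 v))"
    by (rule continuous_on_eq[OF *]) (simp add: line_projector_abs)
  then show ?thesis
    unfolding continuous_on_iff dist_cp2_def .
qed

lemma open_cp2_iff: "open S \<longleftrightarrow> open {v. v \<noteq> 0 \<and> abs_cp2 v \<in> S}"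
proof
  assume "open S"
  then have "open (abs_cp2 -` S \<inter> - {0})"
    using continuous_on_abs_cp2 continuous_on_open_vimage open_Compl by blast
  moreover have "abs_cp2 -` S \<inter> - {0} = {v. v \<noteq> 0 \<and> abs_cp2 v \<in> S}" by auto
  ultimately show "open {v. v \<noteq> 0 \<and> abs_cp2 v \<in> S}" by simp
next
  assume op: "open {v. v \<noteq> 0 \<and> abs_cp2 v \<in> S}"
  have "closed (- S)"
    unfolding closed_sequential_limits
  proof (intro allI impI, elim conjE)
    fix X l assume X: "\<forall>n. X n \<in> - S" and l: "X \<longlonglongrightarrow> l"
    have "\<exists>v. norm v = 1 \<and> X n = abs_cp2 v" for n
      using cp2_cases by metis
    then obtain v where v: "\<And>n. norm (v n) = 1" "\<And>n. X n = abs_cp2 (v n)" by metis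
    have "\<forall>n. v n \<in> sphere 0 1" using v by simp
    then obtain w r where w: "w \<in> sphere 0 1" "strict_mono (r :: nat \<Rightarrow> nat)" "(v \<circ> r) \<longlonglongrightarrow> w"
      using compact_sphere[of 0 1] unfolding compact_def by metis
    have w0: "w \<in> - {0}" using w by auto
    have "isCont abs_cp2 w"
      using continuous_on_abs_cp2 w0 by (simp add: continuous_on_eq_continuous_at open_Compl)
    then have "(\<lambda>n. abs_cp2 ((v \<circ> r) n)) \<longlonglongrightarrow> abs_cp2 w"
      using w(3) by (rule isCont_tendsto_compose)
    moreover have "(\<lambda>n. abs_cp2 ((v \<circ> r) n)) \<longlonglongrightarrow> l"
      using LIMSEQ_subseq_LIMSEQ[OF l w(2)] v by (simp add: comp_def)
    ultimately have lw: "l = abs_cp2 w" using LIMSEQ_unique by blast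
    show "l \<in> - S"
    proof
      assume "l \<in> S"
      then have "w \<in> {v. v \<noteq> 0 \<and> abs_cp2 v \<in> S}" using w0 lw by auto
      then have "\<forall>\<^sub>F n in sequentially. (v \<circ> r) n \<in> {v. v \<noteq> 0 \<and> abs_cp2 v \<in> S}"
        using topological_tendstoD[OF w(3) op] by blast
      then obtain n where "abs_cp2 (v (r n)) \<in> S"
        by (auto simp: eventually_sequentially)
      then show False using X v by (metis ComplD)
    qed
  qed
  then show "open S" by (simp add: closed_def)
qed

definition embed_cp2 :: "complex \<times> complex \<Rightarrow> cp2" where
  "embed_cp2 = (\<lambda>(z, w). abs_cp2 (vector [1, z, w]))"

definition line_at_infinity :: "cp2 set" where
  "line_at_infinity = {x. \<not> in_chart 1 x}"


section \<open>Holomorphic maps\<close>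

definition holomorphic2_on :: "(complex \<times> complex \<Rightarrow> complex) \<Rightarrow> (complex \<times> complex) set \<Rightarrow> bool"
    (infixl "holomorphic2'_on" 50) where
  "f holomorphic2_on U \<longleftrightarrow>
     (\<forall>p\<in>U. \<exists>a b. (f has_derivative (\<lambda>(x, y). a * x + b * y)) (at p))"

definition biholomorphism ::
    "(complex \<times> complex) set \<Rightarrow> (complex \<times> complex) set \<Rightarrow>
     (complex \<times> complex \<Rightarrow> complex \<times> complex) \<Rightarrow> (complex \<times> complex \<Rightarrow> complex \<times> complex) \<Rightarrow> bool" where
  "biholomorphism U W \<phi> \<psi> \<longleftrightarrow>
     open U \<and> open W \<and> homeomorphism U W \<phi> \<psi> \<and>
     (fst \<circ> \<phi>) holomorphic2_on U \<and> (snd \<circ> \<phi>) holomorphic2_on U \<and>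
     (fst \<circ> \<psi>) holomorphic2_on W \<and> (snd \<circ> \<psi>) holomorphic2_on W"

text \<open>A map into \<open>\<P>\<^sup>2\<close> is holomorphic if it is continuous and its expressions in the standard
  charts are holomorphic. We need open subsets of \<open>\<C>\<^sup>2\<close> and of \<open>\<C>\<close> as domains.\<close>

definition holomorphic_into_cp2 :: "(complex \<times> complex) set \<Rightarrow> (complex \<times> complex \<Rightarrow> cp2) \<Rightarrow> bool" where
  "holomorphic_into_cp2 U h \<longleftrightarrow> open U \<and> continuous_on U h \<and>
     (\<forall>i j. (\<lambda>p. affine_coords i (h p) $ j) holomorphic2_on {p\<in>U. in_chart i (h p)})"

definition holomorphic_curve_cp2 :: "complex set \<Rightarrow> (complex \<Rightarrow> cp2) \<Rightarrow> bool" where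
  "holomorphic_curve_cp2 D h \<longleftrightarrow> open D \<and> continuous_on D h \<and>
     (\<forall>i j. (\<lambda>t. affine_coords i (h t) $ j) holomorphic_on {t\<in>D. in_chart i (h t)})"

text \<open>The complex rank of the differential of \<open>h\<close> at \<open>p\<close>, computed in any chart around \<open>h p\<close>.\<close>

definition generic_rank :: "(complex \<times> complex) set \<Rightarrow> (complex \<times> complex \<Rightarrow> cp2) \<Rightarrow> nat" where
  "generic_rank U h =
     Max {vec.dim (range (frechet_derivative (\<lambda>q. affine_coords i (h q)) (at p))) | i p.
            p \<in> U \<and> in_chart i (h p)}"

text \<open>A subset of \<open>\<ell>\<^sub>\<infinity>\<close> is a hyperbolic Riemann surface if it is open and connected in \<open>\<ell>\<^sub>\<infinity>\<close> and
  has the unit disk as (holomorphic) universal cover; the disk being simply connected, any covering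
  by it is universal.\<close>

definition hyperbolic_at_infinity :: "cp2 set \<Rightarrow> bool" where
  "hyperbolic_at_infinity S \<longleftrightarrow>
     openin (top_of_set line_at_infinity) S \<and> connected S \<and>
     (\<exists>\<pi>. holomorphic_curve_cp2 (ball 0 1) \<pi> \<and> covering_space (ball 0 1) \<pi> S)"


section \<open>Fatou components and limit functions\<close>

type_synonym self_map = "complex \<times> complex \<Rightarrow> complex \<times> complex"

definition uniform_limit_on_compacts ::
    "(complex \<times> complex) set \<Rightarrow> (nat \<Rightarrow> self_map) \<Rightarrow> (complex \<times> complex \<Rightarrow> cp2) \<Rightarrow> bool" where
  "uniform_limit_on_compacts U f h \<longleftrightarrow>
     (\<forall>K. compact K \<and> K \<subseteq> U \<longrightarrow> uniform_limit K (\<lambda>n p. embed_cp2 (f n p)) h sequentially)"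

definition normal_family :: "(complex \<times> complex) set \<Rightarrow> self_map set \<Rightarrow> bool" where
  "normal_family U \<F> \<longleftrightarrow>
     (\<forall>f :: nat \<Rightarrow> self_map. range f \<subseteq> \<F> \<longrightarrow>
        (\<exists>r h. strict_mono r \<and> holomorphic_into_cp2 U h \<and> uniform_limit_on_compacts U (f \<circ> r) h))"

definition Fatou_set :: "self_map \<Rightarrow> (complex \<times> complex) set" where
  "Fatou_set F = {p. \<exists>U. open U \<and> p \<in> U \<and> normal_family U (range (\<lambda>n. F ^^ n))}"

definition Fatou_components :: "self_map \<Rightarrow> (complex \<times> complex) set set" where
  "Fatou_components F = components (Fatou_set F)"

text \<open>Limit functions are taken in \<^term>\<open>extensional V\<close>, so that two of them are equal if and only
  if they agree on \<open>V\<close>.\<close>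

definition limit_functions :: "self_map \<Rightarrow> (complex \<times> complex) set \<Rightarrow> (complex \<times> complex \<Rightarrow> cp2) set" where
  "limit_functions F V =
     {h \<in> extensional V. holomorphic_into_cp2 V h \<and>
        (\<exists>n. filterlim n at_top sequentially \<and> uniform_limit_on_compacts V (\<lambda>j. F ^^ n j) h)}"

definition escaping :: "self_map \<Rightarrow> (complex \<times> complex) set \<Rightarrow> bool" where
  "escaping F V \<longleftrightarrow> (\<forall>h\<in>limit_functions F V. h ` V \<subseteq> line_at_infinity)"

text \<open>A cycle is represented by the set of its components.\<close>

definition is_cycle :: "self_map \<Rightarrow> nat \<Rightarrow> (complex \<times> complex) set set \<Rightarrow> bool" where
  "is_cycle F p \<C> \<longleftrightarrow> p > 0 \<and>
     (\<exists>V. inj_on V {..<p} \<and> \<C> = V ` {..<p} \<and>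
        (\<forall>i<p. V i \<in> Fatou_components F \<and> F ` V i = V (Suc i mod p)))"


section \<open>The maps\<close>

definition linear_coeff :: "nat \<Rightarrow> real \<Rightarrow> complex" where
  "linear_coeff m \<delta> = complex_of_real \<delta> * exp (2 * complex_of_real pi * \<i> / of_nat m)"

definition henon_map :: "nat \<Rightarrow> real \<Rightarrow> self_map" where
  "henon_map m \<delta> = (\<lambda>(z, w). (exp (- (z ^ m)) + linear_coeff m \<delta> * w, z))"

definition linear_part :: "nat \<Rightarrow> real \<Rightarrow> self_map" where
  "linear_part m \<delta> = (\<lambda>(z, w). (linear_coeff m \<delta> * w, z))"

definition half_plane :: "complex set" where
  "half_plane = {z. 0 < Re z}"

end

theory Submission
  imports Defs "HOL-Complex_Analysis.Complex_Analysis"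
begin

text \<open>
  Let \<open>a = \<delta> e\<^bsup>2\<pi>i/m\<^esup>\<close>. The function \<open>e\<^bsup>-z^m\<^esup>\<close> is bounded by 1 on the \<open>m\<close> sectors on which
  \<open>Re z\<^bsup>m\<^esup> > 0\<close>, and multiplication by \<open>a\<close> permutes these sectors cyclically. So \<open>F\<close> maps the
  points deep inside a product of two of them deep inside another such product, and orbits there stay
  close to orbits of \<open>L\<close>; the limit \<open>\<phi>\<close> of \<open>L\<^bsup>-n\<^esup> F\<^bsup>n\<^esup>\<close> (taken along even \<open>n\<close>, where \<open>L\<^bsup>n\<^esup>\<close> is a
  multiple of the identity) exists on the basins and conjugates \<open>F\<close> to \<open>L\<close>. By the Cauchy estimates
  \<open>\<phi> - id\<close> is a contraction far inside, so \<open>\<phi>\<close> maps each of the \<open>m\<^sup>2\<close> basins bijectively onto its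
  product of sectors. The limit functions are \<open>[0 : \<phi>\<^sub>1 : \<phi>\<^sub>2]\<close> and \<open>[0 : a \<phi>\<^sub>2 : \<phi>\<^sub>1]\<close>.

  That a basin is a whole Fatou component is seen on a complex line \<open>c\<close> joining it to a Fatou point in its
  closure. There the ratio \<open>z\<^sub>n / z\<^bsub>n-1\<^esub>\<close> of consecutive coordinates converges along a subsequence, so
  \<open>e\<^bsup>-z\<^sub>n^m\<^esup> = z\<^bsub>n+1\<^esub> - a z\<^bsub>n-1\<^esub>\<close> is at most of the size of \<open>z\<^sub>n\<close>, which confines \<open>arg z\<^sub>n\<^bsup>m\<^esup>\<close> to
  \<open>[-\<pi>/2, \<pi>/2]\<close> in the limit. Since \<open>arg z\<^sub>n\<^bsup>m\<^esup>\<close> is harmonic and is strictly inside this interval in the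
  basin, it is so everywhere, and the orbit enters the absorbing region. The points where the limiting
  ratio is \<open>0\<close> or \<open>\<infinity>\<close> are isolated on the line and excluded by the open mapping theorem.
\<close>

section \<open>Holomorphic functions of two variables\<close>

text \<open>The hypothesis on \<delta> enters in two estimates. It gives
  \<open>\<delta> * T - 1 \<ge> T\<close> for \<open>T \<ge> 1\<close>, so that points of depth over
  1 survive a perturbation of size 1, and it bounds the tails of the series behind \<phi> by 1. On
  pairs of sector indices modulo m, F acts by (j, k) -> (k + 1, j). The limit sets of basin (j, k)
  depend on j - k alone, which alternates between d and 1 - d along a cycle. So the question whether
  m divides 2 d - 1 settles both the period of the cycle and whether its two limit sets agree. The
  obstacle is maximality of the basins: normality at a boundary point yields limits in the
  projective plane without any information about sectors. It is enough that a basin is relatively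
  closed in the Fatou set, and this can be tested on one line at a time, where Montel's theorem, the
  identity theorem and the maximum principle are available in one variable. Limits at three
  consecutive times are taken along one subsequence, because the size of the exponential at one time
  is read off from the coordinates before and after it.\<close>

lemma holomorphic2_onI:
  assumes "\<And>p. p \<in> U \<Longrightarrow> \<exists>D. (f has_derivative D) (at p) \<and> (\<forall>c v w. D (c * v, c * w) = c * D (v, w))"
  shows "f holomorphic2_on U"
  unfolding holomorphic2_on_def
proof
  fix p assume "p \<in> U"
  then obtain D where D: "(f has_derivative D) (at p)" "\<And>c v w. D (c * v, c * w) = c * D (v, w)"
    using assms by blast
  interpret bounded_linear D using D(1) by (rule has_derivative_bounded_linear)
  have "D (x, y) = D (1, 0) * x + D (0, 1) * y" for x y
    using add[of "(x, 0)" "(0, y)"] D(2)[of x 1 0] D(2)[of y 0 1] by (simp add: mult.commute)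
  then have "D = (\<lambda>(x, y). D (1, 0) * x + D (0, 1) * y)" by (intro ext) (metis case_prod_conv surj_pair)
  then show "\<exists>a b. (f has_derivative (\<lambda>(x, y). a * x + b * y)) (at p)"
    using D(1) by metis
qed

text \<open>Together with the introduction rule this trades the two coefficients for complex
  homogeneity of the differential. The closure properties below then follow from the real derivative
  rules, since homogeneity passes through sums, products and compositions.\<close>

lemma holomorphic2_onD:
  assumes "f holomorphic2_on U" "p \<in> U"
  shows "\<exists>D. (f has_derivative D) (at p) \<and> (\<forall>c v w. D (c * v, c * w) = c * D (v, w))"
proof -
  obtain a b where "(f has_derivative (\<lambda>(x, y). a * x + b * y)) (at p)"
    using assms unfolding holomorphic2_on_def by blast
  then show ?thesis by (intro exI conjI) (auto simp: algebra_simps)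
qed

lemma holomorphic2_on_subset: "f holomorphic2_on U \<Longrightarrow> V \<subseteq> U \<Longrightarrow> f holomorphic2_on V"
  unfolding holomorphic2_on_def by blast

lemma holomorphic2_on_imp_continuous_on: "f holomorphic2_on U \<Longrightarrow> continuous_on U f"
  unfolding holomorphic2_on_def
  by (meson continuous_at_imp_continuous_on has_derivative_continuous)

lemma holomorphic2_on_transform:
  assumes "f holomorphic2_on U" "open U" "\<And>p. p \<in> U \<Longrightarrow> f p = g p"
  shows "g holomorphic2_on U"
  unfolding holomorphic2_on_def
proof
  fix p assume p: "p \<in> U"
  then obtain a b where "(f has_derivative (\<lambda>(x, y). a * x + b * y)) (at p)"
    using assms(1) unfolding holomorphic2_on_def by blast
  then have "(g has_derivative (\<lambda>(x, y). a * x + b * y)) (at p)"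
    by (rule has_derivative_transform_within_open[OF _ assms(2) p assms(3)])
  then show "\<exists>a b. (g has_derivative (\<lambda>(x, y). a * x + b * y)) (at p)" by (intro exI)
qed

lemma holomorphic2_on_const: "(\<lambda>_. c) holomorphic2_on U"
  by (rule holomorphic2_onI, rule exI[of _ "\<lambda>_. 0"]) simp

lemma holomorphic2_on_fst: "fst holomorphic2_on U"
  by (rule holomorphic2_onI, rule exI[of _ fst]) (simp add: bounded_linear_fst bounded_linear_imp_has_derivative)

lemma holomorphic2_on_snd: "snd holomorphic2_on U"
  by (rule holomorphic2_onI, rule exI[of _ snd]) (simp add: bounded_linear_snd bounded_linear_imp_has_derivative)

lemma holomorphic2_on_compose:
  assumes f: "f holomorphic2_on U" and g: "g holomorphic_on V" and "open V"
    and "\<And>p. p \<in> U \<Longrightarrow> f p \<in> V"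
  shows "(\<lambda>p. g (f p)) holomorphic2_on U"
proof (rule holomorphic2_onI)
  fix p assume p: "p \<in> U"
  obtain D where D: "(f has_derivative D) (at p)" "\<And>c v w. D (c * v, c * w) = c * D (v, w)"
    using holomorphic2_onD[OF f p] by blast
  have "(g has_field_derivative deriv g (f p)) (at (f p))"
    using assms p by (simp add: holomorphic_derivI)
  then have "((\<lambda>p. g (f p)) has_derivative (\<lambda>x. deriv g (f p) * D x)) (at p)"
    using has_derivative_compose[OF D(1)] by (simp add: has_field_derivative_def)
  then show "\<exists>D. ((\<lambda>p. g (f p)) has_derivative D) (at p) \<and> (\<forall>c v w. D (c * v, c * w) = c * D (v, w))"
    using D(2) by (intro exI[of _ "\<lambda>x. deriv g (f p) * D x"]) (simp add: algebra_simps)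
qed

lemma holomorphic2_on_pair_compose:
  assumes f: "f holomorphic2_on V" and g: "g1 holomorphic2_on U" "g2 holomorphic2_on U"
    and sub: "\<And>p. p \<in> U \<Longrightarrow> (g1 p, g2 p) \<in> V"
  shows "(\<lambda>p. f (g1 p, g2 p)) holomorphic2_on U"
proof (rule holomorphic2_onI)
  fix p assume p: "p \<in> U"
  obtain D1 where D1: "(g1 has_derivative D1) (at p)" "\<And>c v w. D1 (c * v, c * w) = c * D1 (v, w)"
    using holomorphic2_onD[OF g(1) p] by blast
  obtain D2 where D2: "(g2 has_derivative D2) (at p)" "\<And>c v w. D2 (c * v, c * w) = c * D2 (v, w)"
    using holomorphic2_onD[OF g(2) p] by blast
  obtain D where D: "(f has_derivative D) (at (g1 p, g2 p))" "\<And>c v w. D (c * v, c * w) = c * D (v, w)"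
    using holomorphic2_onD[OF f sub[OF p]] by blast
  have "((\<lambda>p. f (g1 p, g2 p)) has_derivative (\<lambda>x. D (D1 x, D2 x))) (at p)"
    by (rule has_derivative_compose[OF has_derivative_Pair[OF D1(1) D2(1)]])
      (simp add: D(1))
  then show "\<exists>D. ((\<lambda>p. f (g1 p, g2 p)) has_derivative D) (at p) \<and> (\<forall>c v w. D (c * v, c * w) = c * D (v, w))"
    by (intro exI conjI, assumption) (simp add: D(2) D1(2) D2(2))
qed

lemma holomorphic2_on_slice:
  assumes f: "f holomorphic2_on V" and g: "g1 holomorphic_on U" "g2 holomorphic_on U" and "open U"
    and sub: "\<And>t. t \<in> U \<Longrightarrow> (g1 t, g2 t) \<in> V"
  shows "(\<lambda>t. f (g1 t, g2 t)) holomorphic_on U"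
  unfolding holomorphic_on_open[OF \<open>open U\<close>]
proof
  fix t assume t: "t \<in> U"
  obtain a b where D: "(f has_derivative (\<lambda>(x, y). a * x + b * y)) (at (g1 t, g2 t))"
    using f sub[OF t] unfolding holomorphic2_on_def by blast
  have g': "(g1 has_derivative (\<lambda>x. deriv g1 t * x)) (at t)" "(g2 has_derivative (\<lambda>x. deriv g2 t * x)) (at t)"
    using g \<open>open U\<close> t by (auto simp: holomorphic_derivI simp flip: has_field_derivative_def)
  have "((\<lambda>t. f (g1 t, g2 t)) has_derivative (\<lambda>x. case (deriv g1 t * x, deriv g2 t * x) of (x, y) \<Rightarrow> a * x + b * y)) (at t)"
    by (rule has_derivative_compose[OF has_derivative_Pair[OF g']]) (use D in simp)
  then have "((\<lambda>t. f (g1 t, g2 t)) has_field_derivative (a * deriv g1 t + b * deriv g2 t)) (at t)"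
    unfolding has_field_derivative_def by (rule has_derivative_eq_rhs) (auto simp: algebra_simps)
  then show "\<exists>f'. ((\<lambda>t. f (g1 t, g2 t)) has_field_derivative f') (at t)" ..
qed

lemma holomorphic2_on_add:
  assumes "f holomorphic2_on U" "g holomorphic2_on U"
  shows "(\<lambda>p. f p + g p) holomorphic2_on U"
proof (rule holomorphic2_onI)
  fix p assume p: "p \<in> U"
  obtain D1 where D1: "(f has_derivative D1) (at p)" "\<And>c v w. D1 (c * v, c * w) = c * D1 (v, w)"
    using holomorphic2_onD[OF assms(1) p] by blast
  obtain D2 where D2: "(g has_derivative D2) (at p)" "\<And>c v w. D2 (c * v, c * w) = c * D2 (v, w)"
    using holomorphic2_onD[OF assms(2) p] by blast
  show "\<exists>D. ((\<lambda>p. f p + g p) has_derivative D) (at p) \<and> (\<forall>c v w. D (c * v, c * w) = c * D (v, w))"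
    by (intro exI conjI, rule has_derivative_add[OF D1(1) D2(1)]) (simp add: D1(2) D2(2) algebra_simps)
qed

lemma holomorphic2_on_mult:
  assumes "f holomorphic2_on U" "g holomorphic2_on U"
  shows "(\<lambda>p. f p * g p) holomorphic2_on U"
proof (rule holomorphic2_onI)
  fix p assume p: "p \<in> U"
  obtain D1 where D1: "(f has_derivative D1) (at p)" "\<And>c v w. D1 (c * v, c * w) = c * D1 (v, w)"
    using holomorphic2_onD[OF assms(1) p] by blast
  obtain D2 where D2: "(g has_derivative D2) (at p)" "\<And>c v w. D2 (c * v, c * w) = c * D2 (v, w)"
    using holomorphic2_onD[OF assms(2) p] by blast
  show "\<exists>D. ((\<lambda>p. f p * g p) has_derivative D) (at p) \<and> (\<forall>c v w. D (c * v, c * w) = c * D (v, w))"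
    by (intro exI conjI, rule has_derivative_mult[OF D1(1) D2(1)]) (simp add: D1(2) D2(2) algebra_simps)
qed

lemma holomorphic2_on_diff:
  assumes "f holomorphic2_on U" "g holomorphic2_on U"
  shows "(\<lambda>p. f p - g p) holomorphic2_on U"
  using holomorphic2_on_add[OF assms(1) holomorphic2_on_mult[OF holomorphic2_on_const[of "-1"] assms(2)]]
  by simp

lemma holomorphic2_on_divide:
  assumes "f holomorphic2_on U" "g holomorphic2_on U" "\<And>p. p \<in> U \<Longrightarrow> g p \<noteq> 0"
  shows "(\<lambda>p. f p / g p) holomorphic2_on U"
proof -
  have "(\<lambda>p. inverse (g p)) holomorphic2_on U"
    by (rule holomorphic2_on_compose[OF assms(2), where V = "- {0}"])
      (use assms(3) in \<open>auto intro: holomorphic_on_inverse holomorphic_on_ident\<close>)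
  then show ?thesis
    using holomorphic2_on_mult[OF assms(1)] by (simp add: divide_inverse)
qed

lemma open_Pair_slice:
  assumes "open U"
  shows "open {x. (x, y) \<in> U}" "open {y. (x, y) \<in> U}"
proof -
  have "open ((\<lambda>x. (x, y)) -` U)" "open ((\<lambda>y. (x, y)) -` U)"
    by (intro open_vimage assms continuous_intros)+
  then show "open {x. (x, y) \<in> U}" "open {y. (x, y) \<in> U}"
    by (simp_all add: vimage_def)
qed

lemma holomorphic2_on_Pair_holomorphic:
  assumes "f holomorphic2_on U" "open U"
  shows "(\<lambda>x. f (x, y)) holomorphic_on {x. (x, y) \<in> U}" "(\<lambda>y. f (x, y)) holomorphic_on {y. (x, y) \<in> U}"
proof -
  show "(\<lambda>x. f (x, y)) holomorphic_on {x. (x, y) \<in> U}"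
    by (intro holomorphic2_on_slice[OF assms(1)] open_Pair_slice assms(2)) (auto intro!: holomorphic_intros)
  show "(\<lambda>y. f (x, y)) holomorphic_on {y. (x, y) \<in> U}"
    by (intro holomorphic2_on_slice[OF assms(1)] open_Pair_slice assms(2)) (auto intro!: holomorphic_intros)
qed

lemma open_Pair_cball:
  fixes p :: "complex \<times> complex"
  assumes "open U" "p \<in> U"
  obtains r where "r > 0" "cball (fst p) r \<times> cball (snd p) r \<subseteq> U"
proof -
  obtain S T where ST: "open S" "open T" "fst p \<in> S" "snd p \<in> T" "S \<times> T \<subseteq> U"
    using open_prod_elim[OF assms] by (metis mem_Times_iff)
  obtain r1 r2 where "r1 > 0" "cball (fst p) r1 \<subseteq> S" "r2 > 0" "cball (snd p) r2 \<subseteq> T"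
    using ST by (meson open_contains_cball_eq)
  then show ?thesis
    using ST(5) by (intro that[of "min r1 r2"]) (auto simp: subset_iff)
qed

text \<open>Osgood's lemma. Continuity of the partial derivative in the second variable
  comes from the Cauchy estimate for differences.\<close>

lemma continuous_separately_holomorphic_imp_holomorphic2:
  assumes "open U" and cont: "continuous_on U f"
    and hx: "\<And>y. (\<lambda>x. f (x, y)) holomorphic_on {x. (x, y) \<in> U}"
    and hy: "\<And>x. (\<lambda>y. f (x, y)) holomorphic_on {y. (x, y) \<in> U}"
  shows "f holomorphic2_on U"
  unfolding holomorphic2_on_def
proof
  fix p assume "p \<in> U"
  then obtain r where r: "r > 0" "cball (fst p) r \<times> cball (snd p) r \<subseteq> U"
    using open_Pair_cball[OF \<open>open U\<close>] by blast
  obtain x0 y0 where p: "p = (x0, y0)" by (cases p)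
  have sub: "cball x0 r \<times> cball y0 r \<subseteq> U" using r p by simp
  define X where "X = ball x0 r"
  define Y where "Y = ball y0 (r/2)"
  have hol: "(\<lambda>y. f (x, y)) holomorphic_on ball y0 r" if "x \<in> cball x0 r" for x
    by (rule holomorphic_on_subset[OF hy[of x]]) (use sub that in auto)
  have contb: "continuous_on (cball x0 r \<times> cball y0 r) f"
    using cont sub continuous_on_subset by blast
  have unif: "uniformly_continuous_on (cball x0 r \<times> cball y0 r) f"
    by (intro compact_uniformly_continuous contb compact_Times compact_cball)
  define g where "g = (\<lambda>x y. deriv (\<lambda>y. f (x, y)) y)"
  have g_cont: "((\<lambda>(x, y). g x y) \<longlongrightarrow> g x0 y0) (at (x0, y0) within X \<times> Y)"
    unfolding tendsto_iff
  proof (intro allI impI)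
    fix e :: real assume "e > 0"
    \<comment> \<open>The Cauchy estimate is applied on discs of radius r/4, so a difference of size
      e' in the values costs 4 e' / r = e/4 in the derivative. Such discs around points of Y stay
      inside the disc of radius r.\<close>
    define e' where "e' = e * r / 16"
    have "e' > 0" using \<open>e > 0\<close> r by (simp add: e'_def)
    with unif obtain d where d: "d > 0"
      "\<And>q q'. q \<in> cball x0 r \<times> cball y0 r \<Longrightarrow> q' \<in> cball x0 r \<times> cball y0 r \<Longrightarrow> dist q' q < d \<Longrightarrow> dist (f q') (f q) < e'"
      unfolding uniformly_continuous_on_def by metis
    have est: "cmod (g x y - g x0 y) < e / 2" if "x \<in> X" "y \<in> Y" "dist x x0 < d" for x y
    proof -
      have xb: "x \<in> cball x0 r" "x0 \<in> cball x0 r" using that r by (auto simp: X_def)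
      have yb: "cball y (r/4) \<subseteq> ball y0 r"
      proof
        fix w assume "w \<in> cball y (r/4)"
        then show "w \<in> ball y0 r"
          using that r dist_triangle[of y0 w y] by (auto simp: Y_def)
      qed
      have y: "y \<in> ball y0 r" using that r by (auto simp: Y_def)
      have h: "(\<lambda>y. f (x, y) - f (x0, y)) holomorphic_on ball y0 r"
        by (intro holomorphic_intros hol xb)
      have "cmod ((deriv ^^ 1) (\<lambda>y. f (x, y) - f (x0, y)) y) \<le> fact 1 * e' / (r/4) ^ 1"
      proof (rule Cauchy_inequality)
        show "(\<lambda>y. f (x, y) - f (x0, y)) holomorphic_on ball y (r/4)"
          using holomorphic_on_subset[OF h] yb by (meson ball_subset_cball order_trans)
        show "continuous_on (cball y (r/4)) (\<lambda>y. f (x, y) - f (x0, y))"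
          using holomorphic_on_imp_continuous_on[OF holomorphic_on_subset[OF h yb]] .
        fix w assume "cmod (y - w) = r/4"
        then have "w \<in> cball y (r/4)" by (simp add: dist_norm)
        then have "w \<in> cball y0 r" using yb by auto
        then have "dist (f (x, w)) (f (x0, w)) < e'"
          using xb that by (intro d) (auto simp: dist_prod_def)
        then show "cmod (f (x, w) - f (x0, w)) \<le> e'" by (simp add: dist_norm)
      qed (use r in auto)
      also have "(deriv ^^ 1) (\<lambda>y. f (x, y) - f (x0, y)) y = g x y - g x0 y"
        unfolding g_def
        using holomorphic_on_imp_differentiable_at[OF hol[OF xb(1)] open_ball y]
          holomorphic_on_imp_differentiable_at[OF hol[OF xb(2)] open_ball y] by simp
      also have "fact 1 * e' / (r/4) ^ 1 < e / 2" using r \<open>e > 0\<close> by (simp add: e'_def)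
      finally show ?thesis .
    qed
    have "deriv (\<lambda>y. f (x0, y)) holomorphic_on ball y0 r"
      by (intro holomorphic_deriv hol) (use r in auto)
    then have "isCont (g x0) y0"
      unfolding g_def using r by (metis centre_in_ball continuous_on_interior holomorphic_on_imp_continuous_on interior_ball)
    then obtain d' where d': "d' > 0" "\<And>y. dist y y0 < d' \<Longrightarrow> dist (g x0 y) (g x0 y0) < e / 2"
      unfolding continuous_at_eps_delta using \<open>e > 0\<close> by (meson half_gt_zero)
    have "dist (g x y) (g x0 y0) < e" if "(x, y) \<in> X \<times> Y" "dist (x, y) (x0, y0) < min d d'" for x y
    proof -
      have *: "dist x x0 < d" "dist y y0 < d'"
        using that dist_fst_le[of "(x, y)" "(x0, y0)"] dist_snd_le[of "(x, y)" "(x0, y0)"] by auto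
      then show ?thesis
        using est[of x y] d'(2)[of y] that dist_triangle[of "g x y" "g x0 y0" "g x0 y"] by (auto simp: dist_norm)
    qed
    then show "\<forall>\<^sub>F q in at (x0, y0) within X \<times> Y. dist (case q of (x, y) \<Rightarrow> g x y) (g x0 y0) < e"
      unfolding eventually_at using d(1) d'(1) by (intro exI[of _ "min d d'"]) auto
  qed
  have "((\<lambda>x. f (x, y0)) has_derivative (\<lambda>v. deriv (\<lambda>x. f (x, y0)) x0 * v)) (at x0)"
  proof -
    have "(\<lambda>x. f (x, y0)) holomorphic_on X"
      by (rule holomorphic_on_subset[OF hx[of y0]]) (use sub r in \<open>auto simp: X_def\<close>)
    then show ?thesis
      unfolding X_def using r by (simp add: holomorphic_derivI flip: has_field_derivative_def)
  qed
  then have fx: "((\<lambda>x. f (x, y0)) has_derivative (\<lambda>v. deriv (\<lambda>x. f (x, y0)) x0 * v)) (at x0 within X)"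
    by (rule has_derivative_at_withinI)
  have fy: "((\<lambda>y. f (x, y)) has_derivative blinfun_apply (blinfun_mult_right (g x y))) (at y within Y)"
    if "x \<in> X" "y \<in> Y" for x y
  proof -
    have "((\<lambda>y. f (x, y)) has_field_derivative g x y) (at y)"
      unfolding g_def by (rule holomorphic_derivI[OF hol]) (use that r in \<open>auto simp: X_def Y_def\<close>)
    then have "((\<lambda>y. f (x, y)) has_derivative (*) (g x y)) (at y)"
      by (simp add: has_field_derivative_def)
    then show ?thesis
      by (auto intro: has_derivative_at_withinI)
  qed
  have "((\<lambda>(x, y). f (x, y)) has_derivative
      (\<lambda>(tx, ty). deriv (\<lambda>x. f (x, y0)) x0 * tx + blinfun_apply (blinfun_mult_right (g x0 y0)) ty)) (at (x0, y0) within X \<times> Y)"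
  proof (rule has_derivative_partialsI[where f = "\<lambda>x y. f (x, y)" and x = x0 and y = y0 and
        fy = "\<lambda>x y. blinfun_mult_right (g x y)", OF fx fy])
    show "continuous (at (x0, y0) within X \<times> Y) (\<lambda>(x, y). blinfun_mult_right (g x y))"
      unfolding continuous_within using bounded_linear.tendsto[OF bounded_linear_blinfun_mult_right g_cont]
      by (simp add: case_prod_unfold)
  qed (use r in \<open>auto simp: Y_def\<close>)
  moreover have "at (x0, y0) within X \<times> Y = at (x0, y0)"
    by (rule at_within_open) (use r in \<open>auto simp: X_def Y_def open_Times\<close>)
  ultimately show "\<exists>a b. (f has_derivative (\<lambda>(x, y). a * x + b * y)) (at p)"
    unfolding p by auto
qed

text \<open>Weierstrass's theorem: Osgood's lemma reduces it to one variable, and the compact sets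
  \<open>cball x d \<times> {y}\<close> and \<open>{x} \<times> cball y d\<close> carry the uniform
  convergence over to the slices.\<close>

lemma holomorphic2_on_uniform_limit:
  assumes "open U" and f: "\<And>n. f n holomorphic2_on U"
    and lim: "\<And>K. compact K \<Longrightarrow> K \<subseteq> U \<Longrightarrow> uniform_limit K f g sequentially"
  shows "g holomorphic2_on U"
proof (rule continuous_separately_holomorphic_imp_holomorphic2[OF \<open>open U\<close>])
  show "continuous_on U g"
    unfolding continuous_on_eq_continuous_at[OF \<open>open U\<close>]
  proof
    fix p assume "p \<in> U"
    then obtain r where r: "r > 0" "cball p r \<subseteq> U" using \<open>open U\<close> open_contains_cball by blast
    have "continuous_on (cball p r) g"
      using lim[OF compact_cball r(2)] f r(2)
      by (intro uniform_limit_theorem[where f = f and F = sequentially])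
        (auto intro!: always_eventually continuous_on_subset[OF holomorphic2_on_imp_continuous_on])
    then show "isCont g p"
      using r by (metis centre_in_ball continuous_on_interior interior_cball)
  qed
next
  fix y
  have o: "open {x. (x, y) \<in> U}"
    by (rule open_Pair_slice[OF assms(1)])
  show "(\<lambda>x. g (x, y)) holomorphic_on {x. (x, y) \<in> U}"
  proof (rule holomorphic_uniform_sequence[OF o, of "\<lambda>n x. f n (x, y)"])
    show "(\<lambda>x. f n (x, y)) holomorphic_on {x. (x, y) \<in> U}" for n
      using holomorphic2_on_Pair_holomorphic(1)[OF f \<open>open U\<close>] .
    fix x assume "x \<in> {x. (x, y) \<in> U}"
    then obtain d where d: "d > 0" "cball x d \<subseteq> {x. (x, y) \<in> U}"
      using o open_contains_cball by blast
    have "uniform_limit (cball x d \<times> {y}) f g sequentially"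
      using d(2) by (intro lim compact_Times) auto
    then have "uniform_limit (cball x d) (\<lambda>n x. f n (x, y)) (\<lambda>x. g (x, y)) sequentially"
      by (simp add: uniform_limit_iff)
    then show "\<exists>d>0. cball x d \<subseteq> {x. (x, y) \<in> U} \<and> uniform_limit (cball x d) (\<lambda>n x. f n (x, y)) (\<lambda>x. g (x, y)) sequentially"
      using d by blast
  qed
next
  fix x
  have o: "open {y. (x, y) \<in> U}"
    by (rule open_Pair_slice[OF assms(1)])
  show "(\<lambda>y. g (x, y)) holomorphic_on {y. (x, y) \<in> U}"
  proof (rule holomorphic_uniform_sequence[OF o, of "\<lambda>n y. f n (x, y)"])
    show "(\<lambda>y. f n (x, y)) holomorphic_on {y. (x, y) \<in> U}" for n
      using holomorphic2_on_Pair_holomorphic(2)[OF f \<open>open U\<close>] .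
    fix y assume "y \<in> {y. (x, y) \<in> U}"
    then obtain d where d: "d > 0" "cball y d \<subseteq> {y. (x, y) \<in> U}"
      using o open_contains_cball by blast
    have "uniform_limit ({x} \<times> cball y d) f g sequentially"
      using d(2) by (intro lim compact_Times) auto
    then have "uniform_limit (cball y d) (\<lambda>n y. f n (x, y)) (\<lambda>y. g (x, y)) sequentially"
      by (simp add: uniform_limit_iff)
    then show "\<exists>d>0. cball y d \<subseteq> {y. (x, y) \<in> U} \<and> uniform_limit (cball y d) (\<lambda>n y. f n (x, y)) (\<lambda>y. g (x, y)) sequentially"
      using d by blast
  qed
qed

section \<open>Sectors\<close>

text \<open>For \<open>0 < \<gamma> \<le> \<pi>/2\<close> this is positive exactly on the sector \<open>\<bar>Arg z\<bar> < \<gamma>\<close>, where it is the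
  distance to the boundary.\<close>

definition depth :: "real \<Rightarrow> complex \<Rightarrow> real" where
  "depth \<gamma> z = sin \<gamma> * Re z - cos \<gamma> * \<bar>Im z\<bar>"

lemma depth_polar: "depth \<gamma> z = cmod z * sin (\<gamma> - \<bar>Arg z\<bar>)"
proof -
  have *: "Re z = cmod z * cos (Arg z)" "Im z = cmod z * sin (Arg z)"
    using rcis_cmod_Arg[of z] by (metis Re_rcis, metis Im_rcis)
  have "\<bar>sin (Arg z)\<bar> = sin \<bar>Arg z\<bar>"
    using Arg_bounded[of z] sin_ge_zero[of "Arg z"] sin_ge_zero[of "- Arg z"]
    by (cases "Arg z \<ge> 0") auto
  moreover have "cos (Arg z) = cos \<bar>Arg z\<bar>" by (simp add: abs_if)
  ultimately show ?thesis
    unfolding depth_def *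
    by (simp add: abs_mult sin_diff algebra_simps)
qed

lemma depth_pos_iff:
  assumes "0 < \<gamma>" "\<gamma> \<le> pi / 2"
  shows "depth \<gamma> z > 0 \<longleftrightarrow> z \<noteq> 0 \<and> \<bar>Arg z\<bar> < \<gamma>"
proof -
  have b: "\<bar>Arg z\<bar> \<le> pi" using Arg_bounded[of z] by auto
  have "sin (\<gamma> - \<bar>Arg z\<bar>) > 0 \<longleftrightarrow> \<bar>Arg z\<bar> < \<gamma>"
  proof
    assume "\<bar>Arg z\<bar> < \<gamma>"
    then show "sin (\<gamma> - \<bar>Arg z\<bar>) > 0" using assms by (intro sin_gt_zero) auto
  next
    assume *: "sin (\<gamma> - \<bar>Arg z\<bar>) > 0"
    show "\<bar>Arg z\<bar> < \<gamma>"
    proof (rule ccontr)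
      assume "\<not> \<bar>Arg z\<bar> < \<gamma>"
      then have "sin (\<bar>Arg z\<bar> - \<gamma>) \<ge> 0" using assms b by (intro sin_ge_zero) auto
      moreover have "sin (\<gamma> - \<bar>Arg z\<bar>) = - sin (\<bar>Arg z\<bar> - \<gamma>)" by (metis minus_diff_eq sin_minus)
      ultimately show False using * by linarith
    qed
  qed
  then show ?thesis unfolding depth_polar by (auto simp: zero_less_mult_iff)
qed

lemma continuous_on_depth [continuous_intros]:
  "continuous_on A f \<Longrightarrow> continuous_on A (\<lambda>x. depth \<gamma> (f x))"
  unfolding depth_def by (intro continuous_intros)

lemma depth_scaleR: "r \<ge> 0 \<Longrightarrow> depth \<gamma> (of_real r * z) = r * depth \<gamma> z"
  by (simp add: depth_def algebra_simps abs_mult)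

text \<open>The distance to the boundary of a convex cone is superadditive; here it is the triangle
  inequality for the imaginary parts. Convexity of the absorbing regions and their stability under
  small perturbations both come from this.\<close>

lemma depth_add:
  assumes "0 \<le> cos \<gamma>"
  shows "depth \<gamma> (z + w) \<ge> depth \<gamma> z + depth \<gamma> w"
proof -
  have "cos \<gamma> * \<bar>Im z + Im w\<bar> \<le> cos \<gamma> * (\<bar>Im z\<bar> + \<bar>Im w\<bar>)"
    by (intro mult_left_mono assms abs_triangle_ineq)
  then show ?thesis by (simp add: depth_def algebra_simps)
qed

lemma depth_abs_le: "\<bar>depth \<gamma> z\<bar> \<le> cmod z"
  unfolding depth_polar by (simp add: abs_mult mult_left_le)

lemma depth_add_ge:
  assumes "0 \<le> cos \<gamma>"
  shows "depth \<gamma> (z + w) \<ge> depth \<gamma> z - cmod w"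
  using depth_add[OF assms, of z w] depth_abs_le[of \<gamma> w] by linarith

lemma convex_depth:
  assumes "0 \<le> cos \<gamma>"
  shows "convex {z. depth \<gamma> z > T}" "convex {z. depth \<gamma> z \<ge> T}"
proof -
  have *: "depth \<gamma> (u *\<^sub>R z + v *\<^sub>R w) \<ge> u * depth \<gamma> z + v * depth \<gamma> w" if "u \<ge> 0" "v \<ge> 0" for u v z w
    using depth_add[OF assms, of "u *\<^sub>R z" "v *\<^sub>R w"] that
    by (simp add: scaleR_conv_of_real depth_scaleR)
  show "convex {z. depth \<gamma> z \<ge> T}"
    unfolding convex_def
  proof clarify
    fix z w u v :: _ assume h: "T \<le> depth \<gamma> z" "T \<le> depth \<gamma> w" "0 \<le> (u::real)" "0 \<le> v" "u + v = 1"
    have "T = u * T + v * T" using h by (simp flip: distrib_right)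
    also have "\<dots> \<le> u * depth \<gamma> z + v * depth \<gamma> w" using h by (intro add_mono mult_left_mono)
    finally show "T \<le> depth \<gamma> (u *\<^sub>R z + v *\<^sub>R w)" using *[of u v z w] h by linarith
  qed
  show "convex {z. depth \<gamma> z > T}"
    unfolding convex_def
  proof clarify
    fix z w u v :: _ assume h: "T < depth \<gamma> z" "T < depth \<gamma> w" "0 \<le> (u::real)" "0 \<le> v" "u + v = 1"
    have "T < u * depth \<gamma> z + v * depth \<gamma> w"
      using convex_bound_lt[of "- depth \<gamma> z" "- T" "- depth \<gamma> w" u v] h by simp
    then show "T < depth \<gamma> (u *\<^sub>R z + v *\<^sub>R w)" using *[of u v z w] h by linarith
  qed
qed

lemma open_depth: "open {z. depth \<gamma> z > T}"
  by (intro open_Collect_less continuous_intros)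

lemma of_nat_mult_Arg_power:
  assumes "real n * \<bar>Arg z\<bar> < pi" "z \<noteq> 0"
  shows "Arg (z ^ n) = real n * Arg z"
proof -
  have "z ^ n = rcis (cmod z ^ n) (real n * Arg z)"
    by (metis DeMoivre2 rcis_cmod_Arg)
  moreover have "\<bar>real n * Arg z\<bar> < pi" using assms by (simp add: abs_mult)
  ultimately show ?thesis using assms
    by (metis (no_types, lifting) Arg_rcis abs_less_iff greaterThanAtMost_iff less_imp_le minus_less_iff zero_less_norm_iff zero_less_power)
qed

lemma Re_pos_iff_Arg: "Re z > 0 \<longleftrightarrow> z \<noteq> 0 \<and> \<bar>Arg z\<bar> < pi / 2"
  using depth_pos_iff[of "pi/2" z] by (simp add: depth_def)

text \<open>The principal branch of the power with exponent 2\<gamma>/\<pi>, which takes arguments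
  in (-\<pi>/2, \<pi>/2) to (-\<gamma>, \<gamma>). The next definition is the reciprocal
  power.\<close>

definition half_plane_to_sector :: "real \<Rightarrow> complex \<Rightarrow> complex" where
  "half_plane_to_sector \<gamma> z = exp (of_real (2 * \<gamma> / pi) * Ln z)"

definition sector_to_half_plane :: "real \<Rightarrow> complex \<Rightarrow> complex" where
  "sector_to_half_plane \<gamma> z = exp (of_real (pi / (2 * \<gamma>)) * Ln z)"

lemma sector_maps:
  assumes "0 < \<gamma>" "\<gamma> \<le> pi / 2"
  shows "Re z > 0 \<Longrightarrow> depth \<gamma> (half_plane_to_sector \<gamma> z) > 0"
    and "Re z > 0 \<Longrightarrow> sector_to_half_plane \<gamma> (half_plane_to_sector \<gamma> z) = z"
    and "depth \<gamma> z > 0 \<Longrightarrow> Re (sector_to_half_plane \<gamma> z) > 0"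
    and "depth \<gamma> z > 0 \<Longrightarrow> half_plane_to_sector \<gamma> (sector_to_half_plane \<gamma> z) = z"
proof -
  have pi: "pi > 0" by simp
  show 1: "depth \<gamma> (half_plane_to_sector \<gamma> z) > 0" "sector_to_half_plane \<gamma> (half_plane_to_sector \<gamma> z) = z" if "Re z > 0"
  proof -
    have z: "z \<noteq> 0" "\<bar>Arg z\<bar> < pi / 2" using that Re_pos_iff_Arg by auto
    define u where "u = of_real (2 * \<gamma> / pi) * Ln z"
    have "Im u = (2 * \<gamma> / pi) * Arg z" using z by (simp add: u_def Arg_eq_Im_Ln)
    then have "\<bar>Im u\<bar> = (2 * \<gamma> / pi) * \<bar>Arg z\<bar>" using assms by (simp add: abs_mult)
    also have "\<dots> < (2 * \<gamma> / pi) * (pi / 2)" using assms z by (intro mult_strict_left_mono) auto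
    finally have Im: "\<bar>Im u\<bar> < \<gamma>" by simp
    then have a: "Arg (exp u) = Im u" "Ln (exp u) = u" using assms pi by (auto intro!: Arg_exp Ln_exp simp del: pi_gt_zero)
    show "depth \<gamma> (half_plane_to_sector \<gamma> z) > 0"
      unfolding depth_pos_iff[OF assms] half_plane_to_sector_def using a Im by (simp add: u_def)
    show "sector_to_half_plane \<gamma> (half_plane_to_sector \<gamma> z) = z"
      unfolding sector_to_half_plane_def half_plane_to_sector_def u_def[symmetric] a
      using assms z by (simp add: u_def)
  qed
  show "Re (sector_to_half_plane \<gamma> z) > 0" "half_plane_to_sector \<gamma> (sector_to_half_plane \<gamma> z) = z" if "depth \<gamma> z > 0"
  proof -
    have z: "z \<noteq> 0" "\<bar>Arg z\<bar> < \<gamma>" using that depth_pos_iff[OF assms] by auto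
    define u where "u = of_real (pi / (2 * \<gamma>)) * Ln z"
    have "Im u = (pi / (2 * \<gamma>)) * Arg z" using z by (simp add: u_def Arg_eq_Im_Ln)
    then have "\<bar>Im u\<bar> = (pi / (2 * \<gamma>)) * \<bar>Arg z\<bar>" using assms by (simp add: abs_mult)
    also have "\<dots> < (pi / (2 * \<gamma>)) * \<gamma>" using assms z by (intro mult_strict_left_mono) auto
    finally have Im: "\<bar>Im u\<bar> < pi / 2" using assms by simp
    then have a: "Arg (exp u) = Im u" "Ln (exp u) = u" using pi by (auto intro!: Arg_exp Ln_exp simp del: pi_gt_zero)
    show "Re (sector_to_half_plane \<gamma> z) > 0"
      unfolding Re_pos_iff_Arg sector_to_half_plane_def using a Im by (simp add: u_def)
    show "half_plane_to_sector \<gamma> (sector_to_half_plane \<gamma> z) = z"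
      unfolding sector_to_half_plane_def half_plane_to_sector_def u_def[symmetric] a
      using assms z by (simp add: u_def)
  qed
qed

lemma sector_nonpos_Reals:
  assumes "0 < \<gamma>" "\<gamma> \<le> pi / 2" "depth \<gamma> z > 0"
  shows "z \<notin> \<real>\<^sub>\<le>\<^sub>0"
proof -
  have "\<bar>Arg z\<bar> < pi / 2" "z \<noteq> 0" using assms depth_pos_iff[OF assms(1,2), of z] by auto
  then have "Re z > 0" using Re_pos_iff_Arg by blast
  then show ?thesis by (auto simp: complex_nonpos_Reals_iff)
qed

lemma holomorphic_on_half_plane_to_sector: "half_plane_to_sector \<gamma> holomorphic_on half_plane"
  unfolding half_plane_to_sector_def
  by (intro holomorphic_intros) (auto simp: half_plane_def complex_nonpos_Reals_iff)

lemma holomorphic_on_sector_to_half_plane: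
  assumes "0 < \<gamma>" "\<gamma> \<le> pi / 2"
  shows "sector_to_half_plane \<gamma> holomorphic_on {z. depth \<gamma> z > 0}"
  unfolding sector_to_half_plane_def
  by (intro holomorphic_intros) (use sector_nonpos_Reals[OF assms] in auto)

lemma open_half_plane: "open half_plane"
  unfolding half_plane_def by (simp add: open_halfspace_Re_gt)

text \<open>By Montel's theorem and the maximum principle, an asymptotic bound of a sequence of holomorphic
  functions that is not attained at one point is not attained anywhere.\<close>

lemma eventually_less_of_bounded_holomorphic:
  fixes K :: "nat \<Rightarrow> complex \<Rightarrow> complex"
  assumes S: "open S" "connected S" "t0 \<in> S" "t \<in> S"
    and K: "\<forall>\<^sub>F n in sequentially. K n holomorphic_on S"
    and bound: "\<And>e. e > 0 \<Longrightarrow> \<forall>\<^sub>F n in sequentially. \<forall>s\<in>S. cmod (K n s) \<le> M + e"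
    and t0: "\<forall>\<^sub>F n in sequentially. cmod (K n t0) \<le> M'" "M' < M"
  shows "\<exists>M''<M. \<forall>\<^sub>F n in sequentially. cmod (K n t) < M''"
proof (rule ccontr)
  assume neg: "\<not> ?thesis"
  have "\<forall>\<^sub>F n in sequentially. K n holomorphic_on S \<and> (\<forall>s\<in>S. cmod (K n s) \<le> M + 1) \<and> cmod (K n t0) \<le> M'"
    using K bound[OF zero_less_one] t0(1) by eventually_elim simp
  then obtain N0 where N0: "\<And>n. n \<ge> N0 \<Longrightarrow> K n holomorphic_on S"
    "\<And>n s. n \<ge> N0 \<Longrightarrow> s \<in> S \<Longrightarrow> cmod (K n s) \<le> M + 1" "\<And>n. n \<ge> N0 \<Longrightarrow> cmod (K n t0) \<le> M'"
    unfolding eventually_sequentially by blast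
  have "\<exists>n\<ge>max N N0. cmod (K n t) \<ge> M - 1 / Suc k" for N k
  proof -
    have "\<not> (\<forall>\<^sub>F n in sequentially. cmod (K n t) < M - 1 / Suc k)"
      using neg by (metis diff_less_eq less_add_same_cancel1 of_nat_0_less_iff zero_less_Suc zero_less_divide_1_iff)
    then show ?thesis unfolding eventually_sequentially not_less by (meson not_less)
  qed
  then obtain q where q: "\<And>N k. q N k \<ge> max N N0" "\<And>N k. cmod (K (q N k) t) \<ge> M - 1 / Suc k"
    by metis
  \<comment> \<open>Each new index lies beyond the previous one, and the k-th one violates the bound
    M - 1/(k+1) at t. The lower bounds at t thus tend to M along the subsequence.\<close>
  define r0 where "r0 = rec_nat (q 0 0) (\<lambda>k x. q (Suc x) (Suc k))"
  have r0: "strict_mono r0"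
    unfolding strict_mono_Suc_iff r0_def using q(1) by (simp add: Suc_le_lessD)
  have r0t: "cmod (K (r0 k) t) \<ge> M - 1 / Suc k" for k
    using q(2)[of 0 0] q(2)[of k "Suc (r0 (k - 1))"] by (cases k) (auto simp: r0_def)
  have r0N: "r0 k \<ge> N0" for k
    using q(1) by (cases k) (auto simp: r0_def)
  define F where "F = (\<lambda>k. K (r0 k))"
  have bdd: "\<exists>B'. \<forall>h\<in>range F. \<forall>z\<in>C. cmod (h z) \<le> B'" if "C \<subseteq> S" for C
    using N0(2)[OF r0N] that by (intro exI[of _ "M + 1"]) (auto simp: F_def)
  obtain g r where g: "g holomorphic_on S" "strict_mono r" "\<And>x. x \<in> S \<Longrightarrow> (\<lambda>n. F (r n) x) \<longlonglongrightarrow> g x"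
    by (rule Montel[of S "range F" F]) (use N0(1)[OF r0N] bdd S in \<open>auto simp: F_def\<close>)
  have lim: "(\<lambda>n. cmod (F (r n) x)) \<longlonglongrightarrow> cmod (g x)" if "x \<in> S" for x
    using g(3)[OF that] by (rule tendsto_norm)
  have rr: "strict_mono (r0 \<circ> r)" using r0 g(2) strict_mono_o by blast
  have le: "cmod (g x) \<le> M" if x: "x \<in> S" for x
  proof (rule field_le_epsilon)
    fix e :: real assume "e > 0"
    have "\<forall>\<^sub>F n in sequentially. cmod (F (r n) x) \<le> M + e"
      using eventually_compose_filterlim[OF bound[OF \<open>e > 0\<close>] filterlim_subseq[OF rr]]
      by eventually_elim (use x in \<open>auto simp: F_def\<close>)
    then show "cmod (g x) \<le> M + e"
      by (rule tendsto_upperbound[OF lim[OF x]]) simp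
  qed
  have "M \<le> cmod (g t)"
  proof (rule LIMSEQ_le[OF _ lim[OF S(4)]])
    have "(\<lambda>n. 1 / real (Suc n)) \<longlonglongrightarrow> 0" using LIMSEQ_inverse_real_of_nat by (simp add: inverse_eq_divide)
    from LIMSEQ_subseq_LIMSEQ[OF this g(2)]
    show "(\<lambda>n. M - 1 / Suc (r n)) \<longlonglongrightarrow> M"
      using tendsto_diff[OF tendsto_const[of M]] by (fastforce simp: comp_def)
  qed (use r0t in \<open>auto simp: F_def\<close>)
  then have "g constant_on S"
    by (intro maximum_modulus_principle[OF g(1) S(1,2,1) order_refl S(4)]) (use le order_trans in blast)
  then have "g t0 = g t" using S unfolding constant_on_def by metis
  moreover have "cmod (g t0) \<le> M'"
    by (rule LIMSEQ_le_const2[OF lim[OF S(3)]]) (use N0(3)[OF r0N] in \<open>auto simp: F_def\<close>)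
  ultimately show False using \<open>M \<le> cmod (g t)\<close> t0(2) by simp
qed

section \<open>The absorbing regions and their basins\<close>

locale transcendental_henon =
  fixes m :: nat and \<delta> :: real
  assumes m_ge_2: "m \<ge> 2" and \<delta>_gt_2: "\<delta> > 2"
begin

abbreviation F :: self_map where "F \<equiv> henon_map m \<delta>"

abbreviation a :: complex where "a \<equiv> linear_coeff m \<delta>"

definition E :: "complex \<Rightarrow> complex" where "E z = exp (- (z ^ m))"

definition \<omega> :: "int \<Rightarrow> complex" where "\<omega> j = cis (2 * pi * real_of_int j / real m)"

definition \<gamma> :: real where "\<gamma> = pi / (2 * real m)"

text \<open>The rotation by \<open>\<omega> (- j)\<close> moves the sector around
  \<open>\<omega> j\<close> to the positive real axis. The index is an integer, not a residue, so
  that it can be shifted freely; \<open>dep_cong\<close> supplies the periodicity.\<close>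

definition dep :: "int \<Rightarrow> complex \<Rightarrow> real" where "dep j z = depth \<gamma> (z * \<omega> (- j))"

lemma m_pos: "real m > 0" "real m \<ge> 2" "m > 0" "m \<noteq> 0" using m_ge_2 by auto

lemma \<gamma>_bounds: "0 < \<gamma>" "\<gamma> \<le> pi / 4" "\<gamma> \<le> pi / 2" "2 * \<gamma> \<le> pi / 2"
  using m_pos pi_gt_zero by (auto simp: \<gamma>_def field_simps)

lemma cos_\<gamma>: "0 \<le> cos \<gamma>" using \<gamma>_bounds pi_gt_zero by (intro cos_ge_zero) auto

lemma \<omega>_0 [simp]: "\<omega> 0 = 1" by (simp add: \<omega>_def)

lemma \<omega>_add: "\<omega> (i + j) = \<omega> i * \<omega> j"
  by (simp add: \<omega>_def cis_mult distrib_left add_divide_distrib)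

lemma \<omega>_mult_minus [simp]: "\<omega> j * \<omega> (- j) = 1" "\<omega> (- j) * \<omega> j = 1"
  by (simp_all flip: \<omega>_add)

lemma \<omega>_nonzero [simp]: "\<omega> j \<noteq> 0" by (simp add: \<omega>_def)

lemma norm_\<omega> [simp]: "cmod (\<omega> j) = 1" by (simp add: \<omega>_def)

lemma \<omega>_of_multiple: "\<omega> (int m * k) = 1"
  using m_pos cis_multiple_2pi[of "of_int k"] by (simp add: \<omega>_def mult.assoc)

lemma \<omega>_power_m: "\<omega> j ^ m = 1"
proof -
  have "\<omega> j ^ m = cis (real m * (2 * pi * of_int j / m))" by (simp only: \<omega>_def Complex.DeMoivre)
  also have "real m * (2 * pi * of_int j / m) = 2 * pi * of_int j" using m_pos by simp
  finally have "\<omega> j ^ m = cis (2 * pi * of_int j)" .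
  then show ?thesis using cis_multiple_2pi[of "of_int j"] by simp
qed

lemma \<omega>_cong: "int m dvd i - j \<Longrightarrow> \<omega> i = \<omega> j"
  by (metis \<omega>_add \<omega>_of_multiple add.commute diff_add_cancel dvdE mult.right_neutral)

lemma a_eq: "a = of_real \<delta> * \<omega> 1"
  by (simp add: linear_coeff_def \<omega>_def cis_conv_exp mult_ac)

lemma norm_a [simp]: "cmod a = \<delta>" using \<delta>_gt_2 by (simp add: a_eq norm_mult)

lemma a_nonzero [simp]: "a \<noteq> 0" using norm_a \<delta>_gt_2 by (metis norm_zero not_less_iff_gr_or_eq zero_less_numeral less_trans)

lemma dep_cong: "int m dvd i - j \<Longrightarrow> dep i z = dep j z"
proof -
  assume "int m dvd i - j"
  then have "int m dvd - i - (- j)" by (metis dvd_diff_commute minus_diff_minus dvd_minus_iff)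
  then show ?thesis unfolding dep_def using \<omega>_cong by metis
qed

lemma dep_add_ge: "dep j (z + w) \<ge> dep j z - cmod w"
  using depth_add_ge[OF cos_\<gamma>, of "z * \<omega> (- j)" "w * \<omega> (- j)"] by (simp add: dep_def norm_mult distrib_right)

lemma dep_diff_le: "dep j w \<ge> dep j z - cmod (w - z)"
  using dep_add_ge[of j z "w - z"] by simp

lemma dep_le_norm: "dep j z \<le> cmod z"
  using depth_abs_le[of \<gamma> "z * \<omega> (- j)"] by (simp add: dep_def norm_mult)

lemma dep_mult_a_power: "dep (j + int n) (a ^ n * z) = \<delta> ^ n * dep j z"
proof -
  have "a ^ n * \<omega> (- int n) = of_real (\<delta> ^ n)"
  proof (induction n)
    case (Suc n)
    have "a ^ Suc n * \<omega> (- int (Suc n)) = (a ^ n * \<omega> (- int n)) * (a * \<omega> (- 1))"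
      using \<omega>_add[of "- int n" "- 1"] by (simp add: algebra_simps)
    also have "a * \<omega> (- 1) = of_real \<delta>" by (simp add: a_eq)
    finally show ?case using Suc by simp
  qed simp
  then have *: "a ^ n * z * \<omega> (- (j + int n)) = of_real (\<delta> ^ n) * (z * \<omega> (- j))"
    using \<omega>_add[of "- int n" "- j"] by (simp add: algebra_simps)
  show ?thesis
    unfolding dep_def * by (rule depth_scaleR) (use \<delta>_gt_2 in simp)
qed

lemma dep_mult_a: "dep (j + 1) (a * z) = \<delta> * dep j z"
  using dep_mult_a_power[of j 1 z] by simp

lemma continuous_on_dep [continuous_intros]: "continuous_on X f \<Longrightarrow> continuous_on X (\<lambda>x. dep j (f x))"
  unfolding dep_def by (intro continuous_intros)

lemma dep_\<omega>: "dep j (of_real t * \<omega> j) = t * sin \<gamma>"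
  by (simp add: dep_def mult.assoc depth_def)

lemma sin_\<gamma>_pos: "sin \<gamma> > 0" using \<gamma>_bounds pi_gt_zero by (intro sin_gt_zero) linarith+

lemma ex_dep_gt: "\<exists>z. dep j z > T"
  by (rule exI[of _ "of_real ((\<bar>T\<bar> + 1) / sin \<gamma>) * \<omega> j"]) (use sin_\<gamma>_pos in \<open>simp only: dep_\<omega>, simp\<close>)

text \<open>Neighbouring axes are 2\<pi>/m = 4\<gamma> apart, so sectors of half-opening up to
  2\<gamma> around different axes are disjoint. The range of \<beta> includes 2\<gamma> because
  quotients of two sector coordinates fill sectors of the doubled opening; these are the limit
  sets.\<close>

lemma sector_unique:
  assumes \<beta>: "0 < \<beta>" "\<beta> \<le> 2 * \<gamma>" and "depth \<beta> (z * \<omega> (- j)) > 0" "depth \<beta> (z * \<omega> (- k)) > 0"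
  shows "int m dvd j - k"
proof -
  define u where "u = z * \<omega> (- j)"
  define v where "v = z * \<omega> (- k)"
  have \<beta>': "\<beta> \<le> pi / 2" using \<beta> \<gamma>_bounds by linarith
  have uv: "u \<noteq> 0" "\<bar>Arg u\<bar> < \<beta>" "v \<noteq> 0" "\<bar>Arg v\<bar> < \<beta>"
    using assms depth_pos_iff[OF \<beta>(1) \<beta>'] by (auto simp: u_def v_def)
  have v: "v = u * \<omega> (j - k)"
    by (simp add: u_def v_def mult.assoc flip: \<omega>_add)
  have n: "cmod v = cmod u" by (simp add: v norm_mult)
  have "rcis (cmod v) (Arg v) = rcis (cmod u) (Arg u) * \<omega> (j - k)"
    using v by (simp add: rcis_cmod_Arg)
  then have "cis (Arg v) = cis (Arg u + 2 * pi * of_int (j - k) / m)"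
    using uv n by (simp add: rcis_def \<omega>_def mult.assoc flip: cis_mult)
  then obtain n :: int where n: "Arg v = (Arg u + 2 * pi * of_int (j - k) / m) + 2 * pi * n"
    unfolding cis.ctr complex.inject using sin_cos_eq_iff by metis
  \<comment> \<open>X is the difference of the two arguments. It is an integer multiple Y of
    2\<pi>/m and smaller than 2\<pi>/m in modulus, so Y = 0.\<close>
  define X where "X = 2 * pi * of_int (j - k) / m + 2 * pi * n"
  define Y where "Y = real_of_int (j - k + n * int m)"
  have "\<bar>X\<bar> < 2 * \<beta>"
    using uv n by (auto simp: X_def abs_less_iff)
  then have "\<bar>X\<bar> < 2 * pi / m" using \<beta>(2) by (simp add: \<gamma>_def)
  then have "\<bar>X * m\<bar> < 2 * pi" using m_pos by (simp add: abs_mult field_simps)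
  moreover have "X * m = 2 * pi * Y" using m_pos by (simp add: X_def Y_def field_simps)
  ultimately have "2 * pi * \<bar>Y\<bar> < 2 * pi * 1" by (simp add: abs_mult)
  then have "\<bar>Y\<bar> < 1"
    by (subst (asm) mult_less_cancel_left_pos) auto
  then have "j - k + n * int m = 0" unfolding Y_def by (metis of_int_abs of_int_less_1_iff zero_less_abs_iff int_one_le_iff_zero_less not_less)
  then show ?thesis by (metis add_eq_0_iff dvd_minus_iff dvd_triv_right)
qed

lemma dep_pos_unique: "dep j z > 0 \<Longrightarrow> dep k z > 0 \<Longrightarrow> int m dvd j - k"
  using sector_unique[of \<gamma> z j k] \<gamma>_bounds(1) by (simp add: dep_def)

lemma Arg_power_in_sector:
  assumes "dep j z > 0"
  shows "z ^ m \<noteq> 0" "\<bar>Arg (z ^ m)\<bar> < pi / 2"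
proof -
  define u where "u = z * \<omega> (- j)"
  have u: "u \<noteq> 0" "\<bar>Arg u\<bar> < \<gamma>" using assms depth_pos_iff[OF \<gamma>_bounds(1,3)] by (auto simp: dep_def u_def)
  have zu: "z ^ m = u ^ m" by (simp add: u_def power_mult_distrib \<omega>_power_m)
  have "real m * \<bar>Arg u\<bar> < real m * \<gamma>" using u m_pos by simp
  then have *: "real m * \<bar>Arg u\<bar> < pi / 2" using m_pos by (simp add: \<gamma>_def)
  then have "Arg (u ^ m) = real m * Arg u" using u pi_gt_zero by (intro of_nat_mult_Arg_power) linarith+
  then show "z ^ m \<noteq> 0" "\<bar>Arg (z ^ m)\<bar> < pi / 2" using * u by (simp_all add: zu abs_mult)
qed

lemma norm_E_le_1:
  assumes "dep j z > 0"
  shows "cmod (E z) \<le> 1"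
proof -
  have "Re (z ^ m) > 0" unfolding Re_pos_iff_Arg using Arg_power_in_sector[OF assms] by blast
  then show ?thesis by (simp add: E_def)
qed

text \<open>F copies the first coordinate into the second, so the n-th iterate is
  (\<open>orb p (Suc n)\<close>, \<open>orb p n\<close>). A scalar sequence with a recursion of
  order two replaces the planar orbit.\<close>

definition orb :: "complex \<times> complex \<Rightarrow> nat \<Rightarrow> complex" where "orb p n = snd ((F ^^ n) p)"

lemma F_eq: "F p = (E (fst p) + a * snd p, fst p)"
  by (simp add: henon_map_def E_def split_beta)

lemma snd_F [simp]: "snd (F p) = fst p" by (simp add: F_eq)

lemma funpow_F: "(F ^^ n) p = (orb p (Suc n), orb p n)"
  by (simp add: orb_def prod_eq_iff)

lemma orb_0: "orb p 0 = snd p" and orb_1: "orb p (Suc 0) = fst p"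
  by (simp_all add: orb_def)

lemma orb_rec: "orb p (Suc (Suc n)) = E (orb p (Suc n)) + a * orb p n"
proof -
  have "orb p (Suc (Suc n)) = fst (F ((F ^^ n) p))" by (simp add: orb_def)
  then show ?thesis by (simp add: F_eq funpow_F)
qed

lemma orb_funpow: "orb ((F ^^ k) p) n = orb p (n + k)"
  by (simp add: orb_def funpow_add)

lemma orb_F: "orb (F p) n = orb p (Suc n)"
  using orb_funpow[of 1 p n] by simp

lemma holomorphic2_orb: "(\<lambda>p. orb p n) holomorphic2_on U"
proof -
  have *: "E holomorphic_on UNIV" unfolding E_def by (intro holomorphic_intros)
  have "(\<lambda>p. orb p n) holomorphic2_on U \<and> (\<lambda>p. orb p (Suc n)) holomorphic2_on U"
  proof (induction n)
    case 0 show ?case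
      using holomorphic2_on_fst holomorphic2_on_snd by (simp add: orb_0 orb_1)
  next
    case (Suc n) then show ?case
      unfolding orb_rec
      by (auto intro!: holomorphic2_on_add holomorphic2_on_mult holomorphic2_on_const
          holomorphic2_on_compose[OF _ *])
  qed
  then show ?thesis ..
qed

lemma continuous_on_orb: "continuous_on U (\<lambda>p. orb p n)"
  by (rule holomorphic2_on_imp_continuous_on[OF holomorphic2_orb])

lemma continuous_on_funpow_F: "continuous_on U (F ^^ n)"
proof -
  have "continuous_on U (\<lambda>p. (orb p (Suc n), orb p n))"
    by (intro continuous_intros continuous_on_orb)
  moreover have "(\<lambda>p. (orb p (Suc n), orb p n)) = F ^^ n" by (simp add: funpow_F fun_eq_iff)
  ultimately show ?thesis by metis
qed

definition F_inv :: self_map where "F_inv = (\<lambda>(x, y). (y, (x - E y) / a))"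

lemma F_F_inv [simp]: "F (F_inv p) = p" and F_inv_F [simp]: "F_inv (F p) = p"
  by (simp_all add: F_eq F_inv_def split_beta)

lemma continuous_on_F_inv: "continuous_on U F_inv"
  unfolding F_inv_def split_beta E_def by (intro continuous_intros) auto

lemma funpow_F_F_inv [simp]: "(F ^^ n) ((F_inv ^^ n) p) = p" "(F_inv ^^ n) ((F ^^ n) p) = p"
proof (induction n arbitrary: p)
  case (Suc n)
  { case 1 show ?case by (simp only: funpow_Suc_right[of n F] funpow.simps(2)[of n F_inv] comp_def F_F_inv Suc.IH) }
  { case 2 show ?case by (simp only: funpow_Suc_right[of n F_inv] funpow.simps(2)[of n F] comp_def F_inv_F Suc.IH) }
qed simp_all

lemma continuous_on_funpow_F_inv: "continuous_on U (F_inv ^^ n)"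
proof (induction n arbitrary: U)
  case (Suc n) then show ?case
    using continuous_on_compose2[OF continuous_on_F_inv[of UNIV] Suc.IH, of U] by simp
qed (simp add: continuous_on_id id_def)

lemma inj_funpow_F: "inj (F ^^ n)"
  by (metis funpow_F_F_inv(2) injI)

definition W :: "real \<Rightarrow> int \<Rightarrow> int \<Rightarrow> (complex \<times> complex) set" where
  "W T j k = {p. dep j (fst p) > T \<and> dep k (snd p) > T}"

lemma W_cong: "int m dvd j - j' \<Longrightarrow> int m dvd k - k' \<Longrightarrow> W T j k = W T j' k'"
  using dep_cong by (simp add: W_def)

lemma open_W: "open (W T j k)"
  unfolding W_def by (intro open_Collect_conj open_Collect_less continuous_intros)

lemma W_eq_Times: "W T j k = {z. dep j z > T} \<times> {z. dep k z > T}"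
  by (auto simp: W_def)

lemma convex_dep: "convex {z. dep j z > T}" "convex {z. dep j z \<ge> T}"
proof -
  have *: "linear (\<lambda>z. z * \<omega> (- j))"
    by (rule bounded_linear.linear[OF bounded_linear_mult_left])
  have eq: "{z. dep j z > T} = (\<lambda>z. z * \<omega> (- j)) -` {z. depth \<gamma> z > T}"
    "{z. dep j z \<ge> T} = (\<lambda>z. z * \<omega> (- j)) -` {z. depth \<gamma> z \<ge> T}" by (auto simp: dep_def)
  show "convex {z. dep j z > T}" "convex {z. dep j z \<ge> T}"
    unfolding eq by (intro convex_linear_vimage[OF *] convex_depth[OF cos_\<gamma>])+
qed

lemma convex_W: "convex (W T j k)"
  unfolding W_eq_Times by (intro convex_Times convex_dep)

lemma W_nonempty: "W T j k \<noteq> {}"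
  unfolding W_eq_Times using ex_dep_gt by auto

text \<open>Multiplication by a raises the depth from over T to over \<delta> T, and the
  exponential, bounded by 1 in the sector, costs at most 1: what remains exceeds 2 T - 1 >= T. Only
  the new first coordinate gains; the other one is copied, so a gain in both takes two
  steps.\<close>

lemma F_in_W:
  assumes "p \<in> W T j k" "T \<ge> 1"
  shows "F p \<in> W T (k + 1) j" "dep (k + 1) (fst (F p)) > \<delta> * T - 1"
proof -
  have "dep (k + 1) (a * snd p + E (fst p)) \<ge> dep (k + 1) (a * snd p) - cmod (E (fst p))"
    by (rule dep_add_ge)
  moreover have "cmod (E (fst p)) \<le> 1" using assms by (intro norm_E_le_1[of j]) (auto simp: W_def)
  moreover have "dep (k + 1) (a * snd p) > \<delta> * T"
    using assms \<delta>_gt_2 by (simp add: dep_mult_a W_def)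
  ultimately show *: "dep (k + 1) (fst (F p)) > \<delta> * T - 1"
    by (simp add: F_eq add.commute)
  have "\<delta> * T \<ge> 2 * T" using \<delta>_gt_2 assms by (intro mult_right_mono) auto
  then have "dep (k + 1) (fst (F p)) > T" using * assms(2) by linarith
  then show "F p \<in> W T (k + 1) j"
    using assms by (auto simp: W_def)
qed

lemma F2_in_W:
  assumes "p \<in> W T j k" "T \<ge> 1"
  shows "F (F p) \<in> W (\<delta> * T - 1) (j + 1) (k + 1)"
  using F_in_W[OF assms] F_in_W[OF F_in_W(1)[OF assms] assms(2)] by (simp add: W_def)

text \<open>Two steps send depth T to \<delta> T - 1. Measured by its excess over 1, this is at
  least multiplication by \<delta>, because \<delta> - 1 >= 1.\<close>

lemma funpow_F_in_W:
  assumes "p \<in> W (1 + e) j k" "e \<ge> 0"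
  shows "(F ^^ (2 * n)) p \<in> W (1 + \<delta> ^ n * e) (j + int n) (k + int n)"
proof (induction n)
  case (Suc n)
  have "(F ^^ (2 * Suc n)) p = F (F ((F ^^ (2 * n)) p))" by simp
  also have "\<dots> \<in> W (\<delta> * (1 + \<delta> ^ n * e) - 1) (j + int n + 1) (k + int n + 1)"
    using \<delta>_gt_2 assms by (intro F2_in_W Suc) auto
  also have "\<dots> \<subseteq> W (1 + \<delta> ^ Suc n * e) (j + int (Suc n)) (k + int (Suc n))"
    using \<delta>_gt_2 by (auto simp: W_def algebra_simps)
  finally show ?case .
qed (use assms in simp)

lemma funpow_F_in_W1:
  assumes "p \<in> W 1 j k"
  shows "(F ^^ (2 * n)) p \<in> W 1 (j + int n) (k + int n)"
  using funpow_F_in_W[of p 0] assms by simp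

lemma eventually_funpow_F_in_W:
  assumes "p \<in> W 1 j k"
  shows "\<forall>\<^sub>F n in sequentially. (F ^^ (2 * n)) p \<in> W T (j + int n) (k + int n)"
proof -
  define e where "e = (min (dep j (fst p)) (dep k (snd p)) - 1) / 2"
  have e: "e > 0" "p \<in> W (1 + e) j k" using assms by (auto simp: e_def W_def min_def field_simps)
  obtain N where N: "\<bar>T\<bar> / e < \<delta> ^ N" using real_arch_pow[of \<delta> "\<bar>T\<bar> / e"] \<delta>_gt_2 by auto
  have "\<bar>T\<bar> / e \<le> \<delta> ^ n" if "n \<ge> N" for n
    using power_increasing[OF that, of \<delta>] \<delta>_gt_2 N by linarith
  then have "\<forall>\<^sub>F n in sequentially. \<delta> ^ n \<ge> \<bar>T\<bar> / e" by (auto simp: eventually_sequentially)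
  then show ?thesis
  proof eventually_elim
    case (elim n)
    then have "\<bar>T\<bar> \<le> \<delta> ^ n * e" using e by (simp add: field_simps)
    then show ?case using funpow_F_in_W[OF e(2), of n] e by (auto simp: W_def)
  qed
qed

text \<open>Two steps of F shift both sector indices by one and keep their order, whereas a single
  step exchanges them. Hence even times, and the shift by n after 2 n steps.\<close>

definition AN :: "nat \<Rightarrow> int \<Rightarrow> int \<Rightarrow> (complex \<times> complex) set" where
  "AN n j k = {p. (F ^^ (2 * n)) p \<in> W 1 (j + int n) (k + int n)}"

definition A :: "int \<Rightarrow> int \<Rightarrow> (complex \<times> complex) set" where
  "A j k = (\<Union>n. AN n j k)"

lemma A_cong: "int m dvd j - j' \<Longrightarrow> int m dvd k - k' \<Longrightarrow> A j k = A j' k'"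
proof -
  assume "int m dvd j - j'" "int m dvd k - k'"
  then have "W 1 (j + int n) (k + int n) = W 1 (j' + int n) (k' + int n)" for n
    by (intro W_cong) simp_all
  then show ?thesis by (simp add: A_def AN_def)
qed

lemma AN_mono: assumes "n \<le> n'" shows "AN n j k \<subseteq> AN n' j k"
proof
  fix p assume "p \<in> AN n j k"
  then have "(F ^^ (2 * (n' - n))) ((F ^^ (2 * n)) p) \<in> W 1 (j + int n + int (n' - n)) (k + int n + int (n' - n))"
    using funpow_F_in_W1 by (simp add: AN_def)
  moreover have "2 * n' = 2 * (n' - n) + 2 * n" using assms by simp
  ultimately show "p \<in> AN n' j k"
    unfolding AN_def using assms by (simp only: funpow_add comp_def mem_Collect_eq) (simp add: of_nat_diff)
qed

lemma open_AN: "open (AN n j k)"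
  unfolding AN_def using open_vimage[OF open_W continuous_on_funpow_F] by (simp add: vimage_def)

lemma open_A: "open (A j k)"
  unfolding A_def by (intro open_UN ballI open_AN)

lemma AN_0: "AN 0 j k = W 1 j k" by (simp add: AN_def)

lemma W_subset_A: "W 1 j k \<subseteq> A j k"
  unfolding A_def using AN_0 by blast

lemma A_nonempty: "A j k \<noteq> {}"
  using W_subset_A W_nonempty by blast

text \<open>Each piece is the image of a convex set under an iterate of the continuous inverse
  \<open>F_inv\<close>, and all pieces share \<open>W 1 j k\<close>.\<close>

lemma connected_A: "connected (A j k)"
  unfolding A_def
proof (rule connected_Union)
  fix S assume "S \<in> range (\<lambda>n. AN n j k)"
  then obtain n where S: "S = AN n j k" by blast
  have "S = (F_inv ^^ (2 * n)) ` W 1 (j + int n) (k + int n)"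
    unfolding S AN_def by (auto intro: rev_image_eqI[of "(F ^^ (2 * n)) _"] )
  then show "connected S"
    using connected_continuous_image[OF continuous_on_funpow_F_inv convex_connected[OF convex_W]] by simp
next
  have "W 1 j k \<subseteq> \<Inter> (range (\<lambda>n. AN n j k))" using AN_mono[of 0] AN_0 by blast
  then show "\<Inter> (range (\<lambda>n. AN n j k)) \<noteq> {}" using W_nonempty by blast
qed

lemma F_in_A_iff: "F p \<in> A (k + 1) j \<longleftrightarrow> p \<in> A j k"
proof
  assume "p \<in> A j k"
  then obtain n where "(F ^^ (2 * n)) p \<in> W 1 (j + int n) (k + int n)" by (auto simp: A_def AN_def)
  then have "F ((F ^^ (2 * n)) p) \<in> W 1 (k + int n + 1) (j + int n)" by (rule F_in_W) simp
  then have "(F ^^ (2 * n)) (F p) \<in> W 1 (k + 1 + int n) (j + int n)"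
    by (simp add: funpow_swap1 add_ac)
  then show "F p \<in> A (k + 1) j" by (auto simp: A_def AN_def)
next
  assume "F p \<in> A (k + 1) j"
  then obtain n where "(F ^^ (2 * n)) (F p) \<in> W 1 (k + 1 + int n) (j + int n)" by (auto simp: A_def AN_def)
  \<comment> \<open>The orbit of p is known at the odd time 2 n + 1; one further step makes the time
    even again.\<close>
  then have "F ((F ^^ (2 * n)) (F p)) \<in> W 1 (j + int n + 1) (k + 1 + int n)" by (rule F_in_W) simp
  then have "(F ^^ (2 * Suc n)) p \<in> W 1 (j + int (Suc n)) (k + int (Suc n))"
    by (simp add: funpow_swap1 add_ac)
  then show "p \<in> A j k" unfolding A_def AN_def by blast
qed

lemma F_image_A: "F ` A j k = A (k + 1) j"
proof
  show "F ` A j k \<subseteq> A (k + 1) j" using F_in_A_iff by blast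
  show "A (k + 1) j \<subseteq> F ` A j k" by (metis F_F_inv F_in_A_iff image_eqI subsetI)
qed

lemma A_unique:
  assumes "p \<in> A j k" "p \<in> A j' k'"
  shows "int m dvd j - j'" "int m dvd k - k'"
proof -
  obtain n n' where "p \<in> AN n j k" "p \<in> AN n' j' k'" using assms by (auto simp: A_def)
  then have "p \<in> AN (max n n') j k" "p \<in> AN (max n n') j' k'"
    by (meson AN_mono max.cobounded1 max.cobounded2 subsetD)+
  then have "dep (j + int (max n n')) (fst ((F ^^ (2 * max n n')) p)) > 0" "dep (j' + int (max n n')) (fst ((F ^^ (2 * max n n')) p)) > 0"
    "dep (k + int (max n n')) (snd ((F ^^ (2 * max n n')) p)) > 0" "dep (k' + int (max n n')) (snd ((F ^^ (2 * max n n')) p)) > 0"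
    by (auto simp: AN_def W_def)
  then have "int m dvd (j + int (max n n')) - (j' + int (max n n'))" "int m dvd (k + int (max n n')) - (k' + int (max n n'))"
    by (meson dep_pos_unique)+
  then show "int m dvd j - j'" "int m dvd k - k'" by simp_all
qed

lemma A_eq_iff: "A j k = A j' k' \<longleftrightarrow> int m dvd j - j' \<and> int m dvd k - k'"
proof
  assume *: "A j k = A j' k'"
  obtain p where "p \<in> A j k" using A_nonempty by blast
  then show "int m dvd j - j' \<and> int m dvd k - k'" using A_unique[of p j k j' k'] * by simp
qed (elim conjE, rule A_cong)

text \<open>The basins are defined by even times. This version catches an orbit that is seen in the
  absorbing region at an arbitrary time, by undoing one step at a time.\<close>

lemma funpow_in_W_imp_in_A:
  assumes "(F ^^ N) p \<in> W 1 j k"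
  shows "\<exists>j' k'. p \<in> A j' k'"
proof -
  have "\<exists>j k. (F ^^ n) p \<in> A j k \<Longrightarrow> \<exists>j k. p \<in> A j k" for n
  proof (induction n)
    case (Suc n)
    from Suc.prems obtain j k where "F ((F ^^ n) p) \<in> A j k" unfolding funpow.simps comp_def by blast
    then have "(F ^^ n) p \<in> A k (j - 1)" using F_in_A_iff[of "(F ^^ n) p" "j - 1" k] by simp
    then show ?case using Suc.IH by blast
  qed auto
  then show ?thesis using assms W_subset_A by blast
qed

definition \<Omega>N :: "nat \<Rightarrow> (complex \<times> complex) set" where
  "\<Omega>N n = (\<Union>j k. AN n j k)"

definition \<Omega> :: "(complex \<times> complex) set" where
  "\<Omega> = (\<Union>j k. A j k)"

lemma open_\<Omega>: "open \<Omega>"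
  unfolding \<Omega>_def by (intro open_UN ballI open_A)

lemma \<Omega>_eq: "\<Omega> = (\<Union>n. \<Omega>N n)"
  unfolding \<Omega>_def \<Omega>N_def A_def by auto

lemma A_subset_\<Omega>: "A j k \<subseteq> \<Omega>"
  unfolding \<Omega>_def by blast

lemma \<Omega>N_mono: "n \<le> n' \<Longrightarrow> \<Omega>N n \<subseteq> \<Omega>N n'"
  unfolding \<Omega>N_def by (intro UN_mono AN_mono order_refl)

lemma open_\<Omega>N: "open (\<Omega>N n)"
  unfolding \<Omega>N_def by (intro open_UN ballI open_AN)

lemma F_in_\<Omega>: "p \<in> \<Omega> \<Longrightarrow> F p \<in> \<Omega>"
proof -
  assume "p \<in> \<Omega>"
  then obtain j k where "p \<in> A j k" by (auto simp: \<Omega>_def)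
  then have "F p \<in> A (k + 1) j" by (simp add: F_in_A_iff)
  then show ?thesis using A_subset_\<Omega> by blast
qed

lemma compact_subset_\<Omega>N:
  assumes "compact K" "K \<subseteq> \<Omega>"
  obtains N where "K \<subseteq> \<Omega>N N"
proof -
  have "K \<subseteq> (\<Union>n. \<Omega>N n)" using assms(2) by (simp only: \<Omega>_eq)
  then obtain C where C: "finite C" "K \<subseteq> (\<Union>n\<in>C. \<Omega>N n)"
    using compactE_image[OF assms(1), of UNIV \<Omega>N] open_\<Omega>N by metis
  have "K \<subseteq> \<Omega>N (Max (insert 0 C))"
  proof
    fix p assume "p \<in> K"
    then obtain n where "n \<in> C" "p \<in> \<Omega>N n" using C by blast
    then show "p \<in> \<Omega>N (Max (insert 0 C))"
      using \<Omega>N_mono[of n "Max (insert 0 C)"] C(1) by (meson Max_ge finite_insert insertI2 subsetD)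
  qed
  then show ?thesis by (rule that)
qed

end

section \<open>Cauchy estimates in two variables\<close>

lemma holomorphic2_partial_bounds:
  assumes f: "f holomorphic2_on U" "open U" and B: "\<And>p. p \<in> U \<Longrightarrow> cmod (f p) \<le> B"
    and r: "r > 0" "cball x r \<times> cball y r \<subseteq> U"
    and D: "(f has_derivative (\<lambda>(u, v). a * u + b * v)) (at (x, y))"
  shows "cmod a \<le> B / r" "cmod b \<le> B / r"
proof -
  have "((\<lambda>x. f (x, y)) has_derivative (\<lambda>u. case (u, 0) of (u, v) \<Rightarrow> a * u + b * v)) (at x)"
    by (rule has_derivative_compose[where g = f and f = "\<lambda>x. (x, y)" and f' = "\<lambda>u. (u, 0)"])
      (use D in \<open>auto intro!: has_derivative_Pair\<close>)
  then have "((\<lambda>x. f (x, y)) has_field_derivative a) (at x)"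
    unfolding has_field_derivative_def by (rule has_derivative_eq_rhs) auto
  then have da: "deriv (\<lambda>x. f (x, y)) x = a" by (rule DERIV_imp_deriv)
  have "((\<lambda>y. f (x, y)) has_derivative (\<lambda>v. case (0, v) of (u, v) \<Rightarrow> a * u + b * v)) (at y)"
    by (rule has_derivative_compose[where g = f and f = "\<lambda>y. (x, y)" and f' = "\<lambda>v. (0, v)"])
      (use D in \<open>auto intro!: has_derivative_Pair\<close>)
  then have "((\<lambda>y. f (x, y)) has_field_derivative b) (at y)"
    unfolding has_field_derivative_def by (rule has_derivative_eq_rhs) auto
  then have db: "deriv (\<lambda>y. f (x, y)) y = b" by (rule DERIV_imp_deriv)
  have hx: "(\<lambda>x. f (x, y)) holomorphic_on cball x r"
    by (rule holomorphic_on_subset[OF holomorphic2_on_Pair_holomorphic(1)[OF f]]) (use r in auto)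
  have hy: "(\<lambda>y. f (x, y)) holomorphic_on cball y r"
    by (rule holomorphic_on_subset[OF holomorphic2_on_Pair_holomorphic(2)[OF f]]) (use r in auto)
  have "cmod ((deriv ^^ 1) (\<lambda>x. f (x, y)) x) \<le> fact 1 * B / r ^ 1"
  proof (rule Cauchy_inequality)
    show "(\<lambda>x. f (x, y)) holomorphic_on ball x r"
      using hx holomorphic_on_subset ball_subset_cball by blast
    fix z assume "cmod (x - z) = r"
    then have "(z, y) \<in> cball x r \<times> cball y r" using r(1) by (simp add: dist_norm)
    then show "cmod (f (z, y)) \<le> B" using r(2) B by blast
  qed (use r holomorphic_on_imp_continuous_on[OF hx] in auto)
  then show "cmod a \<le> B / r" by (simp add: da)
  have "cmod ((deriv ^^ 1) (\<lambda>y. f (x, y)) y) \<le> fact 1 * B / r ^ 1"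
  proof (rule Cauchy_inequality)
    show "(\<lambda>y. f (x, y)) holomorphic_on ball y r"
      using hy holomorphic_on_subset ball_subset_cball by blast
    fix z assume "cmod (y - z) = r"
    then have "(x, z) \<in> cball x r \<times> cball y r" using r(1) by (simp add: dist_norm)
    then show "cmod (f (x, z)) \<le> B" using r(2) B by blast
  qed (use r holomorphic_on_imp_continuous_on[OF hy] in auto)
  then show "cmod b \<le> B / r" by (simp add: db)
qed

lemma onorm_bilinear_pair_le: "onorm (\<lambda>(u, v). a * u + b * v :: complex) \<le> cmod a + cmod b"
proof (rule onorm_bound)
  fix p :: "complex \<times> complex"
  have "cmod (a * fst p + b * snd p) \<le> cmod a * cmod (fst p) + cmod b * cmod (snd p)"
    by (metis norm_mult norm_triangle_ineq)
  also have "\<dots> \<le> cmod a * norm p + cmod b * norm p"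
    using norm_fst_le[of "fst p" "snd p"] norm_snd_le[of "snd p" "fst p"]
    by (intro add_mono mult_left_mono) auto
  finally show "norm (case p of (u, v) \<Rightarrow> a * u + b * v) \<le> (cmod a + cmod b) * norm p"
    by (simp add: split_beta algebra_simps)
qed simp

text \<open>The Cauchy estimate bounds each of the two partial derivatives by B/r on C, and
  convexity of C allows the mean value inequality. The factor 2 counts the variables.\<close>

lemma holomorphic2_Lipschitz:
  assumes f: "f holomorphic2_on U" "open U" and B: "\<And>p. p \<in> U \<Longrightarrow> cmod (f p) \<le> B"
    and r: "r > 0" and C: "convex C" "\<And>x y. (x, y) \<in> C \<Longrightarrow> cball x r \<times> cball y r \<subseteq> U"
    and pq: "p \<in> C" "q \<in> C"
  shows "cmod (f p - f q) \<le> 2 * B / r * norm (p - q)"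
proof -
  have "\<exists>a b. (f has_derivative (\<lambda>(u, v). a * u + b * v)) (at p)" if "p \<in> C" for p
  proof -
    have "p \<in> cball (fst p) r \<times> cball (snd p) r" using r by (simp add: mem_Times_iff)
    then have "p \<in> U" using that C(2)[of "fst p" "snd p"] by auto
    then show ?thesis using f unfolding holomorphic2_on_def by blast
  qed
  then obtain a b where D: "\<And>p. p \<in> C \<Longrightarrow> (f has_derivative (\<lambda>(u, v). a p * u + b p * v)) (at p)"
    by metis
  show ?thesis
  proof (rule differentiable_bound[OF C(1) _ _ pq])
    fix p assume p: "p \<in> C"
    show "(f has_derivative (\<lambda>(u, v). a p * u + b p * v)) (at p within C)"
      using D[OF p] by (rule has_derivative_at_withinI)
    obtain x y where xy: "p = (x, y)" by (cases p)
    have "cmod (a p) \<le> B / r" "cmod (b p) \<le> B / r"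
      using holomorphic2_partial_bounds[OF f B r, of x y "a p" "b p"] D[OF p] C(2) p by (auto simp: xy)
    then show "onorm (\<lambda>(u, v). a p * u + b p * v) \<le> 2 * B / r"
      using onorm_bilinear_pair_le[of "a p" "b p"] by simp
  qed
qed

lemma biholomorphismI:
  assumes "open U" "open V"
    and "(\<lambda>p. fst (f p)) holomorphic2_on U" "(\<lambda>p. snd (f p)) holomorphic2_on U"
    and "(\<lambda>p. fst (g p)) holomorphic2_on V" "(\<lambda>p. snd (g p)) holomorphic2_on V"
    and "\<And>p. p \<in> U \<Longrightarrow> f p \<in> V" "\<And>p. p \<in> V \<Longrightarrow> g p \<in> U"
    and "\<And>p. p \<in> U \<Longrightarrow> g (f p) = p" "\<And>p. p \<in> V \<Longrightarrow> f (g p) = p"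
  shows "biholomorphism U V f g"
proof -
  have "continuous_on U f"
    using continuous_on_Pair[OF holomorphic2_on_imp_continuous_on[OF assms(3)] holomorphic2_on_imp_continuous_on[OF assms(4)]]
    by simp
  moreover have "continuous_on V g"
    using continuous_on_Pair[OF holomorphic2_on_imp_continuous_on[OF assms(5)] holomorphic2_on_imp_continuous_on[OF assms(6)]]
    by simp
  ultimately have "homeomorphism U V f g"
    using assms by (intro homeomorphismI) auto
  then show ?thesis
    using assms unfolding biholomorphism_def comp_def by simp
qed

context transcendental_henon
begin

section \<open>The linearising coordinates\<close>

text \<open>The square of L is multiplication by a, so this is the second component of the 2n-th
  iterate of F followed by the inverse of the 2n-th iterate of L. Its value at \<open>F p\<close> is
  the first component, so one scalar limit carries the whole linearisation.\<close>

definition \<eta>N :: "nat \<Rightarrow> complex \<times> complex \<Rightarrow> complex" where "\<eta>N n p = orb p (2 * n) / a ^ n"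

definition \<eta> :: "complex \<times> complex \<Rightarrow> complex" where "\<eta> p = lim (\<lambda>n. \<eta>N n p)"

definition \<phi> :: self_map where "\<phi> p = (\<eta> (F p), \<eta> p)"

lemma \<Omega>N_iff: "p \<in> \<Omega>N n \<longleftrightarrow> (\<exists>j k. p \<in> AN n j k)"
  by (simp add: \<Omega>N_def)

lemma norm_\<eta>N_step:
  assumes "p \<in> \<Omega>N n"
  shows "cmod (\<eta>N (Suc n) p - \<eta>N n p) \<le> (1 / \<delta>) ^ Suc n"
proof -
  obtain j k where "p \<in> AN n j k" using assms \<Omega>N_iff by blast
  then have "dep (j + int n) (orb p (Suc (2 * n))) > 0" by (auto simp: AN_def W_def funpow_F)
  then have E: "cmod (E (orb p (Suc (2 * n)))) \<le> 1" by (rule norm_E_le_1)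
  have "\<eta>N (Suc n) p - \<eta>N n p = E (orb p (Suc (2 * n))) / a ^ Suc n"
    by (simp add: \<eta>N_def orb_rec field_simps)
  then have "cmod (\<eta>N (Suc n) p - \<eta>N n p) = cmod (E (orb p (Suc (2 * n)))) / \<delta> ^ Suc n"
    by (simp only: norm_divide norm_power norm_a)
  also have "\<dots> \<le> 1 / \<delta> ^ Suc n" using E \<delta>_gt_2 by (intro divide_right_mono) auto
  finally show ?thesis by (simp add: power_one_over)
qed

text \<open>The right-hand side is chosen to make the geometric sum telescope: the induction step
  only needs 2 (1/\<delta>)^(k+1) <= (1/\<delta>)^k. For n = 0 the bound is at most 1, which keeps
  \<phi> within distance 1 of the identity in each coordinate on \<open>W 1 j k\<close>.\<close>

lemma norm_\<eta>N_diff: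
  assumes "p \<in> \<Omega>N n" "n \<le> k"
  shows "cmod (\<eta>N k p - \<eta>N n p) \<le> (1 / \<delta>) ^ n - (1 / \<delta>) ^ k"
  using assms(2)
proof (induction k rule: dec_induct)
  case (step k)
  have "cmod (\<eta>N (Suc k) p - \<eta>N k p) \<le> (1 / \<delta>) ^ Suc k"
    using assms(1) \<Omega>N_mono[OF step(1)] by (intro norm_\<eta>N_step) blast
  moreover have "cmod (\<eta>N (Suc k) p - \<eta>N n p) \<le> cmod (\<eta>N (Suc k) p - \<eta>N k p) + cmod (\<eta>N k p - \<eta>N n p)"
    using norm_triangle_ineq[of "\<eta>N (Suc k) p - \<eta>N k p" "\<eta>N k p - \<eta>N n p"] by simp
  moreover have "2 * (1 / \<delta>) ^ Suc k \<le> (1 / \<delta>) ^ k"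
    using \<delta>_gt_2 by (simp add: field_simps)
  ultimately show ?case using step.IH by linarith
qed simp

lemma norm_\<eta>N_diff':
  assumes "p \<in> \<Omega>N n" "n \<le> k"
  shows "cmod (\<eta>N k p - \<eta>N n p) \<le> (1 / \<delta>) ^ n"
  using norm_\<eta>N_diff[OF assms] \<delta>_gt_2 by (smt (verit) zero_le_divide_1_iff zero_le_power)

lemma \<delta>_power_tendsto_0: "(\<lambda>n. (1 / \<delta>) ^ n) \<longlonglongrightarrow> 0"
  using \<delta>_gt_2 by (intro LIMSEQ_realpow_zero) auto

lemma \<eta>N_tendsto:
  assumes "p \<in> \<Omega>"
  shows "(\<lambda>n. \<eta>N n p) \<longlonglongrightarrow> \<eta> p"
proof -
  obtain N where N: "p \<in> \<Omega>N N" using assms \<Omega>_eq by auto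
  have "Cauchy (\<lambda>n. \<eta>N n p)"
  proof (rule metric_CauchyI)
    fix e :: real assume "e > 0"
    then have "\<forall>\<^sub>F n in sequentially. (1 / \<delta>) ^ n < e / 2"
      using \<delta>_power_tendsto_0 by (intro order_tendstoD(2)) auto
    then obtain M where M: "\<And>n. n \<ge> M \<Longrightarrow> (1 / \<delta>) ^ n < e / 2" unfolding eventually_sequentially by blast
    define K where "K = max M N"
    have K: "p \<in> \<Omega>N K" "(1 / \<delta>) ^ K < e / 2" using N M[of K] \<Omega>N_mono[of N K] by (auto simp: K_def)
    have "dist (\<eta>N i p) (\<eta>N j p) < e" if "i \<ge> K" "j \<ge> K" for i j
      using norm_\<eta>N_diff'[OF K(1) that(1)] norm_\<eta>N_diff'[OF K(1) that(2)] K(2)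
        dist_triangle2[of "\<eta>N i p" "\<eta>N j p" "\<eta>N K p"] by (simp add: dist_norm)
    then show "\<exists>M. \<forall>i\<ge>M. \<forall>j\<ge>M. dist (\<eta>N i p) (\<eta>N j p) < e" by blast
  qed
  then show ?thesis
    unfolding \<eta>_def by (simp add: Cauchy_convergent_iff convergent_LIMSEQ_iff)
qed

lemma norm_\<eta>_diff:
  assumes "p \<in> \<Omega>N n"
  shows "cmod (\<eta> p - \<eta>N n p) \<le> (1 / \<delta>) ^ n"
proof -
  have "p \<in> \<Omega>" using assms \<Omega>_eq by auto
  then have "(\<lambda>k. cmod (\<eta>N k p - \<eta>N n p)) \<longlonglongrightarrow> cmod (\<eta> p - \<eta>N n p)"
    by (intro tendsto_intros \<eta>N_tendsto)
  then show ?thesis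
    by (rule LIMSEQ_le_const2) (use norm_\<eta>N_diff'[OF assms] in blast)
qed

lemma uniform_limit_\<eta>N:
  assumes "compact K" "K \<subseteq> \<Omega>"
  shows "uniform_limit K \<eta>N \<eta> sequentially"
proof (rule uniform_limitI)
  fix e :: real assume "e > 0"
  obtain N where N: "K \<subseteq> \<Omega>N N" using compact_subset_\<Omega>N[OF assms] .
  have "\<forall>\<^sub>F n in sequentially. (1 / \<delta>) ^ n < e"
    using \<delta>_power_tendsto_0 \<open>e > 0\<close> by (rule order_tendstoD(2))
  then show "\<forall>\<^sub>F n in sequentially. \<forall>x\<in>K. dist (\<eta>N n x) (\<eta> x) < e"
    using eventually_ge_at_top[of N]
  proof eventually_elim
    case (elim n)
    show ?case
    proof
      fix p assume "p \<in> K"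
      then have "p \<in> \<Omega>N n" using N \<Omega>N_mono[OF elim(2)] by blast
      from norm_\<eta>_diff[OF this] show "dist (\<eta>N n p) (\<eta> p) < e"
        using elim(1) by (simp add: dist_norm norm_minus_commute)
    qed
  qed
qed

lemma holomorphic2_\<eta>: "\<eta> holomorphic2_on \<Omega>"
proof (rule holomorphic2_on_uniform_limit[OF open_\<Omega> _ uniform_limit_\<eta>N])
  fix n
  show "\<eta>N n holomorphic2_on \<Omega>"
    unfolding \<eta>N_def[abs_def] by (intro holomorphic2_on_divide holomorphic2_orb holomorphic2_on_const) simp
qed

lemma holomorphic2_F: "(\<lambda>p. fst (F p)) holomorphic2_on U" "(\<lambda>p. snd (F p)) holomorphic2_on U"
  using holomorphic2_orb[of 2 U] holomorphic2_orb[of 1 U] funpow_F[of 1] by (simp_all add: numeral_2_eq_2)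

lemma holomorphic2_\<eta>_F: "(\<lambda>p. \<eta> (F p)) holomorphic2_on \<Omega>"
  using holomorphic2_on_pair_compose[OF holomorphic2_\<eta> holomorphic2_F, of \<Omega>] F_in_\<Omega>
  by (simp del: snd_F)

lemma \<eta>_F_F:
  assumes "p \<in> \<Omega>"
  shows "\<eta> (F (F p)) = a * \<eta> p"
proof -
  have "\<eta>N n (F (F p)) = a * \<eta>N (Suc n) p" for n
    by (simp add: \<eta>N_def orb_F)
  moreover have "(\<lambda>n. \<eta>N n (F (F p))) \<longlonglongrightarrow> \<eta> (F (F p))"
    by (intro \<eta>N_tendsto F_in_\<Omega> assms)
  ultimately have "(\<lambda>n. a * \<eta>N (Suc n) p) \<longlonglongrightarrow> \<eta> (F (F p))" by (simp only:)
  moreover have "(\<lambda>n. a * \<eta>N (Suc n) p) \<longlonglongrightarrow> a * \<eta> p"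
    by (intro tendsto_intros LIMSEQ_Suc \<eta>N_tendsto assms)
  ultimately show ?thesis by (rule LIMSEQ_unique)
qed

lemma \<phi>_F: "p \<in> \<Omega> \<Longrightarrow> \<phi> (F p) = linear_part m \<delta> (\<phi> p)"
  by (simp add: \<phi>_def linear_part_def \<eta>_F_F)

lemma funpow_F_in_\<Omega>: "p \<in> \<Omega> \<Longrightarrow> (F ^^ n) p \<in> \<Omega>"
  by (induction n) (auto intro: F_in_\<Omega>)

lemma \<eta>_funpow: "p \<in> \<Omega> \<Longrightarrow> \<eta> ((F ^^ (2 * n)) p) = a ^ n * \<eta> p"
proof (induction n)
  case (Suc n)
  have "\<eta> ((F ^^ (2 * Suc n)) p) = \<eta> (F (F ((F ^^ (2 * n)) p)))" by simp
  also have "\<dots> = a * (a ^ n * \<eta> p)" using Suc by (simp add: \<eta>_F_F funpow_F_in_\<Omega>)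
  finally show ?case by simp
qed simp

lemma \<phi>_funpow:
  assumes "p \<in> \<Omega>"
  shows "\<phi> ((F ^^ (2 * n)) p) = (a ^ n * fst (\<phi> p), a ^ n * snd (\<phi> p))"
  using \<eta>_funpow[OF assms, of n] \<eta>_funpow[OF F_in_\<Omega>[OF assms], of n] by (simp add: \<phi>_def funpow_swap1)

lemma W_subset_\<Omega>: "T \<ge> 1 \<Longrightarrow> W T j k \<subseteq> \<Omega>"
proof -
  assume "T \<ge> 1"
  then have "W T j k \<subseteq> W 1 j k" by (auto simp: W_def)
  then show ?thesis using W_subset_A[of j k] A_subset_\<Omega>[of j k] by blast
qed

lemma norm_\<phi>_diff:
  assumes "p \<in> W 1 j k"
  shows "cmod (\<eta> (F p) - fst p) \<le> 1" "cmod (\<eta> p - snd p) \<le> 1"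
proof -
  have *: "cmod (\<eta> p - snd p) \<le> 1" if "p \<in> W 1 j k" for p j k
    using norm_\<eta>_diff[of p 0] that by (auto simp: \<Omega>N_iff AN_0 \<eta>N_def orb_0)
  show "cmod (\<eta> p - snd p) \<le> 1" using * assms .
  show "cmod (\<eta> (F p) - fst p) \<le> 1" using *[OF F_in_W(1)[OF assms]] by simp
qed

lemma \<phi>_W1_in_W0:
  assumes "p \<in> W 1 j k"
  shows "\<phi> p \<in> W 0 j k"
  using norm_\<phi>_diff[OF assms] dep_diff_le[of j "fst p" "\<eta> (F p)"] dep_diff_le[of k "snd p" "\<eta> p"] assms
  by (auto simp: W_def \<phi>_def)

lemma W0_mult_a_power_iff: "(a ^ n * x, a ^ n * y) \<in> W 0 (j + int n) (k + int n) \<longleftrightarrow> (x, y) \<in> W 0 j k"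
  using \<delta>_gt_2 by (simp add: W_def dep_mult_a_power zero_less_mult_iff)

text \<open>At depth over 1, \<phi> displaces each coordinate by at most 1 and therefore cannot
  leave the sectors. For other points of the basin the statement is pulled back through
  \<phi>(F^(2n) p) = a^n \<phi>(p), since the product of full sectors is compatible with scaling by
  a^n.\<close>

lemma \<phi>_in_W0:
  assumes "p \<in> A j k"
  shows "\<phi> p \<in> W 0 j k"
proof -
  obtain n where "(F ^^ (2 * n)) p \<in> W 1 (j + int n) (k + int n)" using assms by (auto simp: A_def AN_def)
  then have "\<phi> ((F ^^ (2 * n)) p) \<in> W 0 (j + int n) (k + int n)" by (rule \<phi>_W1_in_W0)
  moreover have "p \<in> \<Omega>" using assms A_subset_\<Omega> by blast
  ultimately show ?thesis using W0_mult_a_power_iff[of n "fst (\<phi> p)" "snd (\<phi> p)"] by (simp add: \<phi>_funpow)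
qed

lemma cball_Times_subset_W:
  assumes "(x, y) \<in> W (T + r) j k"
  shows "cball x r \<times> cball y r \<subseteq> W T j k"
proof clarify
  fix u v assume "u \<in> cball x r" "v \<in> cball y r"
  then have "cmod (u - x) \<le> r" "cmod (v - y) \<le> r" by (auto simp: dist_norm norm_minus_commute)
  then show "(u, v) \<in> W T j k"
    using assms dep_diff_le[of j x u] dep_diff_le[of k y v] by (auto simp: W_def)
qed

text \<open>On \<open>W 1 j k\<close> both components of \<open>\<phi> - id\<close> are bounded by 1, so the Cauchy estimates make
  \<open>\<phi> - id\<close> a contraction at depth 9.\<close>

lemma holomorphic2_\<phi>_diff:
  "(\<lambda>p. \<eta> (F p) - fst p) holomorphic2_on W 1 j k" "(\<lambda>p. \<eta> p - snd p) holomorphic2_on W 1 j k"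
  using W_subset_\<Omega>[of 1 j k]
  by (intro holomorphic2_on_diff holomorphic2_on_fst holomorphic2_on_snd
      holomorphic2_on_subset[OF holomorphic2_\<eta>] holomorphic2_on_subset[OF holomorphic2_\<eta>_F]; simp)+

lemma \<phi>_diff_contraction:
  assumes "p \<in> W 9 j k" "q \<in> W 9 j k"
  shows "norm ((\<phi> p - p) - (\<phi> q - q)) \<le> 1 / 2 * norm (p - q)"
proof -
  have *: "cball x 8 \<times> cball y 8 \<subseteq> W 1 j k" if "(x, y) \<in> W 9 j k" for x y
    using cball_Times_subset_W[of x y 1 8] that by simp
  \<comment> \<open>Depth 9 leaves bidiscs of radius 8 at depth 1, where the components are bounded
    by 1. Each one gets the Lipschitz constant 2 * 1 / 8 = 1/4, and the two add up to 1/2.\<close>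
  have "cmod ((\<eta> (F p) - fst p) - (\<eta> (F q) - fst q)) \<le> 2 * 1 / 8 * norm (p - q)"
    by (rule holomorphic2_Lipschitz[OF holomorphic2_\<phi>_diff(1) open_W norm_\<phi>_diff(1) _ convex_W * assms]) auto
  moreover have "cmod ((\<eta> p - snd p) - (\<eta> q - snd q)) \<le> 2 * 1 / 8 * norm (p - q)"
    by (rule holomorphic2_Lipschitz[OF holomorphic2_\<phi>_diff(2) open_W norm_\<phi>_diff(2) _ convex_W * assms]) auto
  moreover have "(\<phi> p - p) - (\<phi> q - q) = ((\<eta> (F p) - fst p) - (\<eta> (F q) - fst q), (\<eta> p - snd p) - (\<eta> q - snd q))"
    by (simp add: \<phi>_def prod_eq_iff)
  ultimately show ?thesis
    using norm_Pair_le[of "(\<eta> (F p) - fst p) - (\<eta> (F q) - fst q)" "(\<eta> p - snd p) - (\<eta> q - snd q)"] by simp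
qed

lemma \<phi>_inj_W9:
  assumes "p \<in> W 9 j k" "q \<in> W 9 j k" "\<phi> p = \<phi> q"
  shows "p = q"
proof -
  have "norm (q - p) \<le> 1 / 2 * norm (p - q)" using \<phi>_diff_contraction[OF assms(1,2)] assms(3) by simp
  then show ?thesis by (simp add: norm_minus_commute)
qed

lemma eventually_A_in_W:
  assumes "p \<in> A j k"
  shows "\<forall>\<^sub>F n in sequentially. (F ^^ (2 * n)) p \<in> W T (j + int n) (k + int n)"
proof -
  obtain N where N: "(F ^^ (2 * N)) p \<in> W 1 (j + int N) (k + int N)" using assms by (auto simp: A_def AN_def)
  have "\<forall>\<^sub>F n in sequentially. (F ^^ (2 * (n + N))) p \<in> W T (j + int (n + N)) (k + int (n + N))"
    using eventually_funpow_F_in_W[OF N, of T]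
    by (simp add: distrib_left funpow_add add_ac)
  then show ?thesis
    using eventually_sequentially_seg[of "\<lambda>n. (F ^^ (2 * n)) p \<in> W T (j + int n) (k + int n)" N] by simp
qed

text \<open>The value of \<phi> determines the basin, as the sectors are disjoint. Late even
  iterates of both points lie at depth 9, where \<phi> is injective; the conjugacy transfers
  equality of the values there, and injectivity of the iterates brings it back.\<close>

lemma inj_on_\<phi>: "inj_on \<phi> \<Omega>"
proof (rule inj_onI)
  fix p q assume pq: "p \<in> \<Omega>" "q \<in> \<Omega>" "\<phi> p = \<phi> q"
  obtain j k j' k' where A: "p \<in> A j k" "q \<in> A j' k'" using pq by (auto simp: \<Omega>_def)
  have "\<phi> p \<in> W 0 j k" "\<phi> p \<in> W 0 j' k'" using \<phi>_in_W0 A pq by metis+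
  then have "int m dvd j - j'" "int m dvd k - k'" using dep_pos_unique by (auto simp: W_def)
  then have A': "q \<in> A j k" using A A_cong[of j j' k k'] by simp
  have "\<forall>\<^sub>F n in sequentially. (F ^^ (2 * n)) p \<in> W 9 (j + int n) (k + int n) \<and> (F ^^ (2 * n)) q \<in> W 9 (j + int n) (k + int n)"
    by (intro eventually_conj eventually_A_in_W A A')
  then obtain n where n: "(F ^^ (2 * n)) p \<in> W 9 (j + int n) (k + int n)" "(F ^^ (2 * n)) q \<in> W 9 (j + int n) (k + int n)"
    by (auto simp: eventually_sequentially)
  have "\<phi> ((F ^^ (2 * n)) p) = \<phi> ((F ^^ (2 * n)) q)" using pq by (simp add: \<phi>_funpow)
  then have "(F ^^ (2 * n)) p = (F ^^ (2 * n)) q" using \<phi>_inj_W9[OF n] by blast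
  then show "p = q" using inj_funpow_F[of "2 * n"] by (simp add: inj_eq)
qed

lemma W11_subset_\<phi>_image:
  assumes "q \<in> W 11 j k"
  obtains p where "p \<in> W 9 j k" "\<phi> p = q"
proof -
  \<comment> \<open>Solving \<open>\<phi> p = q\<close> means finding a fixed point of
    \<open>\<lambda>p. q - (\<phi> p - p)\<close>. As q has depth over 11 and the correction is at
    most 1 in each coordinate, depth at least 10 is preserved; the non-strict inequality makes S
    closed, hence complete, and S lies in \<open>W 9 j k\<close>, where the map contracts.\<close>
  define S where "S = {z. dep j z \<ge> 10} \<times> {z. dep k z \<ge> 10}"
  have S9: "S \<subseteq> W 9 j k" by (auto simp: S_def W_def)
  then have S1: "S \<subseteq> W 1 j k" by (auto simp: W_def)
  have "closed S" unfolding S_def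
    by (intro closed_Times closed_Collect_le continuous_intros)
  then have "complete S" by (simp add: complete_eq_closed)
  moreover have "q \<in> S" using assms by (auto simp: S_def W_def mem_Times_iff)
  then have "S \<noteq> {}" by blast
  moreover have "(\<lambda>p. q - (\<phi> p - p)) ` S \<subseteq> S"
  proof (rule image_subsetI)
    fix p assume "p \<in> S"
    then have p: "p \<in> W 1 j k" using S1 by blast
    have "dep j (fst q - (\<eta> (F p) - fst p)) \<ge> 10"
      using dep_diff_le[of j "fst q" "fst q - (\<eta> (F p) - fst p)"] norm_\<phi>_diff(1)[OF p] assms
      by (simp add: W_def norm_minus_commute)
    moreover have "dep k (snd q - (\<eta> p - snd p)) \<ge> 10"
      using dep_diff_le[of k "snd q" "snd q - (\<eta> p - snd p)"] norm_\<phi>_diff(2)[OF p] assms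
      by (simp add: W_def norm_minus_commute)
    ultimately show "q - (\<phi> p - p) \<in> S" by (simp add: S_def mem_Times_iff \<phi>_def)
  qed
  moreover have "\<forall>x\<in>S. \<forall>y\<in>S. dist (q - (\<phi> x - x)) (q - (\<phi> y - y)) \<le> 1 / 2 * dist x y"
  proof (intro ballI)
    fix x y assume "x \<in> S" "y \<in> S"
    then have "norm ((\<phi> y - y) - (\<phi> x - x)) \<le> 1 / 2 * norm (y - x)" using S9 by (intro \<phi>_diff_contraction) auto
    moreover have "(q - (\<phi> x - x)) - (q - (\<phi> y - y)) = (\<phi> y - y) - (\<phi> x - x)" by simp
    ultimately show "dist (q - (\<phi> x - x)) (q - (\<phi> y - y)) \<le> 1 / 2 * dist x y"
      unfolding dist_norm by (simp only: norm_minus_commute)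
  qed
  ultimately have "\<exists>!x. x \<in> S \<and> q - (\<phi> x - x) = x"
    by (intro Banach_fix[where c = "1 / 2"]) auto
  then obtain p where "p \<in> S" "q - (\<phi> p - p) = p" by blast
  moreover from this(2) have "\<phi> p = q" by (simp add: algebra_simps)
  ultimately show ?thesis using that S9 by blast
qed

text \<open>A point of the product of sectors is scaled by a^n to depth 11, where the fixed point
  argument yields a preimage; the inverse of the 2n-th iterate of F then brings that preimage back
  into the basin.\<close>

lemma \<phi>_image_A: "\<phi> ` A j k = W 0 j k"
proof
  show "\<phi> ` A j k \<subseteq> W 0 j k" using \<phi>_in_W0 by blast
  show "W 0 j k \<subseteq> \<phi> ` A j k"
  proof
    fix q assume q: "q \<in> W 0 j k"
    define e where "e = min (dep j (fst q)) (dep k (snd q))"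
    have e: "e > 0" using q by (auto simp: e_def W_def)
    obtain n where n: "11 / e < \<delta> ^ n" using real_arch_pow[of \<delta> "11 / e"] \<delta>_gt_2 by auto
    then have "11 < \<delta> ^ n * e" using e by (simp add: field_simps)
    moreover have "\<delta> ^ n * e \<le> \<delta> ^ n * dep j (fst q)" "\<delta> ^ n * e \<le> \<delta> ^ n * dep k (snd q)"
      using \<delta>_gt_2 by (auto intro!: mult_left_mono simp: e_def)
    ultimately have "(a ^ n * fst q, a ^ n * snd q) \<in> W 11 (j + int n) (k + int n)"
      by (simp add: W_def dep_mult_a_power)
    then obtain p0 where p0: "p0 \<in> W 9 (j + int n) (k + int n)" "\<phi> p0 = (a ^ n * fst q, a ^ n * snd q)"
      by (rule W11_subset_\<phi>_image)
    define p where "p = (F_inv ^^ (2 * n)) p0"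
    have Fp: "(F ^^ (2 * n)) p = p0" by (simp add: p_def)
    then have "p \<in> AN n j k" using p0(1) unfolding AN_def by (auto simp: W_def)
    then have p: "p \<in> A j k" unfolding A_def by blast
    then have "p \<in> \<Omega>" using A_subset_\<Omega>[of j k] by blast
    from \<phi>_funpow[OF this, of n] have "(a ^ n * fst (\<phi> p), a ^ n * snd (\<phi> p)) = (a ^ n * fst q, a ^ n * snd q)"
      unfolding Fp p0(2) by (rule sym)
    then have "\<phi> p = q" by (simp add: prod_eq_iff)
    then show "q \<in> \<phi> ` A j k" using p by blast
  qed
qed

definition \<psi> :: self_map where "\<psi> = inv_into \<Omega> \<phi>"

lemma \<psi>_\<phi> [simp]: "p \<in> \<Omega> \<Longrightarrow> \<psi> (\<phi> p) = p"
  unfolding \<psi>_def by (rule inv_into_f_f[OF inj_on_\<phi>])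

lemma \<psi>_in_A: "q \<in> W 0 j k \<Longrightarrow> \<psi> q \<in> A j k"
  and \<phi>_\<psi>: "q \<in> W 0 j k \<Longrightarrow> \<phi> (\<psi> q) = q"
proof -
  assume "q \<in> W 0 j k"
  then obtain p where "p \<in> A j k" "q = \<phi> p" using \<phi>_image_A by blast
  then show "\<psi> q \<in> A j k" "\<phi> (\<psi> q) = q" using A_subset_\<Omega>[of j k] by auto
qed

end

section \<open>Holomorphy of the inverse of \<phi> and the half-plane model of a basin\<close>

context transcendental_henon
begin

lemma holomorphic2_\<phi>: "(\<lambda>p. fst (\<phi> p)) holomorphic2_on \<Omega>" "(\<lambda>p. snd (\<phi> p)) holomorphic2_on \<Omega>"
  using holomorphic2_\<eta> holomorphic2_\<eta>_F by (simp_all add: \<phi>_def)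

lemma continuous_on_\<phi>: "continuous_on \<Omega> \<phi>"
  unfolding \<phi>_def
  by (intro continuous_on_Pair holomorphic2_on_imp_continuous_on[OF holomorphic2_\<eta>]
      holomorphic2_on_imp_continuous_on[OF holomorphic2_\<eta>_F])

lemma continuous_on_\<psi>: "continuous_on (\<phi> ` \<Omega>) \<psi>"
  by (rule continuous_on_inverse_open[OF open_\<Omega> continuous_on_\<phi>]) auto

lemma open_\<phi>_image: "open U \<Longrightarrow> U \<subseteq> \<Omega> \<Longrightarrow> open (\<phi> ` U)"
  using continuous_on_\<phi> inj_on_\<phi>
  by (intro invariance_of_domain) (auto intro: continuous_on_subset inj_on_subset)

lemma \<phi>_derivative_near_id:
  assumes "p \<in> W 9 j k"
  obtains a1 b1 a2 b2 where "(\<phi> has_derivative (\<lambda>(u, v). (a1 * u + b1 * v, a2 * u + b2 * v))) (at p)"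
    "a1 * b2 - b1 * a2 \<noteq> 0"
proof -
  have p1: "p \<in> W 1 j k" using assms by (auto simp: W_def)
  obtain a1 b1 where D1: "((\<lambda>p. \<eta> (F p) - fst p) has_derivative (\<lambda>(u, v). a1 * u + b1 * v)) (at p)"
    using holomorphic2_\<phi>_diff(1)[of j k] p1 unfolding holomorphic2_on_def by blast
  obtain a2 b2 where D2: "((\<lambda>p. \<eta> p - snd p) has_derivative (\<lambda>(u, v). a2 * u + b2 * v)) (at p)"
    using holomorphic2_\<phi>_diff(2)[of j k] p1 unfolding holomorphic2_on_def by blast
  have sub: "cball (fst p) 8 \<times> cball (snd p) 8 \<subseteq> W 1 j k"
    using cball_Times_subset_W[of "fst p" "snd p" 1 8 j k] assms by simp
  have b: "cmod a1 \<le> 1 / 8" "cmod b1 \<le> 1 / 8"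
    using holomorphic2_partial_bounds[OF holomorphic2_\<phi>_diff(1) open_W norm_\<phi>_diff(1) _ sub, where a = a1 and b = b1] D1 by auto
  have c: "cmod a2 \<le> 1 / 8" "cmod b2 \<le> 1 / 8"
    using holomorphic2_partial_bounds[OF holomorphic2_\<phi>_diff(2) open_W norm_\<phi>_diff(2) _ sub, where a = a2 and b = b2] D2 by auto
  have "((\<lambda>p. ((\<eta> (F p) - fst p) + fst p, (\<eta> p - snd p) + snd p)) has_derivative
      (\<lambda>h. ((case h of (u, v) \<Rightarrow> a1 * u + b1 * v) + fst h, (case h of (u, v) \<Rightarrow> a2 * u + b2 * v) + snd h))) (at p)"
    by (intro has_derivative_Pair has_derivative_add D1 D2
        bounded_linear_imp_has_derivative bounded_linear_fst bounded_linear_snd)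
  then have D: "(\<phi> has_derivative
      (\<lambda>h. ((case h of (u, v) \<Rightarrow> a1 * u + b1 * v) + fst h, (case h of (u, v) \<Rightarrow> a2 * u + b2 * v) + snd h))) (at p)"
    by (simp add: \<phi>_def[abs_def])
  have D': "(\<phi> has_derivative (\<lambda>(u, v). ((a1 + 1) * u + b1 * v, a2 * u + (b2 + 1) * v))) (at p)"
    by (rule has_derivative_eq_rhs[OF D]) (auto simp: algebra_simps)
  \<comment> \<open>All four entries of the derivative of \<phi> - id are at most 1/8, so a
    vanishing determinant would give 1 <= 1/64 + 1/64 + 1/8 + 1/8.\<close>
  have "(a1 + 1) * (b2 + 1) - b1 * a2 \<noteq> 0"
  proof
    assume "(a1 + 1) * (b2 + 1) - b1 * a2 = 0"
    then have "1 = b1 * a2 - a1 * b2 - a1 - b2" by (simp add: algebra_simps)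
    then have "1 = cmod (b1 * a2 - a1 * b2 - a1 - b2)" by (metis norm_one)
    also have "\<dots> \<le> cmod (b1 * a2) + cmod (a1 * b2) + cmod a1 + cmod b2"
      by (smt (verit) norm_triangle_ineq4)
    also have "\<dots> \<le> 1 / 8 * (1 / 8) + 1 / 8 * (1 / 8) + 1 / 8 + 1 / 8"
      unfolding norm_mult using b c by (intro add_mono mult_mono) auto
    finally show False by simp
  qed
  with D' show ?thesis by (rule that)
qed

text \<open>Invariance of domain makes \<psi> continuous, so the invertible derivative of \<phi> can
  be inverted pointwise. The inverse of a complex matrix is again complex linear, whence
  holomorphy.\<close>

lemma holomorphic2_\<psi>_W9:
  "(\<lambda>q. fst (\<psi> q)) holomorphic2_on \<phi> ` W 9 j k \<and> (\<lambda>q. snd (\<psi> q)) holomorphic2_on \<phi> ` W 9 j k"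
proof -
  have W: "W 9 j k \<subseteq> \<Omega>" by (rule W_subset_\<Omega>) simp
  have D\<psi>: "\<exists>a b c d. (\<psi> has_derivative (\<lambda>(u, v). (a * u + b * v, c * u + d * v))) (at q)" if q: "q \<in> \<phi> ` W 9 j k" for q
  proof -
    obtain p where p: "p \<in> W 9 j k" "q = \<phi> p" using q by blast
    obtain a1 b1 a2 b2 where D: "(\<phi> has_derivative (\<lambda>(u, v). (a1 * u + b1 * v, a2 * u + b2 * v))) (at p)"
      and det: "a1 * b2 - b1 * a2 \<noteq> 0"
      using \<phi>_derivative_near_id[OF p(1)] .
    define \<Delta> where "\<Delta> = a1 * b2 - b1 * a2"
    define G where "G = (\<lambda>(u, v). (b2 / \<Delta> * u + (- b1 / \<Delta>) * v, (- a2 / \<Delta>) * u + a1 / \<Delta> * v))"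
    have pO: "p \<in> \<Omega>" using p W by blast
    have "(\<psi> has_derivative G) (at q)"
    proof (rule has_derivative_inverse_basic[where f = \<phi> and T = "\<phi> ` \<Omega>"])
      show "(\<phi> has_derivative (\<lambda>(u, v). (a1 * u + b1 * v, a2 * u + b2 * v))) (at (\<psi> q))"
        using D p pO by simp
      show "bounded_linear G"
        unfolding G_def split_beta
        by (intro bounded_linear_Pair bounded_linear_add bounded_linear_mult_right[THEN bounded_linear_compose]
            bounded_linear_fst bounded_linear_snd)
      show "G \<circ> (\<lambda>(u, v). (a1 * u + b1 * v, a2 * u + b2 * v)) = id"
      proof
        fix h :: "complex \<times> complex"
        have "b2 * (a1 * u + b1 * v) - b1 * (a2 * u + b2 * v) = \<Delta> * u" for u v
          by (simp add: \<Delta>_def algebra_simps)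
        moreover have "a1 * (a2 * u + b2 * v) - a2 * (a1 * u + b1 * v) = \<Delta> * v" for u v
          by (simp add: \<Delta>_def algebra_simps)
        moreover have "\<Delta> \<noteq> 0" using det by (simp add: \<Delta>_def)
        ultimately show "(G \<circ> (\<lambda>(u, v). (a1 * u + b1 * v, a2 * u + b2 * v))) h = id h"
          by (cases h) (simp add: G_def diff_divide_distrib[symmetric] minus_divide_left[symmetric] field_simps)
      qed
      show "open (\<phi> ` \<Omega>)" by (intro open_\<phi>_image open_\<Omega> order_refl)
      then show "isCont \<psi> q"
        using continuous_on_\<psi> p pO by (simp add: continuous_on_eq_continuous_at)
      show "q \<in> \<phi> ` \<Omega>" using p pO by blast
      show "\<phi> (\<psi> z) = z" if "z \<in> \<phi> ` \<Omega>" for z using that by auto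
    qed
    then show ?thesis unfolding G_def by blast
  qed
  have *: "\<exists>a b c d. ((\<lambda>q. fst (\<psi> q)) has_derivative (\<lambda>(u, v). a * u + b * v)) (at q) \<and>
      ((\<lambda>q. snd (\<psi> q)) has_derivative (\<lambda>(u, v). c * u + d * v)) (at q)" if "q \<in> \<phi> ` W 9 j k" for q
  proof -
    obtain a b c d where D: "(\<psi> has_derivative (\<lambda>(u, v). (a * u + b * v, c * u + d * v))) (at q)"
      using D\<psi>[OF \<open>q \<in> \<phi> ` W 9 j k\<close>] by blast
    have "((\<lambda>q. fst (\<psi> q)) has_derivative (\<lambda>(u, v). a * u + b * v)) (at q)"
      by (rule has_derivative_eq_rhs[OF has_derivative_fst[OF D]]) auto
    moreover have "((\<lambda>q. snd (\<psi> q)) has_derivative (\<lambda>(u, v). c * u + d * v)) (at q)"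
      by (rule has_derivative_eq_rhs[OF has_derivative_snd[OF D]]) auto
    ultimately show ?thesis by blast
  qed
  show ?thesis unfolding holomorphic2_on_def using * by meson
qed

lemma holomorphic2_F_inv: "(\<lambda>p. fst ((F_inv ^^ n) p)) holomorphic2_on U \<and> (\<lambda>p. snd ((F_inv ^^ n) p)) holomorphic2_on U"
proof (induction n)
  case 0 show ?case
    using holomorphic2_on_fst[of U] holomorphic2_on_snd[of U] by simp
next
  case (Suc n)
  have *: "E holomorphic_on UNIV" unfolding E_def by (intro holomorphic_intros)
  show ?case
    using Suc unfolding funpow.simps comp_def F_inv_def split_beta fst_conv snd_conv
    by (intro conjI holomorphic2_on_divide holomorphic2_on_diff holomorphic2_on_const
        holomorphic2_on_compose[OF _ *]) auto
qed

text \<open>Near an arbitrary point, \<open>\<psi>\<close> is \<open>F\<^bsup>-2n\<^esup>\<close> after \<open>\<psi>\<close> near a point far inside the absorbing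
  region after multiplication by \<open>a\<^bsup>n\<^esup>\<close>.\<close>

lemma holomorphic2_\<psi>: "(\<lambda>q. fst (\<psi> q)) holomorphic2_on \<phi> ` \<Omega>" "(\<lambda>q. snd (\<psi> q)) holomorphic2_on \<phi> ` \<Omega>"
proof -
  have "\<exists>U. open U \<and> q \<in> U \<and> (\<lambda>q. fst (\<psi> q)) holomorphic2_on U \<and> (\<lambda>q. snd (\<psi> q)) holomorphic2_on U"
    if "q \<in> \<phi> ` \<Omega>" for q
  proof -
    obtain p where p: "p \<in> \<Omega>" "q = \<phi> p" using \<open>q \<in> \<phi> ` \<Omega>\<close> by blast
    then obtain j k where "p \<in> A j k" by (auto simp: \<Omega>_def)
    from eventually_A_in_W[OF this, of 9] obtain n where
      n: "(F ^^ (2 * n)) p \<in> W 9 (j + int n) (k + int n)" by (auto simp: eventually_sequentially)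
    define X where "X = W 9 (j + int n) (k + int n)"
    define U where "U = (F ^^ (2 * n)) -` X"
    have XO: "X \<subseteq> \<Omega>" unfolding X_def by (rule W_subset_\<Omega>) simp
    have UO: "U \<subseteq> \<Omega>"
    proof
      fix x assume "x \<in> U"
      then have "(F ^^ (2 * n)) x \<in> W 1 (j + int n) (k + int n)" by (auto simp: U_def X_def W_def)
      then show "x \<in> \<Omega>" unfolding \<Omega>_def A_def AN_def by blast
    qed
    have oU: "open U" unfolding U_def X_def by (rule open_vimage[OF open_W continuous_on_funpow_F])
    have oV: "open (\<phi> ` U)" by (rule open_\<phi>_image[OF oU UO])
    have \<psi>X: "(\<lambda>q. fst (\<psi> q)) holomorphic2_on \<phi> ` X" "(\<lambda>q. snd (\<psi> q)) holomorphic2_on \<phi> ` X"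
      using holomorphic2_\<psi>_W9 by (auto simp: X_def)
    have lin: "(\<lambda>q. a ^ n * fst q) holomorphic2_on \<phi> ` U" "(\<lambda>q. a ^ n * snd q) holomorphic2_on \<phi> ` U"
      by (intro holomorphic2_on_mult holomorphic2_on_const holomorphic2_on_fst holomorphic2_on_snd)+
    have eq: "(a ^ n * fst (\<phi> x), a ^ n * snd (\<phi> x)) = \<phi> ((F ^^ (2 * n)) x)" if "x \<in> U" for x
      using \<phi>_funpow[of x n] that UO by auto
    have inX: "(a ^ n * fst y, a ^ n * snd y) \<in> \<phi> ` X" if y: "y \<in> \<phi> ` U" for y
    proof -
      obtain x where x: "x \<in> U" "y = \<phi> x" using y by blast
      then have "(F ^^ (2 * n)) x \<in> X" by (simp add: U_def)
      then show ?thesis using eq[OF x(1)] x(2) by simp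
    qed
    define g where "g = (\<lambda>q. \<psi> (a ^ n * fst q, a ^ n * snd q))"
    have g: "(\<lambda>q. fst (g q)) holomorphic2_on \<phi> ` U" "(\<lambda>q. snd (g q)) holomorphic2_on \<phi> ` U"
      unfolding g_def
      using holomorphic2_on_pair_compose[OF \<psi>X(1) lin inX] holomorphic2_on_pair_compose[OF \<psi>X(2) lin inX] by simp_all
    have \<psi>_eq: "(F_inv ^^ (2 * n)) (fst (g y), snd (g y)) = \<psi> y" if y: "y \<in> \<phi> ` U" for y
    proof -
      obtain x where x: "x \<in> U" "y = \<phi> x" using y by blast
      have "(F ^^ (2 * n)) x \<in> \<Omega>" using x XO by (auto simp: U_def)
      then have "g y = (F ^^ (2 * n)) x" unfolding g_def x(2) eq[OF x(1)] by simp
      moreover have "\<psi> y = x" using x UO by auto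
      ultimately show ?thesis by simp
    qed
    have "(\<lambda>q. fst (\<psi> q)) holomorphic2_on \<phi> ` U"
      by (rule holomorphic2_on_transform[OF holomorphic2_on_pair_compose[OF conjunct1[OF holomorphic2_F_inv[of "2 * n" UNIV]] g UNIV_I] oV])
        (simp only: \<psi>_eq)
    moreover have "(\<lambda>q. snd (\<psi> q)) holomorphic2_on \<phi> ` U"
      by (rule holomorphic2_on_transform[OF holomorphic2_on_pair_compose[OF conjunct2[OF holomorphic2_F_inv[of "2 * n" UNIV]] g UNIV_I] oV])
        (simp only: \<psi>_eq)
    moreover have "q \<in> \<phi> ` U" using p n by (auto simp: U_def X_def)
    ultimately show ?thesis using oV by blast
  qed
  then show "(\<lambda>q. fst (\<psi> q)) holomorphic2_on \<phi> ` \<Omega>" "(\<lambda>q. snd (\<psi> q)) holomorphic2_on \<phi> ` \<Omega>"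
    unfolding holomorphic2_on_def by meson+
qed

lemma biholomorphism_\<phi>: "biholomorphism \<Omega> (\<phi> ` \<Omega>) \<phi> \<psi>"
  by (rule biholomorphismI[OF open_\<Omega> open_\<phi>_image[OF open_\<Omega> order_refl] holomorphic2_\<phi> holomorphic2_\<psi>]) auto

text \<open>Differentiating \<phi> \<circ> \<psi> = id exhibits a preimage of every vector. That the
  two components have independent differentials is what gives the limit functions rank one.\<close>

lemma \<phi>_derivative_surj:
  assumes "p \<in> \<Omega>"
    and D1: "((\<lambda>p. fst (\<phi> p)) has_derivative D1) (at p)" and D2: "((\<lambda>p. snd (\<phi> p)) has_derivative D2) (at p)"
  obtains h where "D1 h = x" "D2 h = y"
proof -
  define q where "q = \<phi> p"
  have q: "q \<in> \<phi> ` \<Omega>" "\<psi> q = p" using assms(1) by (auto simp: q_def)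
  obtain G1 G2 where G: "((\<lambda>q. fst (\<psi> q)) has_derivative G1) (at q)" "((\<lambda>q. snd (\<psi> q)) has_derivative G2) (at q)"
    using holomorphic2_\<psi> q(1) unfolding holomorphic2_on_def by meson
  have G': "(\<psi> has_derivative (\<lambda>h. (G1 h, G2 h))) (at q)"
    using has_derivative_Pair[OF G] by simp
  have open\<phi>: "open (\<phi> ` \<Omega>)" by (intro open_\<phi>_image open_\<Omega> order_refl)
  have "((\<lambda>q. fst (\<phi> (\<psi> q))) has_derivative (\<lambda>h. D1 (G1 h, G2 h))) (at q)"
    by (rule has_derivative_compose[OF G']) (use D1 q in simp)
  moreover have "((\<lambda>q. fst (\<phi> (\<psi> q))) has_derivative fst) (at q)"
    by (rule has_derivative_transform_within_open[OF bounded_linear_imp_has_derivative[OF bounded_linear_fst] open\<phi> q(1)]) auto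
  ultimately have 1: "(\<lambda>h. D1 (G1 h, G2 h)) = fst" by (rule has_derivative_unique)
  have "((\<lambda>q. snd (\<phi> (\<psi> q))) has_derivative (\<lambda>h. D2 (G1 h, G2 h))) (at q)"
    by (rule has_derivative_compose[OF G']) (use D2 q in simp)
  moreover have "((\<lambda>q. snd (\<phi> (\<psi> q))) has_derivative snd) (at q)"
    by (rule has_derivative_transform_within_open[OF bounded_linear_imp_has_derivative[OF bounded_linear_snd] open\<phi> q(1)]) auto
  ultimately have 2: "(\<lambda>h. D2 (G1 h, G2 h)) = snd" by (rule has_derivative_unique)
  show ?thesis
    by (rule that[of "(G1 (x, y), G2 (x, y))"]) (use fun_cong[OF 1, of "(x, y)"] fun_cong[OF 2, of "(x, y)"] in auto)
qed

lemma W0_iff: "(x, y) \<in> W 0 j k \<longleftrightarrow> depth \<gamma> (x * \<omega> (- j)) > 0 \<and> depth \<gamma> (y * \<omega> (- k)) > 0"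
  by (simp add: W_def dep_def)

lemma biholomorphism_A_half_planes: "\<exists>f g. biholomorphism (A j k) (half_plane \<times> half_plane) f g"
proof -
  define f where "f p = (sector_to_half_plane \<gamma> (fst (\<phi> p) * \<omega> (- j)), sector_to_half_plane \<gamma> (snd (\<phi> p) * \<omega> (- k)))" for p
  define s where "s q = (half_plane_to_sector \<gamma> (fst q) * \<omega> j, half_plane_to_sector \<gamma> (snd q) * \<omega> k)" for q
  define g where "g q = \<psi> (fst (s q), snd (s q))" for q
  note sm = sector_maps[OF \<gamma>_bounds(1,3)]
  have \<phi>0: "depth \<gamma> (fst (\<phi> p) * \<omega> (- j)) > 0" "depth \<gamma> (snd (\<phi> p) * \<omega> (- k)) > 0" if "p \<in> A j k" for p
    using \<phi>_in_W0[OF that] W0_iff[of "fst (\<phi> p)" "snd (\<phi> p)"] by auto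
  have s: "(fst (s q), snd (s q)) \<in> W 0 j k" if "q \<in> half_plane \<times> half_plane" for q
    using that sm(1) by (auto simp: W0_iff s_def half_plane_def mult.assoc)
  have "biholomorphism (A j k) (half_plane \<times> half_plane) f g"
  proof (rule biholomorphismI)
    show "(\<lambda>p. fst (f p)) holomorphic2_on A j k" "(\<lambda>p. snd (f p)) holomorphic2_on A j k"
      unfolding f_def fst_conv snd_conv using \<phi>0
      by (auto intro!: holomorphic2_on_compose[OF _ holomorphic_on_sector_to_half_plane[OF \<gamma>_bounds(1,3)]]
          holomorphic2_on_mult holomorphic2_on_const open_depth
          holomorphic2_on_subset[OF holomorphic2_\<phi>(1) A_subset_\<Omega>] holomorphic2_on_subset[OF holomorphic2_\<phi>(2) A_subset_\<Omega>])
    have hs: "(\<lambda>q. fst (s q)) holomorphic2_on half_plane \<times> half_plane" "(\<lambda>q. snd (s q)) holomorphic2_on half_plane \<times> half_plane"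
      unfolding s_def fst_conv snd_conv
      by (auto intro!: holomorphic2_on_compose[OF _ holomorphic_on_half_plane_to_sector]
          holomorphic2_on_mult holomorphic2_on_const open_half_plane holomorphic2_on_fst holomorphic2_on_snd)
    have s\<Omega>: "(fst (s q), snd (s q)) \<in> \<phi> ` \<Omega>" if "q \<in> half_plane \<times> half_plane" for q
      using s[OF that] \<phi>_image_A[of j k] A_subset_\<Omega>[of j k] by blast
    show "(\<lambda>p. fst (g p)) holomorphic2_on half_plane \<times> half_plane" "(\<lambda>p. snd (g p)) holomorphic2_on half_plane \<times> half_plane"
      unfolding g_def
      using holomorphic2_on_pair_compose[OF holomorphic2_\<psi>(1) hs s\<Omega>] holomorphic2_on_pair_compose[OF holomorphic2_\<psi>(2) hs s\<Omega>] by simp_all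
    show "f p \<in> half_plane \<times> half_plane" if "p \<in> A j k" for p
      using \<phi>0[OF that] sm(3) by (simp add: f_def half_plane_def)
    show "g q \<in> A j k" if "q \<in> half_plane \<times> half_plane" for q
      unfolding g_def by (rule \<psi>_in_A[OF s[OF that]])
    show "g (f p) = p" if "p \<in> A j k" for p
    proof -
      have "s (f p) = \<phi> p"
        using \<phi>0[OF that] sm(4) by (simp add: f_def s_def mult.assoc prod_eq_iff)
      moreover have "p \<in> \<Omega>" using that A_subset_\<Omega> by blast
      ultimately show ?thesis by (simp add: g_def)
    qed
    show "f (g q) = q" if "q \<in> half_plane \<times> half_plane" for q
    proof -
      have "\<phi> (g q) = s q" unfolding g_def using \<phi>_\<psi>[OF s[OF that]] by simp
      then show ?thesis using that sm(2) by (auto simp: f_def s_def mult.assoc half_plane_def)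
    qed
  qed (auto intro: open_A open_Times open_half_plane)
  then show ?thesis by blast
qed

end

section \<open>Convergence in the projective plane\<close>

lemma in_chart_abs: "v \<noteq> 0 \<Longrightarrow> in_chart i (abs_cp2 v) \<longleftrightarrow> v $ i \<noteq> 0"
  by (rule in_chart.abs_eq) (simp add: eq_onp_def same_line_refl)

lemma affine_coords_abs: "v \<noteq> 0 \<Longrightarrow> affine_coords i (abs_cp2 v) = (\<chi> j. v $ j / v $ i)"
  by (rule affine_coords.abs_eq) (simp add: eq_onp_def same_line_refl)

text \<open>The metric is pulled back along \<open>line_projector\<close>, so charts expressed by
  matrix entries of the projector are continuous without further topology.\<close>

lemma in_chart_iff: "in_chart i x \<longleftrightarrow> line_projector x $ i $ i \<noteq> 0"
proof -
  obtain v where v: "v \<noteq> 0" "norm v = 1" "x = abs_cp2 v" by (rule cp2_cases)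
  then show ?thesis by (simp add: in_chart_abs line_projector_abs)
qed

lemma affine_coords_eq:
  assumes "in_chart i x"
  shows "affine_coords i x = (\<chi> j. line_projector x $ j $ i / line_projector x $ i $ i)"
proof -
  obtain v where v: "v \<noteq> 0" "norm v = 1" "x = abs_cp2 v" by (rule cp2_cases)
  then show ?thesis using assms by (simp add: in_chart_abs line_projector_abs affine_coords_abs vec_eq_iff)
qed

lemma continuous_on_line_projector: "continuous_on U line_projector"
  unfolding continuous_on_iff dist_cp2_def by auto

lemma open_in_chart: "open {x. in_chart i x}"
proof -
  have "open ((\<lambda>x. line_projector x $ i $ i) -` (- {0}))"
    by (intro open_vimage continuous_intros continuous_on_line_projector)
  then show ?thesis by (simp add: in_chart_iff vimage_def)
qed

lemma closed_line_at_infinity: "closed line_at_infinity"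
proof -
  have "line_at_infinity = - {x. in_chart 1 x}" by (auto simp: line_at_infinity_def)
  then show ?thesis using closed_Compl[OF open_in_chart[of 1]] by simp
qed

lemma continuous_on_affine_coords: "continuous_on {x. in_chart i x} (affine_coords i)"
proof -
  have "continuous_on {x. in_chart i x} (\<lambda>x. \<chi> j. line_projector x $ j $ i / line_projector x $ i $ i)"
    by (intro continuous_intros continuous_on_line_projector) (auto simp: in_chart_iff)
  then show ?thesis by (rule continuous_on_eq) (simp add: affine_coords_eq)
qed

lemma vector_eq_0_iff: "vector [x, y, z] = (0 :: complex^3) \<longleftrightarrow> x = 0 \<and> y = 0 \<and> z = 0"
  by (simp add: vec_eq_iff forall_3)

lemma line_at_infinity_cases:
  assumes "x \<in> line_at_infinity"
  obtains y z where "y \<noteq> 0 \<or> z \<noteq> 0" "x = abs_cp2 (vector [0, y, z])"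
proof -
  obtain v where v: "v \<noteq> 0" "norm v = 1" "x = abs_cp2 v" by (rule cp2_cases)
  have "v $ 1 = 0" using assms v by (simp add: line_at_infinity_def in_chart_abs)
  then have "v = vector [0, v $ 2, v $ 3]" by (simp add: vec_eq_iff forall_3)
  then show ?thesis using that v by (metis vector_eq_0_iff)
qed

lemma abs_cp2_in_line_at_infinity: "y \<noteq> 0 \<or> z \<noteq> 0 \<Longrightarrow> abs_cp2 (vector [0, y, z]) \<in> line_at_infinity"
  by (auto simp: line_at_infinity_def in_chart_abs vector_eq_0_iff)

lemma abs_cp2_eqI: "u \<noteq> 0 \<Longrightarrow> v \<noteq> 0 \<Longrightarrow> v = c *s u \<Longrightarrow> abs_cp2 u = abs_cp2 v"
  using abs_cp2_eq_iff by blast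

lemma continuous_on_vector3 [continuous_intros]:
  fixes f g h :: "'a::topological_space \<Rightarrow> complex"
  assumes "continuous_on U f" "continuous_on U g" "continuous_on U h"
  shows "continuous_on U (\<lambda>x. vector [f x, g x, h x] :: complex^3)"
proof -
  have *: "(\<lambda>x. vector [f x, g x, h x] :: complex^3) = (\<lambda>x. \<chi> i. if i = 1 then f x else if i = 2 then g x else h x)"
    by (simp add: vec_eq_iff forall_3 fun_eq_iff)
  show ?thesis
    unfolding *
  proof (intro continuous_on_vec_lambda)
    fix i :: 3
    show "continuous_on U (\<lambda>x. if i = 1 then f x else if i = 2 then g x else h x)"
      using assms by (cases "i = 1"; cases "i = 2") simp_all
  qed
qed

lemma uniform_limit_compose_continuous_open:
  fixes h :: "'a \<Rightarrow> 'b::metric_space" and G :: "'b \<Rightarrow> 'c::metric_space"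
  assumes lim: "uniform_limit K f h F" and cpt: "compact (h ` K)" and S: "open S" "h ` K \<subseteq> S"
    and G: "continuous_on S G"
  shows "uniform_limit K (\<lambda>n x. G (f n x)) (\<lambda>x. G (h x)) F"
    and "\<forall>\<^sub>F n in F. \<forall>x\<in>K. f n x \<in> S"
proof -
  have key: "\<exists>d>0. \<forall>x\<in>h ` K. \<forall>y. dist x y < d \<longrightarrow> y \<in> S \<and> dist (G y) (G x) < e" if "e > 0" for e
  proof -
    have "\<exists>r>0. \<forall>y. dist x y < r \<longrightarrow> y \<in> S \<and> dist (G y) (G x) < e / 2" if "x \<in> h ` K" for x
    proof -
      have x: "x \<in> S" using that S by blast
      obtain r1 where r1: "r1 > 0" "ball x r1 \<subseteq> S" using S(1) x open_contains_ball by blast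
      obtain r2 where r2: "r2 > 0" "\<And>y. y \<in> S \<Longrightarrow> dist y x < r2 \<Longrightarrow> dist (G y) (G x) < e / 2"
        using G x \<open>e > 0\<close> unfolding continuous_on_iff by (meson half_gt_zero)
      show ?thesis
        using r1 r2 by (intro exI[of _ "min r1 r2"]) (auto simp: dist_commute subset_iff)
    qed
    then obtain r where r: "\<And>x. x \<in> h ` K \<Longrightarrow> r x > 0"
      "\<And>x y. x \<in> h ` K \<Longrightarrow> dist x y < r x \<Longrightarrow> y \<in> S \<and> dist (G y) (G x) < e / 2" by metis
    obtain d where d: "d > 0" "\<And>x. x \<in> h ` K \<Longrightarrow> \<exists>B \<in> (\<lambda>x. ball x (r x)) ` (h ` K). ball x d \<subseteq> B"
      by (rule Heine_Borel_lemma[OF cpt, of "(\<lambda>x. ball x (r x)) ` (h ` K)"]) (use r(1) in force)+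
    have "y \<in> S \<and> dist (G y) (G x) < e" if xy: "x \<in> h ` K" "dist x y < d" for x y
    proof -
      obtain x' where x': "x' \<in> h ` K" "ball x d \<subseteq> ball x' (r x')" using d(2)[OF xy(1)] by blast
      have "x \<in> ball x d" "y \<in> ball x d" using xy d(1) by simp_all
      then have "x \<in> ball x' (r x')" "y \<in> ball x' (r x')" using x'(2) by blast+
      then have "y \<in> S" "dist (G y) (G x') < e / 2" "dist (G x) (G x') < e / 2"
        using r(2)[OF x'(1)] by auto
      then show ?thesis using dist_triangle2[of "G y" "G x" "G x'"] by simp
    qed
    then show ?thesis using d(1) by blast
  qed
  have ev: "\<forall>\<^sub>F n in F. \<forall>x\<in>K. f n x \<in> S \<and> dist (G (f n x)) (G (h x)) < e" if e: "e > 0" for e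
  proof -
    obtain d where d: "d > 0" "\<And>x y. x \<in> h ` K \<Longrightarrow> dist x y < d \<Longrightarrow> y \<in> S \<and> dist (G y) (G x) < e"
      using key[OF e] by blast
    show ?thesis
      using uniform_limitD[OF lim d(1)] by eventually_elim (use d(2) in \<open>auto simp: dist_commute\<close>)
  qed
  show "uniform_limit K (\<lambda>n x. G (f n x)) (\<lambda>x. G (h x)) F"
  proof (rule uniform_limitI)
    fix e :: real assume "e > 0"
    from ev[OF this] show "\<forall>\<^sub>F n in F. \<forall>x\<in>K. dist (G (f n x)) (G (h x)) < e"
      by (rule eventually_mono) blast
  qed
  show "\<forall>\<^sub>F n in F. \<forall>x\<in>K. f n x \<in> S"
    using ev[OF zero_less_one] by (rule eventually_mono) blast
qed

lemma uniform_limit_Pair: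
  assumes "uniform_limit K f f' F" "uniform_limit K g g' F"
  shows "uniform_limit K (\<lambda>n x. (f n x, g n x)) (\<lambda>x. (f' x, g' x)) F"
proof (rule uniform_limitI)
  fix e :: real assume "e > 0"
  then have "e / 2 > 0" by simp
  from uniform_limitD[OF assms(1) this] uniform_limitD[OF assms(2) this]
  show "\<forall>\<^sub>F n in F. \<forall>x\<in>K. dist (f n x, g n x) (f' x, g' x) < e"
  proof eventually_elim
    case (elim n)
    show ?case
    proof
      fix x assume "x \<in> K"
      then have "dist (f n x) (f' x) < e / 2" "dist (g n x) (g' x) < e / 2" using elim by auto
      moreover have "dist (f n x, g n x) (f' x, g' x) \<le> dist (f n x) (f' x) + dist (g n x) (g' x)"
        unfolding dist_Pair_Pair by (rule sqrt_sum_squares_le_sum) auto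
      ultimately show "dist (f n x, g n x) (f' x, g' x) < e" by linarith
    qed
  qed
qed

lemma uniform_limit_abs_cp2:
  fixes u v w :: "nat \<Rightarrow> 'a::topological_space \<Rightarrow> complex"
  assumes lim: "uniform_limit K u u' F" "uniform_limit K v v' F" "uniform_limit K w w' F"
    and K: "compact K" "continuous_on K u'" "continuous_on K v'" "continuous_on K w'"
    and nz: "\<And>x. x \<in> K \<Longrightarrow> vector [u' x, v' x, w' x] \<noteq> (0 :: complex^3)"
  shows "uniform_limit K (\<lambda>n x. abs_cp2 (vector [u n x, v n x, w n x])) (\<lambda>x. abs_cp2 (vector [u' x, v' x, w' x])) F"
proof -
  define G where "G = (\<lambda>(x, y, z). abs_cp2 (vector [x, y, z]))"
  have "continuous_on (- {(0, 0, 0)}) G"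
  proof -
    have "continuous_on (- {(0, 0, 0)}) (\<lambda>p. abs_cp2 (vector [fst p, fst (snd p), snd (snd p)]))"
      by (rule continuous_on_compose2[OF continuous_on_abs_cp2])
        (auto intro!: continuous_intros simp: vector_eq_0_iff)
    then show ?thesis by (simp add: G_def split_beta)
  qed
  moreover have "uniform_limit K (\<lambda>n x. (u n x, v n x, w n x)) (\<lambda>x. (u' x, v' x, w' x)) F"
    by (intro uniform_limit_Pair lim)
  moreover have "compact ((\<lambda>x. (u' x, v' x, w' x)) ` K)"
    by (intro compact_continuous_image continuous_intros K)
  moreover have "(\<lambda>x. (u' x, v' x, w' x)) ` K \<subseteq> - {(0, 0, 0)}"
    using nz by (auto simp: vector_eq_0_iff)
  ultimately have "uniform_limit K (\<lambda>n x. G (u n x, v n x, w n x)) (\<lambda>x. G (u' x, v' x, w' x)) F"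
    by (intro uniform_limit_compose_continuous_open(1)[where S = "- {(0, 0, 0)}" and G = G]) auto
  then show ?thesis by (simp add: G_def)
qed

lemma uniform_limit_affine_coords:
  assumes lim: "uniform_limit K f h F" and K: "compact K" "continuous_on K h" "\<And>x. x \<in> K \<Longrightarrow> in_chart i (h x)"
  shows "uniform_limit K (\<lambda>n x. affine_coords i (f n x) $ j) (\<lambda>x. affine_coords i (h x) $ j) F"
    and "\<forall>\<^sub>F n in F. \<forall>x\<in>K. in_chart i (f n x)"
proof -
  have *: "compact (h ` K)" "h ` K \<subseteq> {x. in_chart i x}"
    using K by (auto intro: compact_continuous_image)
  have "continuous_on {x. in_chart i x} (\<lambda>x. affine_coords i x $ j)"
    by (intro continuous_intros continuous_on_affine_coords)
  from uniform_limit_compose_continuous_open(1)[OF lim *(1) open_in_chart *(2) this]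
  show "uniform_limit K (\<lambda>n x. affine_coords i (f n x) $ j) (\<lambda>x. affine_coords i (h x) $ j) F" .
  show "\<forall>\<^sub>F n in F. \<forall>x\<in>K. in_chart i (f n x)"
    using uniform_limit_compose_continuous_open(2)[OF lim *(1) open_in_chart *(2) continuous_on_affine_coords] by simp
qed

lemma embed_cp2_chart2: "in_chart 2 (embed_cp2 (z, w)) \<longleftrightarrow> z \<noteq> 0"
  "affine_coords 2 (embed_cp2 (z, w)) = vector [1 / z, z / z, w / z]"
proof -
  have *: "vector [1, z, w] \<noteq> (0 :: complex^3)" by (simp add: vector_eq_0_iff)
  show "in_chart 2 (embed_cp2 (z, w)) \<longleftrightarrow> z \<noteq> 0"
    "affine_coords 2 (embed_cp2 (z, w)) = vector [1 / z, z / z, w / z]"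
    using * by (simp_all add: embed_cp2_def in_chart_abs affine_coords_abs vec_eq_iff forall_3)
qed

lemma embed_cp2_chart3: "in_chart 3 (embed_cp2 (z, w)) \<longleftrightarrow> w \<noteq> 0"
  "affine_coords 3 (embed_cp2 (z, w)) = vector [1 / w, z / w, w / w]"
proof -
  have *: "vector [1, z, w] \<noteq> (0 :: complex^3)" by (simp add: vector_eq_0_iff)
  show "in_chart 3 (embed_cp2 (z, w)) \<longleftrightarrow> w \<noteq> 0"
    "affine_coords 3 (embed_cp2 (z, w)) = vector [1 / w, z / w, w / w]"
    using * by (simp_all add: embed_cp2_def in_chart_abs affine_coords_abs vec_eq_iff forall_3)
qed

section \<open>Holomorphic maps into the projective plane and their rank\<close>

lemma holomorphic_into_cp2_abs:
  assumes "open U" and f: "f1 holomorphic2_on U" "f2 holomorphic2_on U" "f3 holomorphic2_on U"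
    and nz: "\<And>p. p \<in> U \<Longrightarrow> vector [f1 p, f2 p, f3 p] \<noteq> (0 :: complex^3)"
    and h: "\<And>p. p \<in> U \<Longrightarrow> h p = abs_cp2 (vector [f1 p, f2 p, f3 p])"
  shows "holomorphic_into_cp2 U h"
proof -
  define v where "v p = (vector [f1 p, f2 p, f3 p] :: complex^3)" for p
  have vc: "(\<lambda>p. v p $ j) holomorphic2_on U" for j
    using exhaust_3[of j] f by (auto simp: v_def)
  have cv: "continuous_on U v"
    unfolding v_def by (intro continuous_intros holomorphic2_on_imp_continuous_on f)
  have ch: "continuous_on U h"
    by (rule continuous_on_eq[OF continuous_on_compose2[OF continuous_on_abs_cp2 cv]])
      (use nz h in \<open>auto simp: v_def\<close>)
  have "(\<lambda>p. affine_coords i (h p) $ j) holomorphic2_on {p \<in> U. in_chart i (h p)}" for i j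
  proof -
    have *: "{p \<in> U. in_chart i (h p)} = U \<inter> (\<lambda>p. v p $ i) -` (- {0})"
      using nz h by (auto simp: v_def in_chart_abs)
    have o: "open {p \<in> U. in_chart i (h p)}"
      unfolding * using holomorphic2_on_imp_continuous_on[OF vc] \<open>open U\<close>
      by (intro continuous_open_preimage) auto
    have "(\<lambda>p. v p $ j / v p $ i) holomorphic2_on {p \<in> U. in_chart i (h p)}"
      by (intro holomorphic2_on_divide holomorphic2_on_subset[OF vc]) (auto simp: *)
    then show ?thesis
      by (rule holomorphic2_on_transform[OF _ o]) (use nz h in \<open>auto simp: affine_coords_abs v_def\<close>)
  qed
  then show ?thesis unfolding holomorphic_into_cp2_def using \<open>open U\<close> ch by blast
qed

text \<open>Such a map moves only along the fixed direction e, so its derivative ranges over the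
  complex line spanned by e. In an affine chart this is the form of a map into the line at
  infinity.\<close>

lemma dim_range_rank_one:
  assumes U: "open U" "p \<in> U" and f: "\<And>q. q \<in> U \<Longrightarrow> f q = c + u q *s e" and e: "e \<noteq> (0 :: complex^3)"
    and D: "(u has_derivative D) (at p)" "surj D"
  shows "vec.dim (range (frechet_derivative f (at p))) = 1"
proof -
  have bl: "bounded_linear (\<lambda>z. z *s e)"
    unfolding linear_conv_bounded_linear[symmetric]
    by (rule linearI) (auto simp: vec_eq_iff algebra_simps)
  have "((\<lambda>q. u q *s e) has_derivative (\<lambda>h. D h *s e)) (at p)"
    by (rule bounded_linear.has_derivative[OF bl D(1)])
  then have "((\<lambda>q. c + u q *s e) has_derivative (\<lambda>h. D h *s e)) (at p)"
    by (auto intro!: derivative_eq_intros)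
  then have "(f has_derivative (\<lambda>h. D h *s e)) (at p)"
    by (rule has_derivative_transform_within_open[OF _ U]) (simp add: f)
  then have "frechet_derivative f (at p) = (\<lambda>h. D h *s e)" by (rule frechet_derivative_at[symmetric])
  moreover have "range (\<lambda>h. D h *s e) = (\<lambda>z. z *s e) ` range D" by auto
  then have "range (\<lambda>h. D h *s e) = range (\<lambda>z. z *s e)" by (simp only: D(2))
  moreover have "range (\<lambda>z. z *s e) = vec.span {e}" by (simp add: vec.span_singleton)
  ultimately show ?thesis using e by simp
qed

lemma dim_range_quotient:
  fixes f g :: "complex \<times> complex \<Rightarrow> complex" and e :: "complex^3"
  assumes V: "open V" "p \<in> V" and e: "e \<noteq> 0" and fp: "f p \<noteq> 0"
    and G: "\<And>q. q \<in> V \<Longrightarrow> f q \<noteq> 0 \<Longrightarrow> G q = c + (g q / f q) *s e"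
    and D: "(f has_derivative D1) (at p)" "(g has_derivative D2) (at p)"
    and surj: "\<And>x. \<exists>h. D1 h = 0 \<and> D2 h = x"
  shows "vec.dim (range (frechet_derivative G (at p))) = 1"
proof -
  have "isCont f p" using D(1) has_derivative_continuous by blast
  then have "\<forall>\<^sub>F q in nhds p. f q \<noteq> 0"
    using fp by (metis isCont_def tendsto_at_iff_tendsto_nhds tendsto_imp_eventually_ne)
  then obtain U where U: "open U" "p \<in> U" "\<And>q. q \<in> U \<Longrightarrow> f q \<noteq> 0" unfolding eventually_nhds by blast
  show ?thesis
  proof (rule dim_range_rank_one[where U = "U \<inter> V", OF _ _ G e])
    show "((\<lambda>q. g q / f q) has_derivative (\<lambda>h. - (g p) * (inverse (f p) * D1 h * inverse (f p)) + D2 h / f p)) (at p)"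
      using D fp by (intro has_derivative_divide) auto
    \<comment> \<open>Along a direction h with D1 h = 0 the quotient rule collapses to D2 h / f p;
      the choice D2 h = x * f p then reaches x.\<close>
    show "surj (\<lambda>h. - (g p) * (inverse (f p) * D1 h * inverse (f p)) + D2 h / f p)"
    proof (rule surjI)
      fix x
      show "- (g p) * (inverse (f p) * D1 (SOME h. D1 h = 0 \<and> D2 h = x * f p) * inverse (f p)) +
        D2 (SOME h. D1 h = 0 \<and> D2 h = x * f p) / f p = x"
        using someI_ex[OF surj[of "x * f p"]] fp by simp
    qed
  qed (use U V in auto)
qed

text \<open>In chart 2 or 3 the map is given by a quotient of two functions with independent
  differentials. The rank is thus one at every point, and the point p0 ensures that the set under
  the maximum is exactly {1}.\<close>

lemma generic_rank_line_at_infinity: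
  assumes V: "open V" "p0 \<in> V" and h: "\<And>p. p \<in> V \<Longrightarrow> h p = abs_cp2 (vector [0, f p, g p])"
    and nz: "\<And>p. p \<in> V \<Longrightarrow> f p \<noteq> 0 \<or> g p \<noteq> 0"
    and D: "\<And>p. p \<in> V \<Longrightarrow> \<exists>D1 D2. (f has_derivative D1) (at p) \<and> (g has_derivative D2) (at p) \<and>
      (\<forall>x y. \<exists>h. D1 h = x \<and> D2 h = y)"
  shows "generic_rank V h = 1"
proof -
  have ic: "in_chart i (h p) \<longleftrightarrow> (i = 2 \<and> f p \<noteq> 0) \<or> (i = 3 \<and> g p \<noteq> 0)" if "p \<in> V" for i p
  proof -
    have "vector [0, f p, g p] \<noteq> (0 :: complex^3)" using nz[OF that] by (simp add: vector_eq_0_iff)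
    then show ?thesis using exhaust_3[of i] by (auto simp: h[OF that] in_chart_abs)
  qed
  have "vec.dim (range (frechet_derivative (\<lambda>q. affine_coords i (h q)) (at p))) = 1"
    if p: "p \<in> V" and i: "in_chart i (h p)" for i p
  proof -
    obtain D1 D2 where D12: "(f has_derivative D1) (at p)" "(g has_derivative D2) (at p)"
      "\<And>x y. \<exists>h. D1 h = x \<and> D2 h = y" using D[OF p] by blast
    from i ic[OF p] consider "i = 2" "f p \<noteq> 0" | "i = 3" "g p \<noteq> 0" by blast
    then show ?thesis
    proof cases
      case 1
      show ?thesis
      proof (rule dim_range_quotient[OF V(1) p _ 1(2) _ D12(1,2)])
        show "affine_coords i (h q) = vector [0, 1, 0] + (g q / f q) *s vector [0, 0, 1]" if "q \<in> V" "f q \<noteq> 0" for q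
          using that by (simp add: 1 h affine_coords_abs vector_eq_0_iff vec_eq_iff forall_3)
      qed (use D12(3) in \<open>auto simp: vector_eq_0_iff\<close>)
    next
      case 2
      have "\<exists>h. D2 h = 0 \<and> D1 h = x" for x using D12(3)[of x 0] by blast
      then show ?thesis
      proof (rule dim_range_quotient[OF V(1) p _ 2(2) _ D12(2,1), rotated 2])
        show "affine_coords i (h q) = vector [0, 0, 1] + (f q / g q) *s vector [0, 1, 0]" if "q \<in> V" "g q \<noteq> 0" for q
          using that by (simp add: 2 h affine_coords_abs vector_eq_0_iff vec_eq_iff forall_3)
      qed (simp add: vector_eq_0_iff)
    qed
  qed
  note dim = this
  obtain i where i: "in_chart i (h p0)" using ic[OF V(2)] nz[OF V(2)] by blast
  have "{vec.dim (range (frechet_derivative (\<lambda>q. affine_coords i (h q)) (at p))) | i p.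
            p \<in> V \<and> in_chart i (h p)} = {1}" (is "?S = _")
  proof
    show "?S \<subseteq> {1}" using dim by blast
    have "1 = vec.dim (range (frechet_derivative (\<lambda>q. affine_coords i (h q)) (at p0)))"
      using dim[OF V(2) i] by (rule sym)
    then show "{1} \<subseteq> ?S" using V(2) i by blast
  qed
  then show ?thesis unfolding generic_rank_def by simp
qed

text \<open>Restricting the filter to a predicate that holds frequently takes the place of passing
  to a subsequence.\<close>

lemma frequently_tendsto_unique:
  fixes l :: "'b::t2_space"
  assumes "(f \<longlongrightarrow> l) F" "\<exists>\<^sub>F x in F. P x" "(g \<longlongrightarrow> l') (inf F (principal {x. P x}))"
    and "\<And>x. P x \<Longrightarrow> f x = g x"
  shows "l = l'"
proof (rule tendsto_unique)
  show "inf F (principal {x. P x}) \<noteq> bot"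
    using assms(2) by (auto simp: trivial_limit_def eventually_inf_principal frequently_def)
  show "(f \<longlongrightarrow> l) (inf F (principal {x. P x}))"
    using assms(1) by (rule filterlim_mono) auto
  show "(f \<longlongrightarrow> l') (inf F (principal {x. P x}))"
    by (rule Lim_transform_eventually[OF assms(3)])
      (use assms(4) in \<open>auto simp: eventually_inf_principal\<close>)
qed

lemma holomorphic_into_cp2_cong:
  assumes "\<And>p. p \<in> U \<Longrightarrow> h p = h' p"
  shows "holomorphic_into_cp2 U h \<longleftrightarrow> holomorphic_into_cp2 U h'"
proof -
  have *: "holomorphic_into_cp2 U h'" if hol: "holomorphic_into_cp2 U h" and eq: "\<And>p. p \<in> U \<Longrightarrow> h p = h' p" for h h'
  proof -
    have o: "open U" and c: "continuous_on U h"
      and a: "\<And>i j. (\<lambda>p. affine_coords i (h p) $ j) holomorphic2_on {p \<in> U. in_chart i (h p)}"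
      using hol unfolding holomorphic_into_cp2_def by auto
    have c': "continuous_on U h'" by (rule continuous_on_eq[OF c eq])
    have "(\<lambda>p. affine_coords i (h' p) $ j) holomorphic2_on {p \<in> U. in_chart i (h' p)}" for i j
    proof -
      have s: "{p \<in> U. in_chart i (h' p)} = {p \<in> U. in_chart i (h p)}" using eq by auto
      have "{p \<in> U. in_chart i (h p)} = U \<inter> h -` {x. in_chart i x}" by auto
      then have "open {p \<in> U. in_chart i (h p)}"
        using continuous_open_preimage[OF c o open_in_chart] by simp
      then show ?thesis
        unfolding s by (rule holomorphic2_on_transform[OF a]) (simp add: eq)
    qed
    then show ?thesis unfolding holomorphic_into_cp2_def using o c' by blast
  qed
  show ?thesis
  proof
    show "holomorphic_into_cp2 U h'" if "holomorphic_into_cp2 U h" using that assms by (rule *)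
    show "holomorphic_into_cp2 U h" if "holomorphic_into_cp2 U h'"
      using that by (rule *) (simp add: assms)
  qed
qed

lemma uniform_limit_on_compacts_cong:
  assumes "\<And>p. p \<in> U \<Longrightarrow> h p = h' p"
  shows "uniform_limit_on_compacts U f h \<longleftrightarrow> uniform_limit_on_compacts U f h'"
proof -
  have "uniform_limit K g h F \<longleftrightarrow> uniform_limit K g h' F" if "K \<subseteq> U" for K F and g :: "nat \<Rightarrow> _"
    by (rule uniform_limit_cong') (use assms that in auto)
  then show ?thesis unfolding uniform_limit_on_compacts_def by auto
qed

context transcendental_henon
begin

section \<open>Limit functions\<close>

definition H :: "complex \<times> complex \<Rightarrow> cp2" where
  "H p = abs_cp2 (vector [0, fst (\<phi> p), snd (\<phi> p)])"

lemma \<phi>_nonzero: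
  assumes "p \<in> \<Omega>"
  shows "fst (\<phi> p) \<noteq> 0" "snd (\<phi> p) \<noteq> 0"
proof -
  obtain j k where "p \<in> A j k" using assms by (auto simp: \<Omega>_def)
  then have "dep j (fst (\<phi> p)) > 0" "dep k (snd (\<phi> p)) > 0" using \<phi>_in_W0 by (auto simp: W_def)
  then show "fst (\<phi> p) \<noteq> 0" "snd (\<phi> p) \<noteq> 0"
    using dep_le_norm[of j "fst (\<phi> p)"] dep_le_norm[of k "snd (\<phi> p)"] by auto
qed

lemma H_F: "p \<in> \<Omega> \<Longrightarrow> H (F p) = abs_cp2 (vector [0, a * snd (\<phi> p), fst (\<phi> p)])"
  by (simp add: H_def \<phi>_F linear_part_def split_beta)

lemma H_in_line_at_infinity: "p \<in> \<Omega> \<Longrightarrow> H p \<in> line_at_infinity"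
  unfolding H_def by (rule abs_cp2_in_line_at_infinity) (use \<phi>_nonzero in blast)

text \<open>Homogeneous coordinates may be divided by a^n. Afterwards all three converge: the first
  to 0 and the others to the components of \<phi>.\<close>

lemma embed_even_iterate:
  "embed_cp2 ((F ^^ (2 * n)) p) = abs_cp2 (vector [inverse (a ^ n), \<eta>N n (F p), \<eta>N n p])"
proof -
  have e: "embed_cp2 ((F ^^ (2 * n)) p) = abs_cp2 (vector [1, orb p (Suc (2 * n)), orb p (2 * n)])"
    by (simp add: embed_cp2_def funpow_F)
  show ?thesis
    unfolding e by (rule abs_cp2_eqI[where c = "inverse (a ^ n)"])
      (auto simp: vector_eq_0_iff vec_eq_iff forall_3 \<eta>N_def orb_F field_simps)
qed

lemma uniform_limit_even:
  assumes "compact K" "K \<subseteq> \<Omega>"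
  shows "uniform_limit K (\<lambda>n p. embed_cp2 ((F ^^ (2 * n)) p)) H sequentially"
proof -
  have FK: "compact (F ` K)" "F ` K \<subseteq> \<Omega>"
    using assms F_in_\<Omega> compact_continuous_image[OF continuous_on_funpow_F[of K 1]] by auto
  have "uniform_limit K (\<lambda>n p. inverse (a ^ n)) (\<lambda>p. 0) sequentially"
  proof (rule uniform_limitI)
    fix e :: real assume "e > 0"
    have "\<forall>\<^sub>F n in sequentially. (1 / \<delta>) ^ n < e"
      using \<delta>_power_tendsto_0 \<open>e > 0\<close> by (rule order_tendstoD(2))
    then show "\<forall>\<^sub>F n in sequentially. \<forall>x\<in>K. dist (inverse (a ^ n)) 0 < e"
      by eventually_elim (simp add: norm_inverse norm_power power_one_over inverse_eq_divide norm_divide)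
  qed
  moreover have "uniform_limit K (\<lambda>n p. \<eta>N n (F p)) (\<lambda>p. \<eta> (F p)) sequentially"
    using uniform_limit_\<eta>N[OF FK] by (simp add: uniform_limit_iff)
  moreover have "uniform_limit K \<eta>N \<eta> sequentially" by (rule uniform_limit_\<eta>N[OF assms])
  moreover have "continuous_on K \<eta>" "continuous_on K (\<lambda>p. \<eta> (F p))"
    using continuous_on_subset[OF holomorphic2_on_imp_continuous_on[OF holomorphic2_\<eta>] assms(2)]
      continuous_on_subset[OF holomorphic2_on_imp_continuous_on[OF holomorphic2_\<eta>_F] assms(2)] by auto
  moreover have "vector [0, \<eta> (F p), \<eta> p] \<noteq> (0 :: complex^3)" if "p \<in> K" for p
    using \<phi>_nonzero[of p] that assms by (auto simp: vector_eq_0_iff \<phi>_def)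
  ultimately have "uniform_limit K (\<lambda>n p. abs_cp2 (vector [inverse (a ^ n), \<eta>N n (F p), \<eta>N n p]))
      (\<lambda>p. abs_cp2 (vector [0, \<eta> (F p), \<eta> p])) sequentially"
    by (intro uniform_limit_abs_cp2 assms(1)) auto
  then show ?thesis by (simp add: embed_even_iterate H_def[abs_def] \<phi>_def)
qed

lemma uniform_limit_odd:
  assumes "compact K" "K \<subseteq> \<Omega>"
  shows "uniform_limit K (\<lambda>n p. embed_cp2 ((F ^^ (2 * n + 1)) p)) (\<lambda>p. H (F p)) sequentially"
proof -
  have FK: "compact (F ` K)" "F ` K \<subseteq> \<Omega>"
    using assms F_in_\<Omega> compact_continuous_image[OF continuous_on_funpow_F[of K 1]] by auto
  have "uniform_limit K (\<lambda>n p. embed_cp2 ((F ^^ (2 * n)) (F p))) (\<lambda>p. H (F p)) sequentially"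
    using uniform_limit_even[OF FK] by (simp add: uniform_limit_iff)
  then show ?thesis by (simp add: funpow_swap1)
qed

lemma tendsto_even: "p \<in> \<Omega> \<Longrightarrow> (\<lambda>n. embed_cp2 ((F ^^ (2 * n)) p)) \<longlonglongrightarrow> H p"
  using tendsto_uniform_limitI[OF uniform_limit_even, of "{p}" p] by simp

lemma tendsto_odd: "p \<in> \<Omega> \<Longrightarrow> (\<lambda>n. embed_cp2 ((F ^^ (2 * n + 1)) p)) \<longlonglongrightarrow> H (F p)"
  using tendsto_uniform_limitI[OF uniform_limit_odd, of "{p}" p] by simp

lemma holomorphic_into_cp2_H:
  assumes "open V" "V \<subseteq> \<Omega>"
  shows "holomorphic_into_cp2 V H" "holomorphic_into_cp2 V (\<lambda>p. H (F p))"
proof -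
  have f: "(\<lambda>p. fst (\<phi> p)) holomorphic2_on V" "(\<lambda>p. snd (\<phi> p)) holomorphic2_on V"
    using holomorphic2_\<phi> assms(2) holomorphic2_on_subset by blast+
  show "holomorphic_into_cp2 V H"
    by (rule holomorphic_into_cp2_abs[OF assms(1) holomorphic2_on_const[of 0] f])
      (use \<phi>_nonzero assms in \<open>auto simp: H_def vector_eq_0_iff\<close>)
  show "holomorphic_into_cp2 V (\<lambda>p. H (F p))"
    by (rule holomorphic_into_cp2_abs[OF assms(1) holomorphic2_on_const[of 0] holomorphic2_on_mult[OF holomorphic2_on_const[of a] f(2)] f(1)])
      (use \<phi>_nonzero assms H_F in \<open>auto simp: vector_eq_0_iff\<close>)
qed

lemma holomorphic_into_cp2_embed_iterate:
  assumes "open V"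
  shows "holomorphic_into_cp2 V (\<lambda>p. embed_cp2 ((F ^^ n) p))"
  by (rule holomorphic_into_cp2_abs[OF assms holomorphic2_on_const[of 1] holomorphic2_orb[of "Suc n"] holomorphic2_orb[of n]])
    (auto simp: vector_eq_0_iff embed_cp2_def funpow_F)

text \<open>If the exponents are even infinitely often, the limit is identified along those;
  otherwise they are eventually odd. Halving the exponents turns either case into the convergence
  along even or odd times.\<close>

lemma limit_functions_subset:
  assumes V: "V \<subseteq> \<Omega>" and h: "h \<in> limit_functions F V"
  shows "h = restrict H V \<or> h = restrict (\<lambda>p. H (F p)) V"
proof -
  obtain n where n: "filterlim n at_top sequentially" "uniform_limit_on_compacts V (\<lambda>j. F ^^ n j) h"
    and ext: "h \<in> extensional V" using h by (auto simp: limit_functions_def)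
  have lim: "(\<lambda>j. embed_cp2 ((F ^^ n j) p)) \<longlonglongrightarrow> h p" if "p \<in> V" for p
  proof -
    have "compact {p} \<and> {p} \<subseteq> V \<longrightarrow> uniform_limit {p} (\<lambda>j p. embed_cp2 ((F ^^ n j) p)) h sequentially"
      using n(2) unfolding uniform_limit_on_compacts_def by (rule spec)
    then show ?thesis using that by simp
  qed
  have half: "filterlim (\<lambda>j. n j div 2) at_top (inf sequentially (principal X))" for X
  proof -
    have "filterlim (\<lambda>j. n j div 2) at_top sequentially"
      unfolding filterlim_at_top
    proof
      fix Z :: nat
      have "\<forall>\<^sub>F j in sequentially. n j \<ge> 2 * Z" using n(1) by (simp add: filterlim_at_top)
      then show "\<forall>\<^sub>F j in sequentially. Z \<le> n j div 2" by eventually_elim simp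
    qed
    then show ?thesis by (rule filterlim_mono) auto
  qed
  show ?thesis
  proof (cases "\<exists>\<^sub>F j in sequentially. even (n j)")
    case True
    have "h p = H p" if "p \<in> V" for p
    proof (rule frequently_tendsto_unique[OF lim[OF that] True])
      show "((\<lambda>j. embed_cp2 ((F ^^ (2 * (n j div 2))) p)) \<longlongrightarrow> H p) (inf sequentially (principal {j. even (n j)}))"
        using filterlim_compose[OF tendsto_even half] that V by blast
    qed simp
    then show ?thesis using ext by (auto simp: restrict_def extensional_def fun_eq_iff)
  next
    case False
    then have "\<forall>\<^sub>F j in sequentially. odd (n j)" by (simp add: not_frequently)
    then have odd: "\<exists>\<^sub>F j in sequentially. odd (n j)" by (rule eventually_frequently[rotated]) simp
    have "h p = H (F p)" if "p \<in> V" for p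
    proof (rule frequently_tendsto_unique[OF lim[OF that] odd])
      show "((\<lambda>j. embed_cp2 ((F ^^ (2 * (n j div 2) + 1)) p)) \<longlongrightarrow> H (F p)) (inf sequentially (principal {j. odd (n j)}))"
        using filterlim_compose[OF tendsto_odd half] that V by blast
    qed simp
    then show ?thesis using ext by (auto simp: restrict_def extensional_def fun_eq_iff)
  qed
qed

lemma limit_functions_eq:
  assumes V: "open V" "V \<subseteq> \<Omega>"
  shows "limit_functions F V = {restrict H V, restrict (\<lambda>p. H (F p)) V}"
proof
  show "limit_functions F V \<subseteq> {restrict H V, restrict (\<lambda>p. H (F p)) V}"
    using limit_functions_subset[OF V(2)] by blast
  have "restrict H V \<in> limit_functions F V"
    unfolding limit_functions_def
  proof (intro CollectI conjI exI)
    show "holomorphic_into_cp2 V (restrict H V)"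
      using holomorphic_into_cp2_H(1)[OF V] holomorphic_into_cp2_cong[of V H "restrict H V"] by simp
    show "filterlim (\<lambda>j::nat. 2 * j) at_top sequentially"
      by (rule filterlim_subseq) (simp add: strict_mono_def)
    have "uniform_limit_on_compacts V (\<lambda>j. F ^^ (2 * j)) H"
      using uniform_limit_even V by (auto simp: uniform_limit_on_compacts_def)
    then show "uniform_limit_on_compacts V (\<lambda>j. F ^^ (2 * j)) (restrict H V)"
      using uniform_limit_on_compacts_cong[of V H "restrict H V"] by simp
  qed simp
  moreover have "restrict (\<lambda>p. H (F p)) V \<in> limit_functions F V"
    unfolding limit_functions_def
  proof (intro CollectI conjI exI)
    show "holomorphic_into_cp2 V (restrict (\<lambda>p. H (F p)) V)"
      using holomorphic_into_cp2_H(2)[OF V] holomorphic_into_cp2_cong[of V "\<lambda>p. H (F p)" "restrict (\<lambda>p. H (F p)) V"] by simp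
    show "filterlim (\<lambda>j::nat. 2 * j + 1) at_top sequentially"
      by (rule filterlim_subseq) (simp add: strict_mono_def)
    have "uniform_limit_on_compacts V (\<lambda>j. F ^^ (2 * j + 1)) (\<lambda>p. H (F p))"
      unfolding uniform_limit_on_compacts_def using uniform_limit_odd V by blast
    then show "uniform_limit_on_compacts V (\<lambda>j. F ^^ (2 * j + 1)) (restrict (\<lambda>p. H (F p)) V)"
      using uniform_limit_on_compacts_cong[of V "\<lambda>p. H (F p)" "restrict (\<lambda>p. H (F p)) V"] by simp
  qed simp
  ultimately show "{restrict H V, restrict (\<lambda>p. H (F p)) V} \<subseteq> limit_functions F V" by blast
qed

text \<open>A sequence taken from the family may repeat one iterate infinitely often, and then has a
  constant subsequence. Otherwise its exponents tend to infinity, and one of the two parities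
  supplies the subsequence.\<close>

lemma normal_family_\<Omega>: "normal_family \<Omega> (range (\<lambda>n. F ^^ n))"
  unfolding normal_family_def
proof (intro allI impI)
  fix f :: "nat \<Rightarrow> self_map" assume "range f \<subseteq> range (\<lambda>n. F ^^ n)"
  then have "\<forall>i. \<exists>n. f i = F ^^ n" by blast
  then obtain N where N: "\<And>i. f i = F ^^ N i" by metis
  show "\<exists>r h. strict_mono r \<and> holomorphic_into_cp2 \<Omega> h \<and> uniform_limit_on_compacts \<Omega> (f \<circ> r) h"
  proof (cases "\<exists>n. infinite {i. N i = n}")
    case True
    then obtain n where "infinite {i. N i = n}" by blast
    then obtain r :: "nat \<Rightarrow> nat" where r: "strict_mono r" "\<And>k. N (r k) = n"
        using infinite_enumerate by blast
    have "uniform_limit_on_compacts \<Omega> (f \<circ> r) (\<lambda>p. embed_cp2 ((F ^^ n) p))"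
      unfolding uniform_limit_on_compacts_def comp_def N r(2) by (simp add: uniform_limit_const)
    then show ?thesis using r(1) holomorphic_into_cp2_embed_iterate[OF open_\<Omega>] by blast
  next
    case False
    then have fin: "finite {i. N i = n}" for n by blast
    have lim: "filterlim N at_top sequentially"
      unfolding filterlim_at_top
    proof
      fix Z
      have "{i. \<not> Z \<le> N i} = (\<Union>n<Z. {i. N i = n})" by auto
      then have "finite {i. \<not> Z \<le> N i}" using fin by simp
      then show "\<forall>\<^sub>F i in sequentially. Z \<le> N i"
        by (simp add: eventually_cofinite flip: cofinite_eq_sequentially)
    qed
    have half: "filterlim (\<lambda>k. N (r k) div 2) at_top sequentially" if "strict_mono r" for r
      unfolding filterlim_at_top
    proof
      fix Z :: nat
      have "filterlim (\<lambda>k. N (r k)) at_top sequentially"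
        by (rule filterlim_compose[OF lim filterlim_subseq[OF that]])
      then have "\<forall>\<^sub>F k in sequentially. N (r k) \<ge> 2 * Z" by (simp add: filterlim_at_top)
      then show "\<forall>\<^sub>F k in sequentially. Z \<le> N (r k) div 2" by eventually_elim simp
    qed
    have "infinite {i. even (N i)} \<or> infinite {i. odd (N i)}"
    proof (rule ccontr)
      assume "\<not> ?thesis"
      then have "finite ({i. even (N i)} \<union> {i. odd (N i)})" by simp
      moreover have "{i. even (N i)} \<union> {i. odd (N i)} = UNIV" by auto
      ultimately show False by simp
    qed
    then show ?thesis
    proof
      assume "infinite {i. even (N i)}"
      then obtain r :: "nat \<Rightarrow> nat" where r: "strict_mono r" "\<And>k. even (N (r k))"
        using infinite_enumerate by blast
      have fr: "f (r k) = F ^^ (2 * (N (r k) div 2))" for k using r(2)[of k] N by simp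
      have "uniform_limit_on_compacts \<Omega> (f \<circ> r) H"
        unfolding uniform_limit_on_compacts_def comp_def fr
        using filterlim_compose[OF uniform_limit_even half[OF r(1)]] by blast
      then show ?thesis using r(1) holomorphic_into_cp2_H(1)[OF open_\<Omega> order_refl] by blast
    next
      assume "infinite {i. odd (N i)}"
      then obtain r :: "nat \<Rightarrow> nat" where r: "strict_mono r" "\<And>k. odd (N (r k))"
        using infinite_enumerate by blast
      have fr: "f (r k) = F ^^ (2 * (N (r k) div 2) + 1)" for k using r(2)[of k] N by simp
      have "uniform_limit_on_compacts \<Omega> (f \<circ> r) (\<lambda>p. H (F p))"
        unfolding uniform_limit_on_compacts_def comp_def fr
        using filterlim_compose[OF uniform_limit_odd half[OF r(1)]] by blast
      then show ?thesis using r(1) holomorphic_into_cp2_H(2)[OF open_\<Omega> order_refl] by blast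
    qed
  qed
qed

lemma \<Omega>_subset_Fatou_set: "\<Omega> \<subseteq> Fatou_set F"
  unfolding Fatou_set_def using normal_family_\<Omega> open_\<Omega> by blast

lemma generic_rank_H:
  assumes V: "open V" "V \<subseteq> \<Omega>" "V \<noteq> {}"
  shows "generic_rank V (restrict H V) = 1" "generic_rank V (restrict (\<lambda>p. H (F p)) V) = 1"
proof -
  obtain p0 where p0: "p0 \<in> V" using V(3) by blast
  have D: "\<exists>D1 D2. ((\<lambda>p. fst (\<phi> p)) has_derivative D1) (at p) \<and> ((\<lambda>p. snd (\<phi> p)) has_derivative D2) (at p) \<and>
      (\<forall>x y. \<exists>h. D1 h = x \<and> D2 h = y)" if "p \<in> V" for p
  proof -
    have p: "p \<in> \<Omega>" using that V by blast
    obtain D1 D2 where "((\<lambda>p. fst (\<phi> p)) has_derivative D1) (at p)" "((\<lambda>p. snd (\<phi> p)) has_derivative D2) (at p)"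
      using holomorphic2_\<phi> p unfolding holomorphic2_on_def by blast
    moreover from \<phi>_derivative_surj[OF p this] have "\<forall>x y. \<exists>h. D1 h = x \<and> D2 h = y" by metis
    ultimately show ?thesis by blast
  qed
  show "generic_rank V (restrict H V) = 1"
    by (rule generic_rank_line_at_infinity[OF V(1) p0 _ _ D]) (use \<phi>_nonzero V in \<open>auto simp: H_def\<close>)
  show "generic_rank V (restrict (\<lambda>p. H (F p)) V) = 1"
  proof (rule generic_rank_line_at_infinity[OF V(1) p0])
    show "\<exists>D1 D2. ((\<lambda>p. a * snd (\<phi> p)) has_derivative D1) (at p) \<and> ((\<lambda>p. fst (\<phi> p)) has_derivative D2) (at p) \<and>
      (\<forall>x y. \<exists>h. D1 h = x \<and> D2 h = y)" if p: "p \<in> V" for p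
    proof -
      obtain D1 D2 where D12: "((\<lambda>p. fst (\<phi> p)) has_derivative D1) (at p)" "((\<lambda>p. snd (\<phi> p)) has_derivative D2) (at p)"
        "\<And>x y. \<exists>h. D1 h = x \<and> D2 h = y" using D[OF p] by blast
      have "((\<lambda>p. a * snd (\<phi> p)) has_derivative (\<lambda>h. a * D2 h)) (at p)"
        using has_derivative_mult_right[OF D12(2)] .
      moreover have "\<exists>h. a * D2 h = x \<and> D1 h = y" for x y
      proof -
        obtain h where "D1 h = y" "D2 h = x / a" using D12(3) by blast
        then show ?thesis by (intro exI[of _ h]) simp
      qed
      ultimately show ?thesis using D12(1) by blast
    qed
  qed (use \<phi>_nonzero H_F V in auto)
qed

section \<open>The limit sets as sectors of slopes on the line at infinity\<close>

definition Sig :: "int \<Rightarrow> cp2 set" where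
  "Sig d = {abs_cp2 (vector [0, g, 1]) | g. depth (2 * \<gamma>) (g * \<omega> (- d)) > 0}"

lemma Sig_cong: "int m dvd d - d' \<Longrightarrow> Sig d = Sig d'"
proof -
  assume "int m dvd d - d'"
  then have "int m dvd - d - (- d')" by (metis dvd_diff_commute minus_diff_minus dvd_minus_iff)
  then show ?thesis unfolding Sig_def by (simp only: \<omega>_cong[of "- d" "- d'"])
qed

lemma two_\<gamma>_bounds: "0 < 2 * \<gamma>" "2 * \<gamma> \<le> pi / 2" using \<gamma>_bounds by auto

lemma Sig_disjoint:
  assumes "\<not> int m dvd d - d'"
  shows "Sig d \<inter> Sig d' = {}"
proof (rule ccontr)
  assume "Sig d \<inter> Sig d' \<noteq> {}"
  then obtain g g' where g: "depth (2 * \<gamma>) (g * \<omega> (- d)) > 0" "depth (2 * \<gamma>) (g' * \<omega> (- d')) > 0"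
    "abs_cp2 (vector [0, g, 1]) = abs_cp2 (vector [0, g', 1])" by (auto simp: Sig_def)
  have "(vector [0, g, 1] :: complex^3) \<noteq> 0" "(vector [0, g', 1] :: complex^3) \<noteq> 0" by (auto simp: vector_eq_0_iff)
  then have "g = g'" using g(3) by (auto simp: abs_cp2_eq_iff vec_eq_iff forall_3)
  then show False using sector_unique[OF two_\<gamma>_bounds(1) order_refl, of g d d'] g assms by simp
qed

lemma Arg_divide_sector:
  assumes "depth \<gamma> u > 0" "depth \<gamma> v > 0"
  shows "depth (2 * \<gamma>) (u / v) > 0"
proof -
  have uv: "u \<noteq> 0" "\<bar>Arg u\<bar> < \<gamma>" "v \<noteq> 0" "\<bar>Arg v\<bar> < \<gamma>"
    using assms depth_pos_iff[OF \<gamma>_bounds(1,3)] by auto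
  have "u / v = rcis (cmod u) (Arg u) / rcis (cmod v) (Arg v)" by (simp add: rcis_cmod_Arg)
  also have "\<dots> = rcis (cmod u / cmod v) (Arg u - Arg v)" by (rule rcis_divide)
  finally have eq: "u / v = rcis (cmod u / cmod v) (Arg u - Arg v)" .
  have "Arg (u / v) = Arg u - Arg v"
    unfolding eq using uv \<gamma>_bounds pi_gt_zero by (intro Arg_rcis) (auto simp del: pi_gt_zero)
  then show ?thesis using uv by (simp add: depth_pos_iff[OF two_\<gamma>_bounds])
qed

text \<open>The limit point has slope \<phi>_1/\<phi>_2. Quotients of a point of sector j by a point
  of sector k fill the sector around \<open>\<omega> (j - k)\<close> with doubled opening, and
  \<phi> takes every value in the product of the two sectors.\<close>

lemma H_image_A: "H ` A j k = Sig (j - k)"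
proof
  show "H ` A j k \<subseteq> Sig (j - k)"
  proof
    fix x assume "x \<in> H ` A j k"
    then obtain p where p: "p \<in> A j k" "x = H p" by blast
    define u where "u = fst (\<phi> p)"
    define v where "v = snd (\<phi> p)"
    have uv: "depth \<gamma> (u * \<omega> (- j)) > 0" "depth \<gamma> (v * \<omega> (- k)) > 0"
      using \<phi>_in_W0[OF p(1)] by (auto simp: W_def dep_def u_def v_def)
    have "p \<in> \<Omega>" using p(1) A_subset_\<Omega> by blast
    then have "v \<noteq> 0" using \<phi>_nonzero(2) by (simp add: v_def)
    then have "x = abs_cp2 (vector [0, u / v, 1])"
      unfolding p(2) H_def u_def[symmetric] v_def[symmetric]
      by (intro abs_cp2_eqI[where c = "1 / v"]) (auto simp: vector_eq_0_iff vec_eq_iff forall_3)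
    moreover have "(u * \<omega> (- j)) / (v * \<omega> (- k)) = u / v * \<omega> (- (j - k))"
    proof -
      have "\<omega> (- (j - k)) = \<omega> (- j) * \<omega> k" by (simp flip: \<omega>_add)
      moreover have "\<omega> k = 1 / \<omega> (- k)" by (simp add: field_simps)
      ultimately show ?thesis by simp
    qed
    then have "depth (2 * \<gamma>) (u / v * \<omega> (- (j - k))) > 0" using Arg_divide_sector[OF uv] by simp
    ultimately show "x \<in> Sig (j - k)" unfolding Sig_def by blast
  qed
  show "Sig (j - k) \<subseteq> H ` A j k"
  proof
    fix x assume "x \<in> Sig (j - k)"
    then obtain g where g: "depth (2 * \<gamma>) (g * \<omega> (- (j - k))) > 0" "x = abs_cp2 (vector [0, g, 1])" by (auto simp: Sig_def)
    define z where "z = g * \<omega> (- (j - k))"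
    have z: "z \<noteq> 0" "\<bar>Arg z\<bar> < 2 * \<gamma>" using g(1) depth_pos_iff[OF two_\<gamma>_bounds, of z] by (auto simp: z_def)
    \<comment> \<open>Halving the logarithm splits the argument evenly: exp l and exp (-l) have
      quotient z and arguments of modulus below \<gamma>.\<close>
    define l where "l = Ln z / 2"
    have l: "\<bar>Im l\<bar> < \<gamma>" using z by (simp add: l_def Arg_eq_Im_Ln)
    have "Arg (exp l) = Im l" by (rule Arg_exp) (use l \<gamma>_bounds in auto)
    moreover have "Arg (exp (- l)) = Im (- l)" by (rule Arg_exp) (use l \<gamma>_bounds in auto)
    ultimately have d: "depth \<gamma> (exp l) > 0" "depth \<gamma> (exp (- l)) > 0"
      using l by (simp_all add: depth_pos_iff[OF \<gamma>_bounds(1,3)])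
    have "exp l * exp l = z" using z by (simp add: l_def flip: exp_add)
    define q where "q = (exp l * \<omega> j, exp (- l) * \<omega> k)"
    have q: "q \<in> W 0 j k" using d by (simp add: q_def W0_iff mult.assoc)
    define p where "p = \<psi> q"
    have p: "p \<in> A j k" "\<phi> p = q" using q by (simp_all add: p_def \<psi>_in_A \<phi>_\<psi>)
    have "g = z * \<omega> (j - k)"
      using \<omega>_mult_minus(2)[of "j - k"] by (simp add: z_def mult.assoc)
    also have "\<dots> = (exp l * \<omega> j) / (exp (- l) * \<omega> k)"
    proof -
      have "\<omega> (j - k) * \<omega> k = \<omega> j" by (simp flip: \<omega>_add)
      then have "\<omega> (j - k) = \<omega> j / \<omega> k" by (simp add: field_simps)
      then show ?thesis using \<open>exp l * exp l = z\<close> by (simp add: exp_minus field_simps)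
    qed
    finally have "H p = abs_cp2 (vector [0, g, 1])"
      unfolding H_def p(2)
      by (intro abs_cp2_eqI[where c = "1 / (exp (- l) * \<omega> k)"]) (auto simp: q_def vector_eq_0_iff vec_eq_iff forall_3)
    then show "x \<in> H ` A j k" using p(1) g(2) by (intro image_eqI[of _ _ p]) simp_all
  qed
qed

lemma H_F_image_A: "(\<lambda>p. H (F p)) ` A j k = Sig (k + 1 - j)"
  using H_image_A[of "k + 1" j] unfolding F_image_A[of j k, symmetric] image_image .

text \<open>The covering is a homeomorphism: the Cayley transform from the disc to the right half
  plane, followed by the power map onto the sector of slopes.\<close>

lemma hyperbolic_Sig: "hyperbolic_at_infinity (Sig d)"
proof -
  note sm = sector_maps[OF two_\<gamma>_bounds]
  have v0: "vector [0, g, 1] \<noteq> (0 :: complex^3)" for g by (simp add: vector_eq_0_iff)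
  define S where "S = {x. in_chart 3 x \<and> depth (2 * \<gamma>) (affine_coords 3 x $ 2 * \<omega> (- d)) > 0}"
  have cS: "continuous_on {x. in_chart 3 x} (\<lambda>x. affine_coords 3 x $ 2 * \<omega> (- d))"
    by (intro continuous_intros continuous_on_affine_coords)
  have "S = {x. in_chart 3 x} \<inter> (\<lambda>x. affine_coords 3 x $ 2 * \<omega> (- d)) -` {z. depth (2 * \<gamma>) z > 0}"
    by (auto simp: S_def)
  then have "open S" using continuous_open_preimage[OF cS open_in_chart open_depth] by simp
  moreover have "Sig d = line_at_infinity \<inter> S"
  proof
    show "Sig d \<subseteq> line_at_infinity \<inter> S"
      using v0 by (auto simp: Sig_def S_def in_chart_abs affine_coords_abs abs_cp2_in_line_at_infinity)
    show "line_at_infinity \<inter> S \<subseteq> Sig d"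
    proof
      fix x assume x: "x \<in> line_at_infinity \<inter> S"
      then obtain y z where yz: "y \<noteq> 0 \<or> z \<noteq> 0" "x = abs_cp2 (vector [0, y, z])" using line_at_infinity_cases by blast
      have n: "vector [0, y, z] \<noteq> (0 :: complex^3)" using yz(1) by (simp add: vector_eq_0_iff)
      have z: "z \<noteq> 0" "depth (2 * \<gamma>) (y / z * \<omega> (- d)) > 0"
        using x n by (auto simp: S_def yz(2) in_chart_abs affine_coords_abs)
      have "x = abs_cp2 (vector [0, y / z, 1])"
        unfolding yz(2) by (rule abs_cp2_eqI[where c = "1 / z"]) (use n z v0 in \<open>auto simp: vec_eq_iff forall_3\<close>)
      then show "x \<in> Sig d" using z(2) unfolding Sig_def by blast
    qed
  qed
  ultimately have op: "openin (top_of_set line_at_infinity) (Sig d)" by (metis openin_open_Int)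
  define g where "g t = half_plane_to_sector (2 * \<gamma>) ((1 + t) / (1 - t)) * \<omega> d" for t
  define \<pi> where "\<pi> t = abs_cp2 (vector [0, g t, 1])" for t
  define s where "s x = sector_to_half_plane (2 * \<gamma>) (affine_coords 3 x $ 2 * \<omega> (- d))" for x
  define \<rho> where "\<rho> x = (s x - 1) / (s x + 1)" for x
  have mob: "Re ((1 + t) / (1 - t)) > 0" "1 - t \<noteq> 0" if "t \<in> ball 0 1" for t :: complex
  proof -
    have t: "cmod t < 1" using that by simp
    then show t1: "1 - t \<noteq> 0" by auto
    define s where "s = (1 + t) / (1 - t)"
    \<comment> \<open>By this identity |t| < 1 means that s is closer to 1 than to -1, that is,
      \<open>Re s > 0\<close>.\<close>
    have s: "s - 1 = t * (s + 1)" "s + 1 = 2 / (1 - t)" using t1 by (simp_all add: s_def field_simps)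
    from s(1) have "cmod (s - 1) = cmod t * cmod (s + 1)" by (simp only: norm_mult)
    moreover have "cmod (s + 1) > 0" using s(2) t1 by simp
    ultimately have "cmod (s - 1) < cmod (s + 1)" using t by simp
    then have "(cmod (s - 1))\<^sup>2 < (cmod (s + 1))\<^sup>2" by (simp add: power_strict_mono)
    then show "Re s > 0" unfolding cmod_power2 by (simp add: power2_eq_square algebra_simps)
  qed
  have ghol: "g holomorphic_on ball 0 1"
    unfolding g_def
  proof (intro holomorphic_intros)
    have "(half_plane_to_sector (2 * \<gamma>) \<circ> (\<lambda>t. (1 + t) / (1 - t))) holomorphic_on ball 0 1"
    proof (rule holomorphic_on_compose_gen[OF _ holomorphic_on_half_plane_to_sector])
      show "(\<lambda>t. (1 + t) / (1 - t)) holomorphic_on ball 0 1" using mob by (intro holomorphic_intros) auto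
    qed (use mob in \<open>auto simp: half_plane_def\<close>)
    then show "(\<lambda>t. half_plane_to_sector (2 * \<gamma>) ((1 + t) / (1 - t))) holomorphic_on ball 0 1" by (simp add: comp_def)
  qed
  have gd: "depth (2 * \<gamma>) (g t * \<omega> (- d)) > 0" "sector_to_half_plane (2 * \<gamma>) (g t * \<omega> (- d)) = (1 + t) / (1 - t)"
    if "t \<in> ball 0 1" for t
    using sm(1,2)[OF mob(1)[OF that]] by (simp_all add: g_def mult.assoc)
  have \<pi>_cont: "continuous_on (ball 0 1) \<pi>"
    unfolding \<pi>_def
    by (rule continuous_on_compose2[OF continuous_on_abs_cp2, of "ball 0 1" "\<lambda>t. vector [0, g t, 1]"])
      (use v0 in \<open>auto intro!: continuous_intros holomorphic_on_imp_continuous_on[OF ghol]\<close>)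
  have \<pi>_hol: "holomorphic_curve_cp2 (ball 0 1) \<pi>"
    unfolding holomorphic_curve_cp2_def
  proof (intro conjI allI open_ball \<pi>_cont)
    fix i j :: 3
    have c3: "affine_coords 3 (\<pi> t) = vector [0, g t, 1]" for t
      using v0[of "g t"] by (simp add: \<pi>_def affine_coords_abs vec_eq_iff forall_3)
    have c2: "affine_coords 2 (\<pi> t) = vector [0, g t / g t, 1 / g t]" for t
      using v0[of "g t"] by (simp add: \<pi>_def affine_coords_abs vec_eq_iff forall_3)
    have ch: "in_chart i (\<pi> t) \<longleftrightarrow> (i = 2 \<and> g t \<noteq> 0) \<or> i = 3" for t
      using v0[of "g t"] exhaust_3[of i] by (auto simp: \<pi>_def in_chart_abs)
    consider "i = 1" | "i = 2" | "i = 3" using exhaust_3[of i] by blast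
    then show "(\<lambda>t. affine_coords i (\<pi> t) $ j) holomorphic_on {t \<in> ball 0 1. in_chart i (\<pi> t)}"
    proof cases
      case 1 then show ?thesis using ch by (simp add: holomorphic_on_empty)
    next
      case 2
      have gh: "g holomorphic_on {t \<in> ball 0 1. in_chart i (\<pi> t)}"
        by (rule holomorphic_on_subset[OF ghol]) auto
      have "(\<lambda>t. vector [0, 1, 1 / g t] $ j) holomorphic_on {t \<in> ball 0 1. in_chart i (\<pi> t)}"
        using exhaust_3[of j] gh ch by (auto simp: 2 intro!: holomorphic_intros)
      then show ?thesis
        by (rule holomorphic_transform) (use exhaust_3[of j] ch in \<open>auto simp: 2 c2\<close>)
    next
      case 3
      have gh: "g holomorphic_on {t \<in> ball 0 1. in_chart i (\<pi> t)}"
        by (rule holomorphic_on_subset[OF ghol]) auto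
      show ?thesis unfolding 3 c3
        using exhaust_3[of j] gh by (auto simp: 3 intro!: holomorphic_intros)
    qed
  qed
  have s\<pi>: "s (\<pi> t) = (1 + t) / (1 - t)" if "t \<in> ball 0 1" for t
    using gd(2)[OF that] v0[of "g t"] by (simp add: s_def \<pi>_def affine_coords_abs)
  have s_Sig: "Re (s x) > 0" "in_chart 3 x" "half_plane_to_sector (2 * \<gamma>) (s x) * \<omega> d = affine_coords 3 x $ 2"
    "x = abs_cp2 (vector [0, affine_coords 3 x $ 2, 1])" if "x \<in> Sig d" for x
  proof -
    obtain h where h: "depth (2 * \<gamma>) (h * \<omega> (- d)) > 0" "x = abs_cp2 (vector [0, h, 1])" using \<open>x \<in> Sig d\<close> by (auto simp: Sig_def)
    have ah: "affine_coords 3 x $ 2 = h" using v0[of h] by (simp add: h(2) affine_coords_abs)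
    show "Re (s x) > 0" "half_plane_to_sector (2 * \<gamma>) (s x) * \<omega> d = affine_coords 3 x $ 2"
      using sm(3,4)[OF h(1)] by (simp_all add: s_def ah mult.assoc)
    show "in_chart 3 x" using v0[of h] by (simp add: h(2) in_chart_abs)
    show "x = abs_cp2 (vector [0, affine_coords 3 x $ 2, 1])" unfolding ah by (rule h(2))
  qed
  have "homeomorphism (ball 0 1) (Sig d) \<pi> \<rho>"
  proof (rule homeomorphismI[OF \<pi>_cont])
    have "continuous_on (Sig d) s"
      unfolding s_def
    proof (rule continuous_on_compose2[OF holomorphic_on_imp_continuous_on[OF holomorphic_on_sector_to_half_plane[OF two_\<gamma>_bounds]]])
      show "continuous_on (Sig d) (\<lambda>x. affine_coords 3 x $ 2 * \<omega> (- d))"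
        by (rule continuous_on_subset[OF cS]) (use s_Sig(2) in auto)
      show "(\<lambda>x. affine_coords 3 x $ 2 * \<omega> (- d)) ` Sig d \<subseteq> {z. depth (2 * \<gamma>) z > 0}"
        using v0 by (auto simp: Sig_def affine_coords_abs)
    qed
    moreover have "s x + 1 \<noteq> 0" if "x \<in> Sig d" for x
      using s_Sig(1)[OF that] by (auto simp: complex_eq_iff)
    ultimately show "continuous_on (Sig d) \<rho>" unfolding \<rho>_def by (intro continuous_intros) auto
    show "\<pi> ` ball 0 1 \<subseteq> Sig d" using gd(1) by (auto simp: \<pi>_def Sig_def)
    show "\<rho> ` Sig d \<subseteq> ball 0 1"
    proof (rule image_subsetI)
      fix x assume "x \<in> Sig d"
      then have s: "Re (s x) > 0" by (rule s_Sig)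
      then have "(cmod (s x - 1))\<^sup>2 < (cmod (s x + 1))\<^sup>2"
        unfolding cmod_power2 by (simp add: power2_eq_square algebra_simps)
      then have "cmod (s x - 1) < cmod (s x + 1)" using power2_less_imp_less norm_ge_zero by blast
      moreover from this have "cmod (s x + 1) > 0" by (rule le_less_trans[OF norm_ge_zero])
      ultimately show "\<rho> x \<in> ball 0 1" by (simp add: \<rho>_def norm_divide divide_less_eq)
    qed
    show "\<rho> (\<pi> t) = t" if "t \<in> ball 0 1" for t
      using mob(2)[OF that] unfolding \<rho>_def s\<pi>[OF that] by (simp add: field_simps)
    show "\<pi> (\<rho> x) = x" if "x \<in> Sig d" for x
    proof -
      have "s x + 1 \<noteq> 0" using s_Sig(1)[OF that] by (auto simp: complex_eq_iff)
      then have "1 + \<rho> x = 2 * s x / (s x + 1)" "1 - \<rho> x = 2 / (s x + 1)" "s x + 1 \<noteq> 0"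
        unfolding \<rho>_def by (simp_all add: field_simps)
      then have "(1 + \<rho> x) / (1 - \<rho> x) = s x" by simp
      then have "g (\<rho> x) = affine_coords 3 x $ 2" using s_Sig(3)[OF that] by (simp add: g_def)
      then show ?thesis using s_Sig(4)[OF that] by (simp add: \<pi>_def)
    qed
  qed
  then have "covering_space (ball 0 1) \<pi> (Sig d)" "\<pi> ` ball 0 1 = Sig d"
    by (auto intro: homeomorphism_imp_covering_space simp: homeomorphism_image1)
  moreover from this(2) have "connected (Sig d)"
    using connected_continuous_image[OF \<pi>_cont] by (metis connected_ball)
  ultimately show ?thesis unfolding hyperbolic_at_infinity_def using op \<pi>_hol by blast
qed

end

section \<open>Closures, isolated zeros and the bound on the argument\<close>

lemma connected_subset_of_clopen:
  assumes "connected S" "open T" "S \<inter> T \<noteq> {}" "\<And>t. t \<in> S \<Longrightarrow> t \<in> closure T \<Longrightarrow> t \<in> T"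
  shows "S \<subseteq> T"
proof -
  have "S \<inter> closure T = S \<inter> T" using assms(4) closure_subset[of T] by blast
  then have "closedin (top_of_set S) (S \<inter> T)" by (metis closed_closure closedin_closed_Int)
  moreover have "openin (top_of_set S) (S \<inter> T)" using assms(2) by (rule openin_open_Int)
  ultimately have "S \<inter> T = {} \<or> S \<inter> T = S" using assms(1) unfolding connected_clopen by blast
  then show ?thesis using assms(3) by blast
qed

lemma closure_sequence:
  fixes t :: "'a::metric_space"
  assumes "open N" "t \<in> N" "t \<in> closure T"
  obtains x where "\<And>n. x n \<in> T \<inter> N" "x \<longlonglongrightarrow> t"
proof -
  have "t \<in> closure (N \<inter> T)" using open_Int_closure_subset[OF assms(1)] assms by blast
  then obtain x where "\<forall>n. x n \<in> N \<inter> T" "x \<longlonglongrightarrow> t" unfolding closure_sequential by blast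
  then show ?thesis by (intro that[of x]) auto
qed

lemma continuous_on_agree_closure:
  fixes f g :: "'a::metric_space \<Rightarrow> 'b::t2_space"
  assumes "continuous_on N f" "continuous_on N g" "open N" "t \<in> N" "t \<in> closure T"
    and "\<And>s. s \<in> T \<Longrightarrow> s \<in> N \<Longrightarrow> f s = g s"
  shows "f t = g t"
proof -
  obtain x where x: "\<And>n. x n \<in> T \<inter> N" "x \<longlonglongrightarrow> t" using closure_sequence[OF assms(3-5)] by blast
  have "isCont f t" "isCont g t" using assms by (auto simp: continuous_on_eq_continuous_at)
  then have "(\<lambda>n. f (x n)) \<longlonglongrightarrow> f t" "(\<lambda>n. g (x n)) \<longlonglongrightarrow> g t"
    using x(2) by (auto intro: isCont_tendsto_compose)
  moreover have "(\<lambda>n. f (x n)) = (\<lambda>n. g (x n))" using assms(6) x(1) by auto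
  ultimately show ?thesis using LIMSEQ_unique by metis
qed

lemma continuous_on_closed_closure:
  fixes f :: "'a::metric_space \<Rightarrow> 'b::metric_space"
  assumes "continuous_on N f" "open N" "t \<in> N" "t \<in> closure T" "closed S"
    and "\<And>s. s \<in> T \<Longrightarrow> s \<in> N \<Longrightarrow> f s \<in> S"
  shows "f t \<in> S"
proof -
  obtain x where x: "\<And>n. x n \<in> T \<inter> N" "x \<longlonglongrightarrow> t" using closure_sequence[OF assms(2-4)] by blast
  have "isCont f t" using assms by (auto simp: continuous_on_eq_continuous_at)
  then have "(\<lambda>n. f (x n)) \<longlonglongrightarrow> f t" using x(2) by (auto intro: isCont_tendsto_compose)
  moreover have "\<And>n. f (x n) \<in> S" using x(1) assms(6) by auto
  ultimately show ?thesis using closed_sequentially[OF assms(5), of "\<lambda>n. f (x n)" "f t"] by blast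
qed

text \<open>If \<open>T\<close> is closed away from the zeros of \<open>u\<close>, then near an isolated zero of \<open>u\<close> it fills a
  punctured disc, so that \<open>exp (- \<kappa> u)\<close> has a local maximum of its modulus there.\<close>

lemma no_isolated_zero_in_closure:
  assumes u: "u holomorphic_on ball t \<rho>" "u t = 0" "\<rho> > 0" and T: "open T" "t \<in> closure T"
    and pos: "\<And>s. s \<in> T \<Longrightarrow> s \<in> ball t \<rho> \<Longrightarrow> Re (\<kappa> * u s) > 0"
    and abs: "\<And>s. s \<in> closure T \<Longrightarrow> s \<in> ball t \<rho> \<Longrightarrow> u s \<noteq> 0 \<Longrightarrow> s \<in> T"
  shows False
proof -
  have meet: "\<exists>s. s \<in> T \<and> s \<in> ball t r" if "r > 0" for r
    using T(2) that by (metis closure_approachable mem_ball dist_commute)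
  obtain s0 where s0: "s0 \<in> T" "s0 \<in> ball t \<rho>" using meet[OF u(3)] by blast
  \<comment> \<open>At a zero of u the quantity Re (\<kappa> u) could not be positive. So u does not
    vanish identically, and its zero at t is isolated.\<close>
  then have "u s0 \<noteq> 0" using pos[OF s0] by auto
  then obtain r where r: "r > 0" "ball t r \<subseteq> ball t \<rho>" "\<And>z. z \<in> ball t r - {t} \<Longrightarrow> u z \<noteq> 0"
    using isolated_zeros[OF u(1) open_ball connected_ball, of t s0] u s0 by auto
  have conn: "connected (ball t r - {t})"
    by (intro connected_open_delete open_ball connected_ball) simp
  obtain s where s: "s \<in> T" "s \<in> ball t r" using meet[OF r(1)] by blast
  then have st: "s \<noteq> t" using pos[of s] r(2) u(2,3) by auto
  have sub: "ball t r - {t} \<subseteq> T"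
    by (rule connected_subset_of_clopen[OF conn T(1)]) (use s st abs r in auto)
  define f where "f z = exp (- (\<kappa> * u z))" for z
  have f: "f holomorphic_on ball t r"
    unfolding f_def by (intro holomorphic_intros holomorphic_on_subset[OF u(1) r(2)])
  have pos': "Re (\<kappa> * u z) > 0" if "z \<in> ball t r" "z \<noteq> t" for z
  proof -
    have "z \<in> T" "z \<in> ball t \<rho>" using sub that r(2) by auto
    then show ?thesis by (rule pos)
  qed
  have "cmod (f z) \<le> cmod (f t)" if "z \<in> ball t r" for z
    using pos'[OF that] by (cases "z = t") (auto simp: f_def u(2))
  then have "f constant_on ball t r"
    by (intro maximum_modulus_principle[OF f open_ball connected_ball open_ball order_refl, of t]) (use r in auto)
  then have "f s = f t" using s r(1) unfolding constant_on_def by (metis centre_in_ball)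
  then have "cmod (f s) = 1" by (simp add: f_def u(2))
  moreover have "cmod (f s) < 1" using pos'[OF s(2) st] by (simp add: f_def)
  ultimately show False by simp
qed

lemma Arg_le_of_Re_ge:
  assumes "0 < e" "e < pi / 2" "w \<noteq> 0" "Re w \<ge> - sin e * cmod w"
  shows "\<bar>Arg w\<bar> \<le> pi / 2 + e"
proof (rule ccontr)
  assume "\<not> ?thesis"
  then have *: "pi / 2 + e < \<bar>Arg w\<bar>" "\<bar>Arg w\<bar> \<le> pi" using Arg_bounded[of w] by auto
  then have "cos \<bar>Arg w\<bar> < cos (pi / 2 + e)"
    using assms by (intro cos_monotone_0_pi) auto
  then have "cos (Arg w) < - sin e" by (simp add: cos_add)
  then have "cmod w * cos (Arg w) < cmod w * (- sin e)" using assms(3) by (intro mult_strict_left_mono) auto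
  moreover have "Re w = cmod w * cos (Arg w)" by (metis Re_rcis rcis_cmod_Arg)
  ultimately show False using assms(4) by (simp add: mult.commute)
qed

lemma nonpos_Reals_Arg: "w \<in> \<real>\<^sub>\<le>\<^sub>0 \<Longrightarrow> w = 0 \<or> Arg w = pi"
  by (metis Arg_eq_pi complex_is_Real_iff complex_nonpos_Reals_iff complex_eqI less_eq_real_def zero_complex.sel)

lemma cmod_exp_i_Ln:
  assumes "w \<noteq> 0"
  shows "cmod (exp (- \<i> * Ln w)) = exp (Arg w)" "cmod (exp (\<i> * Ln w)) = exp (- Arg w)"
  using assms by (simp_all add: Arg_eq_Im_Ln)

text \<open>The growth hypothesis confines the argument to \<pi>/2 + e uniformly on S for late n. To
  apply the maximum principle to the argument from both sides it is turned into moduli: exp (-i Ln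
  w) has modulus exp (Arg w), and exp (i Ln w) has modulus exp (-Arg w). The strict bound at t0 then
  propagates to t.\<close>

lemma eventually_Arg_power_bounded:
  fixes f :: "nat \<Rightarrow> complex \<Rightarrow> complex"
  assumes m: "m \<ge> 2" and S: "open S" "connected S" "t0 \<in> S" "t \<in> S"
    and hol: "\<And>n. f n holomorphic_on S"
    and infty: "\<And>e. e > 0 \<Longrightarrow> \<forall>\<^sub>F n in sequentially. \<forall>s\<in>S. f n s \<noteq> 0 \<and> cmod (1 / f n s) < e"
    and E: "\<forall>\<^sub>F n in sequentially. \<forall>s\<in>S. cmod (exp (- (f n s ^ m))) \<le> C * cmod (f n s)"
    and t0: "\<forall>\<^sub>F n in sequentially. \<bar>Arg (f n t0 ^ m)\<bar> \<le> \<beta>" "\<beta> < pi / 2"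
  shows "\<exists>\<beta>'<pi / 2. \<forall>\<^sub>F n in sequentially. \<bar>Arg (f n t ^ m)\<bar> < \<beta>'"
proof -
  have arg: "\<forall>\<^sub>F n in sequentially. \<forall>s\<in>S. f n s \<noteq> 0 \<and> \<bar>Arg (f n s ^ m)\<bar> \<le> pi / 2 + e"
    if e: "0 < e" "e < pi / 2" for e
  proof -
    have sin: "sin e > 0" using e by (intro sin_gt_zero) auto
    have "\<forall>\<^sub>F n in sequentially. \<forall>s\<in>S. f n s \<noteq> 0 \<and> cmod (1 / f n s) < 1"
      "\<forall>\<^sub>F n in sequentially. \<forall>s\<in>S. f n s \<noteq> 0 \<and> cmod (1 / f n s) < sin e / (\<bar>C\<bar> + 1)"
      by (rule infty; use sin in simp)+
    with E show ?thesis
    proof eventually_elim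
      case (elim n)
      show ?case
      proof
        fix s assume s: "s \<in> S"
        define z where "z = f n s"
        have z: "z \<noteq> 0" "cmod (1 / z) < 1" "cmod (1 / z) < sin e / (\<bar>C\<bar> + 1)" "cmod (exp (- (z ^ m))) \<le> C * cmod z"
          using elim s by (auto simp: z_def)
        have z1: "cmod z > 1" using z(1,2) by (simp add: norm_divide field_simps)
        have z2: "\<bar>C\<bar> + 1 \<le> sin e * cmod z"
          using z(1,3) by (simp add: norm_divide field_simps)
        \<comment> \<open>Estimating C |z| crudely by exp (C |z|) allows -Re (z^m) to be linear in
          |z|. This is still absorbed by sin e * |z|^m, because m >= 2 and |z| is at least (|C| + 1)
          / sin e.\<close>
        have "exp (- Re (z ^ m)) \<le> C * cmod z" using z(4) by simp
        also have "\<dots> \<le> exp (C * cmod z)" using exp_ge_add_one_self[of "C * cmod z"] by linarith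
        finally have "- Re (z ^ m) \<le> C * cmod z" by simp
        also have "\<dots> \<le> (\<bar>C\<bar> + 1) * cmod z" by (intro mult_right_mono) auto
        also have "\<dots> \<le> sin e * cmod z * cmod z" using z2 by (intro mult_right_mono) auto
        also have "\<dots> = sin e * cmod z ^ 2" by (simp add: power2_eq_square)
        also have "\<dots> \<le> sin e * cmod z ^ m" using sin z1 m by (intro mult_left_mono power_increasing) auto
        finally have "Re (z ^ m) \<ge> - sin e * cmod (z ^ m)" by (simp add: norm_power)
        then have "\<bar>Arg (z ^ m)\<bar> \<le> pi / 2 + e" using z(1) by (intro Arg_le_of_Re_ge e) auto
        then show "f n s \<noteq> 0 \<and> \<bar>Arg (f n s ^ m)\<bar> \<le> pi / 2 + e" using z(1) by (simp add: z_def)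
      qed
    qed
  qed
  have arg1: "\<forall>\<^sub>F n in sequentially. \<forall>s\<in>S. f n s \<noteq> 0 \<and> \<bar>Arg (f n s ^ m)\<bar> \<le> pi / 2 + 1"
    by (rule arg) (use pi_gt3 in auto)
  have Kbound: "\<forall>\<^sub>F n in sequentially. \<forall>s\<in>S. f n s \<noteq> 0 \<and> exp \<bar>Arg (f n s ^ m)\<bar> \<le> exp (pi / 2) + e" if "e > 0" for e
  proof -
    have "((\<lambda>x. exp (pi / 2 + x)) \<longlongrightarrow> exp (pi / 2 + 0)) (at_right (0::real))"
      by (intro tendsto_intros)
    then have "\<forall>\<^sub>F x in at_right (0::real). exp (pi / 2 + x) < exp (pi / 2) + e"
      by (rule order_tendstoD(2)) (use that in simp)
    moreover have "\<forall>\<^sub>F x in at_right (0::real). 0 < x \<and> x < pi / 2"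
      using eventually_at_right_real[of 0 "pi / 2"] by (simp add: greaterThanLessThan_iff)
    ultimately have "\<forall>\<^sub>F x in at_right (0::real). exp (pi / 2 + x) < exp (pi / 2) + e \<and> 0 < x \<and> x < pi / 2"
      by eventually_elim simp
    then obtain x where x: "exp (pi / 2 + x) < exp (pi / 2) + e" "0 < x" "x < pi / 2"
      using eventually_happens'[OF trivial_limit_at_right_real] by blast
    show ?thesis using arg[OF x(2,3)]
    proof eventually_elim
      case (elim n)
      show ?case
      proof
        fix s assume "s \<in> S"
        then have "f n s \<noteq> 0" "exp \<bar>Arg (f n s ^ m)\<bar> \<le> exp (pi / 2 + x)" using elim by auto
        then show "f n s \<noteq> 0 \<and> exp \<bar>Arg (f n s ^ m)\<bar> \<le> exp (pi / 2) + e" using x(1) by linarith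
      qed
    qed
  qed
  \<comment> \<open>The bound \<pi>/2 + 1 < \<pi> keeps the powers off the cut of the principal
    logarithm.\<close>
  have Khol: "\<forall>\<^sub>F n in sequentially. (\<lambda>s. exp (c * Ln (f n s ^ m))) holomorphic_on S" for c
    using arg1
  proof eventually_elim
    case (elim n)
    have "f n s ^ m \<notin> \<real>\<^sub>\<le>\<^sub>0" if "s \<in> S" for s
    proof
      assume "f n s ^ m \<in> \<real>\<^sub>\<le>\<^sub>0"
      then have "Arg (f n s ^ m) = pi" using nonpos_Reals_Arg elim that by fastforce
      then show False using elim that pi_gt3 by fastforce
    qed
    then show ?case by (intro holomorphic_intros hol) auto
  qed
  have ex: "\<exists>M''<exp (pi / 2). \<forall>\<^sub>F n in sequentially. cmod (exp (c * Ln (f n t ^ m))) < M''"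
    if c: "c = \<i> \<or> c = - \<i>" for c
  proof (rule eventually_less_of_bounded_holomorphic[OF S Khol])
    have le: "cmod (exp (c * Ln w)) \<le> exp \<bar>Arg w\<bar>" if "w \<noteq> 0" for w
      using c cmod_exp_i_Ln[OF that] by auto
    show "\<forall>\<^sub>F n in sequentially. \<forall>s\<in>S. cmod (exp (c * Ln (f n s ^ m))) \<le> exp (pi / 2) + e" if "e > 0" for e
      using Kbound[OF that]
    proof eventually_elim
      case (elim n) show ?case
      proof
        fix s assume "s \<in> S"
        with elim have "f n s ^ m \<noteq> 0" "exp \<bar>Arg (f n s ^ m)\<bar> \<le> exp (pi / 2) + e" by auto
        with le show "cmod (exp (c * Ln (f n s ^ m))) \<le> exp (pi / 2) + e" by (meson order_trans)
      qed
    qed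
    show "\<forall>\<^sub>F n in sequentially. cmod (exp (c * Ln (f n t0 ^ m))) \<le> exp \<beta>"
      using arg1 t0(1)
    proof eventually_elim
      case (elim n)
      then have "f n t0 ^ m \<noteq> 0" "exp \<bar>Arg (f n t0 ^ m)\<bar> \<le> exp \<beta>" using S(3) by auto
      with le show ?case by (meson order_trans)
    qed
    show "exp \<beta> < exp (pi / 2)" using t0(2) by simp
  qed
  obtain M1 where M1: "M1 < exp (pi / 2)" "\<forall>\<^sub>F n in sequentially. cmod (exp (\<i> * Ln (f n t ^ m))) < M1"
    using ex[of \<i>] by blast
  obtain M2 where M2: "M2 < exp (pi / 2)" "\<forall>\<^sub>F n in sequentially. cmod (exp (- \<i> * Ln (f n t ^ m))) < M2"
    using ex[of "- \<i>"] by blast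
  \<comment> \<open>The entry 1 makes M positive, so that ln M is meaningful; as 1 < exp (\<pi>/2),
    it does not spoil the strict upper bound.\<close>
  define M where "M = max 1 (max M1 M2)"
  have M: "M > 0" "M < exp (pi / 2)" using M1 M2 by (auto simp: M_def)
  have "ln M < pi / 2" using M by (metis exp_gt_zero ln_exp ln_less_cancel_iff)
  moreover have "\<forall>\<^sub>F n in sequentially. \<bar>Arg (f n t ^ m)\<bar> < ln M"
    using M1(2) M2(2) arg1
  proof eventually_elim
    case (elim n)
    then have nz: "f n t ^ m \<noteq> 0" using S(4) by auto
    have "exp (- Arg (f n t ^ m)) < M" "exp (Arg (f n t ^ m)) < M"
      using elim(1,2) unfolding cmod_exp_i_Ln[OF nz] by (auto simp: M_def)
    then have "- Arg (f n t ^ m) < ln M" "Arg (f n t ^ m) < ln M"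
      using M(1) by (metis exp_gt_zero ln_exp ln_less_cancel_iff)+
    then show ?case by (simp add: abs_less_iff)
  qed
  ultimately show ?thesis by blast
qed

context transcendental_henon
begin

text \<open>An argument of z^m bounded away from \<pi>/2 leaves an angular margin of (\<pi>/2 -
  \<beta>)/m around z in one of the sectors, so its depth there is proportional to |z|. The index j
  records which branch of the m-th root is z.\<close>

lemma dep_ge_of_Arg_power:
  assumes "z \<noteq> 0" "\<bar>Arg (z ^ m)\<bar> < \<beta>" "\<beta> < pi / 2"
  shows "\<exists>j. dep j z \<ge> cmod z * sin ((pi / 2 - \<beta>) / m)"
proof -
  define \<theta> where "\<theta> = Arg (z ^ m)"
  have "z ^ m = rcis (cmod z ^ m) (real m * Arg z)" by (metis DeMoivre2 rcis_cmod_Arg)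
  moreover have "z ^ m = rcis (cmod z ^ m) \<theta>" unfolding \<theta>_def by (metis norm_power rcis_cmod_Arg)
  ultimately have "cis (real m * Arg z) = cis \<theta>" using assms(1) by (simp add: rcis_def)
  then obtain j :: int where j: "real m * Arg z = \<theta> + 2 * pi * j"
    unfolding cis.ctr complex.inject using sin_cos_eq_iff by metis
  then have Az: "Arg z = \<theta> / m + 2 * pi * j / m" using m_pos by (simp add: field_simps)
  define u where "u = z * \<omega> (- j)"
  have "u = rcis (cmod z) (Arg z) * \<omega> (- j)" by (simp add: u_def rcis_cmod_Arg)
  also have "\<dots> = rcis (cmod z) (\<theta> / m)" by (simp add: rcis_def \<omega>_def Az mult.assoc cis_mult)
  finally have u: "u = rcis (cmod z) (\<theta> / m)" .
  have \<theta>: "\<bar>\<theta>\<bar> < \<beta>" using assms(2) by (simp add: \<theta>_def)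
  have "\<bar>\<theta> / m\<bar> \<le> \<bar>\<theta>\<bar>" using m_pos mult_left_mono[of 1 "real m" "\<bar>\<theta>\<bar>"] by (simp add: divide_le_eq)
  then have "\<bar>\<theta> / m\<bar> < pi / 2" using \<theta> assms(3) by linarith
  then have "- pi < \<theta> / m" "\<theta> / m \<le> pi" using pi_gt_zero by linarith+
  then have Au: "Arg u = \<theta> / m" unfolding u using assms(1) by (intro Arg_rcis) auto
  have cu: "cmod u = cmod z" by (simp add: u_def norm_mult)
  have "sin ((pi / 2 - \<beta>) / m) \<le> sin (\<gamma> - \<bar>\<theta> / m\<bar>)"
  proof (intro sin_monotone_2pi_le)
    have "\<gamma> - \<bar>\<theta> / m\<bar> = (pi / 2 - \<bar>\<theta>\<bar>) / m" using m_pos by (simp add: \<gamma>_def diff_divide_distrib)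
    then show "(pi / 2 - \<beta>) / m \<le> \<gamma> - \<bar>\<theta> / m\<bar>" using \<theta> m_pos by (simp add: divide_right_mono)
    have "0 \<le> (pi / 2 - \<beta>) / m" using assms(3) by simp
    then show "- (pi / 2) \<le> (pi / 2 - \<beta>) / m" using pi_gt_zero by linarith
    show "\<gamma> - \<bar>\<theta> / m\<bar> \<le> pi / 2" using \<gamma>_bounds by linarith
  qed
  then have "cmod z * sin ((pi / 2 - \<beta>) / m) \<le> dep j z"
    unfolding dep_def u_def[symmetric] depth_polar Au cu by (intro mult_left_mono) auto
  then show ?thesis by blast
qed

text \<open>Because a^m is a positive real, dividing the orbit by a^n does not change the argument
  of its m-th power. That argument converges to the argument of \<eta>^m, which lies strictly inside
  the interval (-\<pi>/2, \<pi>/2).\<close>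

lemma eventually_Arg_orb_bounded:
  assumes "p \<in> \<Omega>"
  shows "\<exists>\<beta><pi / 2. \<forall>\<^sub>F n in sequentially. \<bar>Arg (orb p (2 * n) ^ m)\<bar> \<le> \<beta>"
proof -
  obtain j k where "p \<in> A j k" using assms by (auto simp: \<Omega>_def)
  then have d: "dep k (\<eta> p) > 0" using \<phi>_in_W0 by (auto simp: W_def \<phi>_def)
  note A = Arg_power_in_sector[OF d]
  have "\<eta> p ^ m \<notin> \<real>\<^sub>\<le>\<^sub>0" using A nonpos_Reals_Arg[of "\<eta> p ^ m"] pi_gt_zero by auto
  then have "(\<lambda>n. \<bar>Arg (\<eta>N n p ^ m)\<bar>) \<longlonglongrightarrow> \<bar>Arg (\<eta> p ^ m)\<bar>"
    by (intro tendsto_rabs isCont_tendsto_compose[OF continuous_at_Arg] tendsto_power \<eta>N_tendsto assms)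
  moreover obtain \<beta> where \<beta>: "\<bar>Arg (\<eta> p ^ m)\<bar> < \<beta>" "\<beta> < pi / 2" using dense[OF A(2)] by blast
  ultimately have "\<forall>\<^sub>F n in sequentially. \<bar>Arg (\<eta>N n p ^ m)\<bar> < \<beta>" by (intro order_tendstoD(2)) auto
  moreover have "Arg (orb p (2 * n) ^ m) = Arg (\<eta>N n p ^ m)" for n
  proof -
    have "(a ^ n) ^ m = of_real ((\<delta> ^ n) ^ m)"
    proof -
      have "a ^ m = of_real (\<delta> ^ m)" by (simp add: a_eq power_mult_distrib \<omega>_power_m)
      then show ?thesis by (metis of_real_power power_commutes power_mult mult.commute)
    qed
    moreover have "orb p (2 * n) = a ^ n * \<eta>N n p" by (simp add: \<eta>N_def)
    ultimately have "orb p (2 * n) ^ m = of_real ((\<delta> ^ n) ^ m) * \<eta>N n p ^ m" by (simp only: power_mult_distrib)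
    then show ?thesis using \<delta>_gt_2 by (simp only: Arg_times_of_real zero_less_power)
  qed
  ultimately show ?thesis using \<beta>(2) by (intro exI[of _ \<beta>]) (auto elim: eventually_mono)
qed

end

section \<open>The basins are Fatou components\<close>

lemma eventually_bounded_of_uniform_limit:
  fixes f :: "nat \<Rightarrow> complex \<Rightarrow> complex"
  assumes "uniform_limit K f g sequentially" "compact K" "continuous_on K g"
  shows "\<exists>C>0. \<forall>\<^sub>F n in sequentially. \<forall>t\<in>K. cmod (f n t) \<le> C"
proof -
  have "bounded (g ` K)" using assms by (intro compact_imp_bounded compact_continuous_image)
  then obtain B where B: "B > 0" "\<And>t. t \<in> K \<Longrightarrow> cmod (g t) \<le> B" unfolding bounded_pos by auto
  have "\<forall>\<^sub>F n in sequentially. \<forall>t\<in>K. dist (f n t) (g t) < 1" using assms(1) by (rule uniform_limitD) simp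
  then have "\<forall>\<^sub>F n in sequentially. \<forall>t\<in>K. cmod (f n t) \<le> B + 1"
  proof eventually_elim
    case (elim n)
    show ?case
    proof
      fix t assume "t \<in> K"
      then have "cmod (f n t - g t) < 1" "cmod (g t) \<le> B" using elim B(2) by (auto simp: dist_norm)
      then show "cmod (f n t) \<le> B + 1" using norm_triangle_ineq2[of "f n t" "g t"] by linarith
    qed
  qed
  then show ?thesis using B(1) by (intro exI[of _ "B + 1"]) auto
qed

text \<open>A complex line \<open>c\<close> through a normality domain, on which \<open>g i\<close> is the limit of
  \<open>F\<^bsup>2 r(k) + i\<^esup>\<close>.\<close>

locale transcendental_henon_slice = transcendental_henon +
  fixes c :: "complex \<Rightarrow> complex \<times> complex" and D :: "complex set" and r :: "nat \<Rightarrow> nat"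
    and g :: "nat \<Rightarrow> complex \<Rightarrow> cp2" and j k :: int
  assumes open_D: "open D"
    and hol_c: "(\<lambda>t. fst (c t)) holomorphic_on D" "(\<lambda>t. snd (c t)) holomorphic_on D"
    and r: "strict_mono r"
    and lim: "\<And>i K. i \<le> 2 \<Longrightarrow> compact K \<Longrightarrow> K \<subseteq> D \<Longrightarrow>
      uniform_limit K (\<lambda>n t. embed_cp2 ((F ^^ (2 * r n + i)) (c t))) (g i) sequentially"
    and cont: "\<And>i. i \<le> 2 \<Longrightarrow> continuous_on D (g i)"
begin

definition T :: "complex set" where "T = {t \<in> D. c t \<in> A j k}"

lemma continuous_on_c: "continuous_on D c"
  using continuous_on_Pair[OF holomorphic_on_imp_continuous_on[OF hol_c(1)] holomorphic_on_imp_continuous_on[OF hol_c(2)]]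
  by simp

lemma open_T: "open T"
proof -
  have "T = D \<inter> c -` A j k" by (auto simp: T_def)
  then show ?thesis using continuous_open_preimage[OF continuous_on_c open_D open_A] by simp
qed

lemma T_D: "t \<in> T \<Longrightarrow> t \<in> D" and T_\<Omega>: "t \<in> T \<Longrightarrow> c t \<in> \<Omega>" and T_A: "t \<in> T \<Longrightarrow> c t \<in> A j k"
  using A_subset_\<Omega> by (auto simp: T_def)

lemma holomorphic_orb: "(\<lambda>t. orb (c t) n) holomorphic_on D"
  using holomorphic2_on_slice[OF holomorphic2_orb hol_c open_D UNIV_I] by simp

lemma lim_point:
  assumes "i \<le> 2" "t \<in> D"
  shows "(\<lambda>n. embed_cp2 ((F ^^ (2 * r n + i)) (c t))) \<longlonglongrightarrow> g i t"
  using tendsto_uniform_limitI[OF lim[of i "{t}"], of t] assms by simp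

lemma g_on_T:
  assumes "t \<in> T"
  shows "g 0 t = H (c t)" "g 1 t = H (F (c t))" "g 2 t = H (c t)"
proof -
  have O: "c t \<in> \<Omega>" "t \<in> D" using assms T_\<Omega> T_D by auto
  have r': "filterlim r at_top sequentially" "filterlim (\<lambda>n. r n + 1) at_top sequentially"
    using r by (auto intro!: filterlim_subseq simp: strict_mono_def)
  have "(\<lambda>n. embed_cp2 ((F ^^ (2 * r n)) (c t))) \<longlonglongrightarrow> H (c t)"
    using filterlim_compose[OF tendsto_even[OF O(1)] r'(1)] .
  then show "g 0 t = H (c t)" using lim_point[of 0 t] O LIMSEQ_unique by fastforce
  have "(\<lambda>n. embed_cp2 ((F ^^ (2 * r n + 1)) (c t))) \<longlonglongrightarrow> H (F (c t))"
    using filterlim_compose[OF tendsto_odd[OF O(1)] r'(1)] .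
  then show "g 1 t = H (F (c t))" using lim_point[of 1 t] O LIMSEQ_unique by fastforce
  have "(\<lambda>n. embed_cp2 ((F ^^ (2 * (r n + 1))) (c t))) \<longlonglongrightarrow> H (c t)"
    using filterlim_compose[OF tendsto_even[OF O(1)] r'(2)] .
  then have "(\<lambda>n. embed_cp2 ((F ^^ (2 * r n + 2)) (c t))) \<longlonglongrightarrow> H (c t)" by simp
  then show "g 2 t = H (c t)" using lim_point[of 2 t] O LIMSEQ_unique by fastforce
qed

lemma T_closure_meets:
  assumes "t \<in> closure T" "\<rho> > 0"
  shows "\<exists>s. s \<in> T \<and> s \<in> ball t \<rho>"
  using assms by (metis closure_approachable mem_ball dist_commute)

text \<open>The quotients of neighbouring coordinates are bounded near \<open>t\<close>, hence so is
  \<open>E (Z) / Z\<close> for \<open>Z = orb (c s) (N n)\<close>, because \<open>E\<close> is a difference of neighbours.\<close>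

lemma local_bounds:
  assumes i: "i \<le> 1" and t: "t \<in> D" "t \<in> closure T"
    and ch: "in_chart 2 (g i t)" "in_chart 3 (g (Suc i) t)"
    and inf: "\<And>s. s \<in> T \<Longrightarrow> g i s \<in> line_at_infinity"
  defines "N n \<equiv> 2 * r n + Suc i"
  shows "\<exists>\<rho>>0. ball t \<rho> \<subseteq> D \<and>
    (\<forall>e>0. \<forall>\<^sub>F n in sequentially. \<forall>s\<in>ball t \<rho>. orb (c s) (N n) \<noteq> 0 \<and> cmod (1 / orb (c s) (N n)) < e) \<and>
    (\<exists>C. \<forall>\<^sub>F n in sequentially. \<forall>s\<in>ball t \<rho>. cmod (E (orb (c s) (N n))) \<le> C * cmod (orb (c s) (N n)))"
proof -
  have i2: "i \<le> 2" "Suc i \<le> 2" using i by auto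
  have "open (D \<inter> g i -` {x. in_chart 2 x})" "open (D \<inter> g (Suc i) -` {x. in_chart 3 x})"
    by (intro continuous_open_preimage cont i2 open_D open_in_chart)+
  then have "open ((D \<inter> g i -` {x. in_chart 2 x}) \<inter> (D \<inter> g (Suc i) -` {x. in_chart 3 x}))" by (rule open_Int)
  moreover have "t \<in> (D \<inter> g i -` {x. in_chart 2 x}) \<inter> (D \<inter> g (Suc i) -` {x. in_chart 3 x})" using t ch by simp
  ultimately obtain \<rho> where \<rho>: "\<rho> > 0" "cball t \<rho> \<subseteq> (D \<inter> g i -` {x. in_chart 2 x}) \<inter> (D \<inter> g (Suc i) -` {x. in_chart 3 x})"
    using open_contains_cball by blast
  define K where "K = cball t \<rho>"
  have K: "compact K" "K \<subseteq> D" "\<And>s. s \<in> K \<Longrightarrow> in_chart 2 (g i s)" "\<And>s. s \<in> K \<Longrightarrow> in_chart 3 (g (Suc i) s)"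
    "ball t \<rho> \<subseteq> K"
    using \<rho> by (auto simp: K_def)
  have cK: "continuous_on K (g i)" "continuous_on K (g (Suc i))"
    using cont i2 K(2) continuous_on_subset by blast+
  define Z where "Z n s = orb (c s) (N n)" for n s
  \<comment> \<open>\<open>Z\<close> is the first coordinate at time 2 r n + i and the second
    coordinate one step later. Chart 2 at the earlier time and chart 3 at the later one therefore
    both divide by \<open>Z\<close>.\<close>
  have em: "embed_cp2 ((F ^^ (2 * r n + i)) (c s)) = embed_cp2 (Z n s, orb (c s) (2 * r n + i))"
    "embed_cp2 ((F ^^ (2 * r n + Suc i)) (c s)) = embed_cp2 (orb (c s) (Suc (N n)), Z n s)" for n s
    by (simp_all add: funpow_F Z_def N_def del: funpow.simps)
  have lim0: "uniform_limit K (\<lambda>n s. embed_cp2 (Z n s, orb (c s) (2 * r n + i))) (g i) sequentially"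
    using lim[OF i2(1) K(1,2)] unfolding em .
  have lim1: "uniform_limit K (\<lambda>n s. embed_cp2 (orb (c s) (Suc (N n)), Z n s)) (g (Suc i)) sequentially"
    using lim[OF i2(2) K(1,2)] unfolding em .
  have ev: "\<forall>\<^sub>F n in sequentially. \<forall>s\<in>K. Z n s \<noteq> 0"
    using uniform_limit_affine_coords(2)[OF lim0 K(1) cK(1) K(3)] by (simp add: embed_cp2_chart2)
  have l1: "uniform_limit K (\<lambda>n s. 1 / Z n s) (\<lambda>s. affine_coords 2 (g i s) $ 1) sequentially"
    using uniform_limit_affine_coords(1)[OF lim0 K(1) cK(1) K(3), of 1] by (simp add: embed_cp2_chart2)
  have l2: "uniform_limit K (\<lambda>n s. orb (c s) (2 * r n + i) / Z n s) (\<lambda>s. affine_coords 2 (g i s) $ 3) sequentially"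
    using uniform_limit_affine_coords(1)[OF lim0 K(1) cK(1) K(3), of 3] by (simp add: embed_cp2_chart2)
  have l3: "uniform_limit K (\<lambda>n s. orb (c s) (Suc (N n)) / Z n s) (\<lambda>s. affine_coords 3 (g (Suc i) s) $ 2) sequentially"
    using uniform_limit_affine_coords(1)[OF lim1 K(1) cK(2) K(4), of 2] by (simp add: embed_cp2_chart3)
  have ca: "continuous_on K (\<lambda>s. affine_coords 2 (g i s) $ q)" for q
    by (intro continuous_intros continuous_on_compose2[OF continuous_on_affine_coords cK(1)]) (use K(3) in auto)
  have ca': "continuous_on K (\<lambda>s. affine_coords 3 (g (Suc i) s) $ q)" for q
    by (intro continuous_intros continuous_on_compose2[OF continuous_on_affine_coords cK(2)]) (use K(4) in auto)
  have Zhol: "(\<lambda>s. Z n s) holomorphic_on D" for n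
    unfolding Z_def by (rule holomorphic_orb)
  \<comment> \<open>\<open>X\<close> is the limit of 1 / \<open>Z\<close>. On T the limit g i lies
    at infinity, so \<open>X\<close> vanishes on a nonempty open set and by the identity theorem on
    the whole disc; hence \<open>Z\<close> tends to infinity uniformly there.\<close>
  define X where "X s = affine_coords 2 (g i s) $ 1" for s
  have "X holomorphic_on ball t \<rho>"
  proof (rule holomorphic_uniform_limit[of t \<rho> "\<lambda>n s. 1 / Z n s" sequentially X])
    show "uniform_limit (cball t \<rho>) (\<lambda>n s. 1 / Z n s) X sequentially"
      using l1 by (simp add: K_def X_def[abs_def])
    show "\<forall>\<^sub>F n in sequentially. continuous_on (cball t \<rho>) (\<lambda>s. 1 / Z n s) \<and> (\<lambda>s. 1 / Z n s) holomorphic_on ball t \<rho>"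
      using ev
    proof eventually_elim
      case (elim n)
      have "(\<lambda>s. 1 / Z n s) holomorphic_on K"
        using elim by (intro holomorphic_intros holomorphic_on_subset[OF Zhol K(2)]) auto
      then show ?case
        using holomorphic_on_imp_continuous_on holomorphic_on_subset K(5) unfolding K_def by blast
    qed
  qed simp_all
  moreover have "X s = 0" if sT: "s \<in> T \<inter> ball t \<rho>" for s
  proof -
    obtain y z where yz: "y \<noteq> 0 \<or> z \<noteq> 0" "g i s = abs_cp2 (vector [0, y, z])"
      by (rule line_at_infinity_cases[OF inf[of s]]) (use sT in auto)
    then have "vector [0, y, z] \<noteq> (0 :: complex^3)" by (simp add: vector_eq_0_iff)
    then show ?thesis by (simp add: X_def yz(2) affine_coords_abs)
  qed
  moreover have "open (T \<inter> ball t \<rho>)" "T \<inter> ball t \<rho> \<noteq> {}"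
    using open_T T_closure_meets[OF t(2) \<rho>(1)] by auto
  ultimately have X0: "X s = 0" if "s \<in> ball t \<rho>" for s
    using analytic_continuation_open[of "T \<inter> ball t \<rho>" "ball t \<rho>" X "\<lambda>_. 0" s] that by auto
  obtain C1 where C1: "\<forall>\<^sub>F n in sequentially. \<forall>s\<in>K. cmod (orb (c s) (2 * r n + i) / Z n s) \<le> C1"
    using eventually_bounded_of_uniform_limit[OF l2 K(1) ca] by blast
  obtain C2 where C2: "\<forall>\<^sub>F n in sequentially. \<forall>s\<in>K. cmod (orb (c s) (Suc (N n)) / Z n s) \<le> C2"
    using eventually_bounded_of_uniform_limit[OF l3 K(1) ca'] by blast
  have "\<forall>\<^sub>F n in sequentially. \<forall>s\<in>ball t \<rho>. cmod (E (Z n s)) \<le> (C2 + \<delta> * C1) * cmod (Z n s)"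
    using C1 C2 ev
  proof eventually_elim
    case (elim n)
    show ?case
    proof
      fix s assume "s \<in> ball t \<rho>"
      then have s: "s \<in> K" using K(5) by blast
      have Z: "cmod (Z n s) > 0" using elim(3) s by simp
      have b: "cmod (orb (c s) (2 * r n + i)) \<le> C1 * cmod (Z n s)" "cmod (orb (c s) (Suc (N n))) \<le> C2 * cmod (Z n s)"
        using elim(1,2) s Z by (auto simp: norm_divide divide_le_eq)
      have "E (Z n s) = orb (c s) (Suc (N n)) - a * orb (c s) (2 * r n + i)"
        by (simp add: Z_def N_def orb_rec)
      then have "cmod (E (Z n s)) \<le> cmod (orb (c s) (Suc (N n))) + cmod (a * orb (c s) (2 * r n + i))"
        using norm_triangle_ineq4 by metis
      also have "\<dots> \<le> C2 * cmod (Z n s) + \<delta> * (C1 * cmod (Z n s))"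
        unfolding norm_mult norm_a using b \<delta>_gt_2 by (intro add_mono mult_left_mono) auto
      finally show "cmod (E (Z n s)) \<le> (C2 + \<delta> * C1) * cmod (Z n s)" by (simp add: algebra_simps)
    qed
  qed
  moreover have "\<forall>\<^sub>F n in sequentially. \<forall>s\<in>ball t \<rho>. Z n s \<noteq> 0 \<and> cmod (1 / Z n s) < e" if "e > 0" for e
    using uniform_limitD[OF l1 that] ev
  proof eventually_elim
    case (elim n)
    show ?case
    proof
      fix s assume s: "s \<in> ball t \<rho>"
      then have "s \<in> K" using K(5) by blast
      then have "dist (1 / Z n s) (X s) < e" "Z n s \<noteq> 0" using elim by (auto simp: X_def)
      then show "Z n s \<noteq> 0 \<and> cmod (1 / Z n s) < e" using X0[OF s] by simp
    qed
  qed
  moreover have "ball t \<rho> \<subseteq> D" using K by blast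
  ultimately show ?thesis using \<rho>(1) unfolding Z_def by blast
qed

text \<open>The local bounds carry the argument estimate from a nearby point t0 of T to t. The
  margin from \<pi>/2 is then a fixed angle while the coordinate tends to infinity, so its depth in
  some sector passes 1.\<close>

lemma eventually_dep_orb:
  assumes i: "i \<le> 1" and t: "t \<in> D" "t \<in> closure T"
    and ch: "in_chart 2 (g i t)" "in_chart 3 (g (Suc i) t)"
    and inf: "\<And>s. s \<in> T \<Longrightarrow> g i s \<in> line_at_infinity"
  shows "\<forall>\<^sub>F n in sequentially. \<exists>l. dep l (orb (c t) (2 * r n + Suc i)) > 1"
proof -
  define f where "f n s = orb (c s) (2 * r n + Suc i)" for n s
  obtain \<rho> C where \<rho>: "\<rho> > 0" "ball t \<rho> \<subseteq> D"
    and infty: "\<And>e. e > 0 \<Longrightarrow> \<forall>\<^sub>F n in sequentially. \<forall>s\<in>ball t \<rho>. f n s \<noteq> 0 \<and> cmod (1 / f n s) < e"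
    and EC: "\<forall>\<^sub>F n in sequentially. \<forall>s\<in>ball t \<rho>. cmod (E (f n s)) \<le> C * cmod (f n s)"
    using local_bounds[OF i t ch inf] unfolding f_def by blast
  obtain t0 where t0: "t0 \<in> T" "t0 \<in> ball t \<rho>" using T_closure_meets[OF t(2) \<rho>(1)] by blast
  have O: "c t0 \<in> \<Omega>" using T_\<Omega> t0 by blast
  obtain \<beta> where \<beta>: "\<beta> < pi / 2" "\<forall>\<^sub>F n in sequentially. \<bar>Arg (f n t0 ^ m)\<bar> \<le> \<beta>"
  proof -
    have r': "filterlim r at_top sequentially" "filterlim (\<lambda>n. r n + 1) at_top sequentially"
      using r by (auto intro!: filterlim_subseq simp: strict_mono_def)
    \<comment> \<open>Time 2 r n + 1 on the orbit of c t0 is the even time 2 r n on the orbit of its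
      image, and 2 r n + 2 is twice r n + 1; the argument bound is known at even times.\<close>
    consider "i = 0" | "i = 1" using i by linarith
    then show ?thesis
    proof cases
      case 1
      obtain \<beta> where b: "\<beta> < pi / 2" "\<forall>\<^sub>F n in sequentially. \<bar>Arg (orb (F (c t0)) (2 * n) ^ m)\<bar> \<le> \<beta>"
        using eventually_Arg_orb_bounded[OF F_in_\<Omega>[OF O]] by blast
      show ?thesis
        by (rule that[OF b(1)])
          (use eventually_compose_filterlim[OF b(2) r'(1)] in \<open>simp add: f_def 1 orb_F\<close>)
    next
      case 2
      obtain \<beta> where b: "\<beta> < pi / 2" "\<forall>\<^sub>F n in sequentially. \<bar>Arg (orb (c t0) (2 * n) ^ m)\<bar> \<le> \<beta>"
        using eventually_Arg_orb_bounded[OF O] by blast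
      show ?thesis
        by (rule that[OF b(1)])
          (use eventually_compose_filterlim[OF b(2) r'(2)] in \<open>simp add: f_def 2\<close>)
    qed
  qed
  have "\<exists>\<beta>'<pi / 2. \<forall>\<^sub>F n in sequentially. \<bar>Arg (f n t ^ m)\<bar> < \<beta>'"
  proof (rule eventually_Arg_power_bounded[OF m_ge_2 open_ball connected_ball t0(2) _ _ infty _ \<beta>(2,1)])
    show "f n holomorphic_on ball t \<rho>" for n
      unfolding f_def by (rule holomorphic_on_subset[OF holomorphic_orb \<rho>(2)])
    show "\<forall>\<^sub>F n in sequentially. \<forall>s\<in>ball t \<rho>. cmod (exp (- (f n s ^ m))) \<le> C * cmod (f n s)"
      using EC by (simp add: E_def)
  qed (use \<rho> in auto)
  then obtain \<beta>' where \<beta>': "\<beta>' < pi / 2" "\<forall>\<^sub>F n in sequentially. \<bar>Arg (f n t ^ m)\<bar> < \<beta>'" by blast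
  define s where "s = sin ((pi / 2 - \<bar>\<beta>'\<bar>) / m)"
  have ab: "\<forall>\<^sub>F n in sequentially. 0 \<le> \<beta>'" using \<beta>'(2) by eventually_elim linarith
  then have \<beta>0: "0 \<le> \<beta>'" by simp
  have "x / 2 - \<beta>' < x" if "0 < x" for x :: real using that \<beta>0 by linarith
  then have "pi / 2 - \<beta>' < pi" by simp
  moreover have "(pi / 2 - \<beta>') / m \<le> (pi / 2 - \<beta>') / 1" using \<beta>'(1) m_pos by (intro divide_left_mono) auto
  ultimately have "(pi / 2 - \<beta>') / m < pi" by simp
  then have s: "sin ((pi / 2 - \<beta>') / m) > 0" using \<beta>'(1) m_pos by (intro sin_gt_zero) auto
  have "\<forall>\<^sub>F n in sequentially. \<forall>u\<in>ball t \<rho>. f n u \<noteq> 0 \<and> cmod (1 / f n u) < sin ((pi / 2 - \<beta>') / m)"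
    by (rule infty[OF s])
  with \<beta>'(2) have "\<forall>\<^sub>F n in sequentially. \<exists>l. dep l (f n t) > 1"
  proof eventually_elim
    case (elim n)
    have n: "f n t \<noteq> 0" "cmod (1 / f n t) < sin ((pi / 2 - \<beta>') / m)" using elim(2) \<rho>(1) by auto
    obtain l where l: "dep l (f n t) \<ge> cmod (f n t) * sin ((pi / 2 - \<beta>') / m)"
      using dep_ge_of_Arg_power[OF n(1) elim(1) \<beta>'(1)] by blast
    have "1 < cmod (f n t) * sin ((pi / 2 - \<beta>') / m)" using n by (simp add: norm_divide field_simps)
    then show ?case using l by (intro exI[of _ l]) linarith
  qed
  then show ?thesis unfolding f_def .
qed

lemma g_in_line_at_infinity:
  "s \<in> T \<Longrightarrow> g 0 s \<in> line_at_infinity" "s \<in> T \<Longrightarrow> g 1 s \<in> line_at_infinity"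
  using g_on_T H_in_line_at_infinity T_\<Omega> F_in_\<Omega> by auto

lemma g2_eq_g0: "t \<in> D \<Longrightarrow> t \<in> closure T \<Longrightarrow> g 2 t = g 0 t"
  by (rule continuous_on_agree_closure[OF cont cont open_D, of 2 0 t T]) (auto simp: g_on_T)

lemma g0_in_line_at_infinity: "t \<in> D \<Longrightarrow> t \<in> closure T \<Longrightarrow> g 0 t \<in> line_at_infinity"
  by (rule continuous_on_closed_closure[OF cont open_D _ _ closed_line_at_infinity, of 0 t T])
    (auto simp: g_in_line_at_infinity)

lemma H_charts:
  assumes "p \<in> \<Omega>"
  shows "affine_coords 2 (H p) $ 3 = snd (\<phi> p) / fst (\<phi> p)" "affine_coords 3 (H p) $ 2 = fst (\<phi> p) / snd (\<phi> p)"
proof -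
  have "vector [0, fst (\<phi> p), snd (\<phi> p)] \<noteq> (0 :: complex^3)" using \<phi>_nonzero[OF assms] by (simp add: vector_eq_0_iff)
  then show "affine_coords 2 (H p) $ 3 = snd (\<phi> p) / fst (\<phi> p)" "affine_coords 3 (H p) $ 2 = fst (\<phi> p) / snd (\<phi> p)"
    by (simp_all add: H_def affine_coords_abs)
qed

text \<open>On T this is the action of L on slopes, [x : y] to [a y : x]. Continuity extends it to
  the closure; x \<noteq> 0 keeps a neighbourhood of t in chart 2, where the slope can be written as
  a continuous function.\<close>

lemma g1_eq:
  assumes t: "t \<in> D" "t \<in> closure T" and g0: "g 0 t = abs_cp2 (vector [0, x, y])" and x: "x \<noteq> 0"
  shows "g 1 t = abs_cp2 (vector [0, a * y, x])"
proof -
  define N where "N = D \<inter> g 0 -` {z. in_chart 2 z}"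
  have oN: "open N" unfolding N_def by (intro continuous_open_preimage cont open_D open_in_chart) simp
  have nz: "vector [0, x, y] \<noteq> (0 :: complex^3)" using x by (simp add: vector_eq_0_iff)
  have tN: "t \<in> N" using t g0 x nz by (simp add: N_def in_chart_abs)
  have nz1: "vector [0, z, 1] \<noteq> (0 :: complex^3)" for z by (simp add: vector_eq_0_iff)
  have cN: "continuous_on N (g 0)" "continuous_on N (g 1)"
    by (rule continuous_on_subset[OF cont]; auto simp: N_def)+
  have c0: "continuous_on N (\<lambda>s. a * affine_coords 2 (g 0 s) $ 3)"
    by (intro continuous_intros continuous_on_compose2[OF continuous_on_affine_coords cN(1)]) (auto simp: N_def)
  have "continuous_on N (\<lambda>s. abs_cp2 (vector [0, a * affine_coords 2 (g 0 s) $ 3, 1]))"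
    by (rule continuous_on_compose2[OF continuous_on_abs_cp2 continuous_on_vector3[OF continuous_on_const c0 continuous_on_const]])
      (use nz1 in auto)
  then have "g 1 t = abs_cp2 (vector [0, a * affine_coords 2 (g 0 t) $ 3, 1])"
  proof (rule continuous_on_agree_closure[OF cN(2) _ oN tN t(2)])
    fix s assume s: "s \<in> T" "s \<in> N"
    have O: "c s \<in> \<Omega>" using s T_\<Omega> by blast
    show "g 1 s = abs_cp2 (vector [0, a * affine_coords 2 (g 0 s) $ 3, 1])"
      unfolding g_on_T[OF s(1)] H_F[OF O] H_charts[OF O]
      by (rule abs_cp2_eqI[where c = "1 / fst (\<phi> (c s))"])
        (use \<phi>_nonzero[OF O] nz1 in \<open>auto simp: vector_eq_0_iff vec_eq_iff forall_3\<close>)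
  qed
  also have "affine_coords 2 (g 0 t) $ 3 = y / x" using nz by (simp add: g0 affine_coords_abs)
  also have "abs_cp2 (vector [0, a * (y / x), 1]) = abs_cp2 (vector [0, a * y, x])"
    by (rule abs_cp2_eqI[where c = x]) (use x nz1 in \<open>auto simp: vector_eq_0_iff vec_eq_iff forall_3\<close>)
  finally show ?thesis .
qed

text \<open>When neither coordinate vanishes, the limits at all three times lie in both charts 2 and
  3. Hence two consecutive coordinates of the orbit are eventually deep, and t belongs to some
  basin; it is the given one because that basin is open and T accumulates at t.\<close>

lemma closure_generic_point:
  assumes t: "t \<in> D" "t \<in> closure T" and g0: "g 0 t = abs_cp2 (vector [0, x, y])" and xy: "x \<noteq> 0" "y \<noteq> 0"
  shows "t \<in> T"
proof -
  have nz: "vector [0, x, y] \<noteq> (0 :: complex^3)" "vector [0, a * y, x] \<noteq> (0 :: complex^3)" using xy by (auto simp: vector_eq_0_iff)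
  have g1: "g 1 t = abs_cp2 (vector [0, a * y, x])" by (rule g1_eq[OF t g0 xy(1)])
  have g2: "g 2 t = abs_cp2 (vector [0, x, y])" using g2_eq_g0[OF t] g0 by simp
  have "\<forall>\<^sub>F n in sequentially. \<exists>l. dep l (orb (c t) (2 * r n + Suc 0)) > 1"
    by (rule eventually_dep_orb[OF _ t]) (use nz xy g0 g1 g_in_line_at_infinity in \<open>auto simp: in_chart_abs\<close>)
  moreover have "\<forall>\<^sub>F n in sequentially. \<exists>l. dep l (orb (c t) (2 * r n + Suc 1)) > 1"
    by (rule eventually_dep_orb[OF _ t]) (use nz xy g1 g2 g_in_line_at_infinity in \<open>auto simp: in_chart_abs numeral_2_eq_2\<close>)
  ultimately have "\<forall>\<^sub>F n in sequentially. \<exists>l l'. (orb (c t) (2 * r n + Suc 1), orb (c t) (2 * r n + Suc 0)) \<in> W 1 l' l"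
    by eventually_elim (auto simp only: W_def mem_Collect_eq fst_conv snd_conv)
  moreover have "(F ^^ (2 * r n + 1)) (c t) = (orb (c t) (2 * r n + Suc 1), orb (c t) (2 * r n + Suc 0))" for n
    using funpow_F[of "2 * r n + 1" "c t"] by simp
  ultimately have "\<forall>\<^sub>F n in sequentially. \<exists>l l'. (F ^^ (2 * r n + 1)) (c t) \<in> W 1 l' l"
    by (simp only:)
  then obtain n l l' where "(F ^^ (2 * r n + 1)) (c t) \<in> W 1 l' l" by (auto simp: eventually_sequentially)
  then obtain j' k' where A': "c t \<in> A j' k'" using funpow_in_W_imp_in_A by blast
  have "open (D \<inter> c -` A j' k')" by (intro continuous_open_preimage continuous_on_c open_D open_A)
  moreover have "t \<in> D \<inter> c -` A j' k'" using A' t by simp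
  ultimately obtain \<rho> where "\<rho> > 0" "ball t \<rho> \<subseteq> D \<inter> c -` A j' k'" using open_contains_ball by blast
  then obtain s where "s \<in> T" "c s \<in> A j' k'" using T_closure_meets[OF t(2)] by blast
  then have "A j k = A j' k'" using A_unique[OF T_A] A_cong by blast
  then show ?thesis using A' t(1) by (simp add: T_def)
qed

text \<open>It remains to exclude limiting slopes 0 and infinity. In a suitable chart the slope is
  then a holomorphic function vanishing at t; near t its other closure points are generic and lie in
  T, and on T its values stay in a rotated half plane, which
  \<open>no_isolated_zero_in_closure\<close> forbids.\<close>

lemma closed_in_D:
  assumes t: "t \<in> D" "t \<in> closure T"
  shows "t \<in> T"
proof -
  have nz: "vector [0, x, y] \<noteq> (0 :: complex^3) \<longleftrightarrow> x \<noteq> 0 \<or> y \<noteq> 0" for x y by (auto simp: vector_eq_0_iff)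
  obtain x y where xy: "x \<noteq> 0 \<or> y \<noteq> 0" "g 0 t = abs_cp2 (vector [0, x, y])"
    using g0_in_line_at_infinity[OF t] line_at_infinity_cases by blast
  have quot: "depth (2 * \<gamma>) (fst (\<phi> (c s)) / snd (\<phi> (c s)) * \<omega> (k - j)) > 0"
    "depth (2 * \<gamma>) (snd (\<phi> (c s)) / fst (\<phi> (c s)) * \<omega> (j - k)) > 0" if "s \<in> T" for s
  proof -
    define u where "u = fst (\<phi> (c s))"
    define v where "v = snd (\<phi> (c s))"
    have uv: "depth \<gamma> (u * \<omega> (- j)) > 0" "depth \<gamma> (v * \<omega> (- k)) > 0"
      using \<phi>_in_W0[OF T_A[OF that]] by (auto simp: W_def dep_def u_def v_def)
    have "u / v * \<omega> (k - j) = (u * \<omega> (- j)) / (v * \<omega> (- k))" "v / u * \<omega> (j - k) = (v * \<omega> (- k)) / (u * \<omega> (- j))"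
    proof -
      have "\<omega> (k - j) * \<omega> (- k) = \<omega> (- j)" "\<omega> (j - k) * \<omega> (- j) = \<omega> (- k)" by (simp_all flip: \<omega>_add)
      then have "\<omega> (k - j) = \<omega> (- j) / \<omega> (- k)" "\<omega> (j - k) = \<omega> (- k) / \<omega> (- j)" by (simp_all add: field_simps)
      then show "u / v * \<omega> (k - j) = (u * \<omega> (- j)) / (v * \<omega> (- k))" "v / u * \<omega> (j - k) = (v * \<omega> (- k)) / (u * \<omega> (- j))"
        by simp_all
    qed
    then show "depth (2 * \<gamma>) (fst (\<phi> (c s)) / snd (\<phi> (c s)) * \<omega> (k - j)) > 0"
      "depth (2 * \<gamma>) (snd (\<phi> (c s)) / fst (\<phi> (c s)) * \<omega> (j - k)) > 0"
      using Arg_divide_sector[OF uv] Arg_divide_sector[OF uv(2,1)] by (simp_all add: u_def v_def)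
  qed
  have Re: "Re z > 0" if "depth (2 * \<gamma>) z > 0" for z
    using that depth_pos_iff[OF two_\<gamma>_bounds] Re_pos_iff_Arg two_\<gamma>_bounds by force
  \<comment> \<open>One argument serves both slopes: i is the chart, q the coordinate holding the
    slope, and \<kappa> rotates the sector of slopes around the positive axis. Its half-opening
    2\<gamma> is at most \<pi>/2, so it lies in the right half plane.\<close>
  have loc: False if ch: "in_chart i (g 0 t)" and zero: "affine_coords i (g 0 t) $ q = 0"
    and iq: "(i = 2 \<and> q = 3 \<and> \<kappa> = \<omega> (j - k)) \<or> (i = 3 \<and> q = 2 \<and> \<kappa> = \<omega> (k - j))" for i q \<kappa>
  proof -
    have "open (D \<inter> g 0 -` {z. in_chart i z})" by (intro continuous_open_preimage cont open_D open_in_chart) simp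
    moreover have "t \<in> D \<inter> g 0 -` {z. in_chart i z}" using t ch by simp
    ultimately obtain \<rho> where \<rho>: "\<rho> > 0" "cball t \<rho> \<subseteq> D \<inter> g 0 -` {z. in_chart i z}"
      using open_contains_cball by blast
    define K where "K = cball t \<rho>"
    have K: "compact K" "K \<subseteq> D" "\<And>s. s \<in> K \<Longrightarrow> in_chart i (g 0 s)" "ball t \<rho> \<subseteq> K" using \<rho> by (auto simp: K_def)
    have cK: "continuous_on K (g 0)" using continuous_on_subset[OF cont K(2)] by simp
    have lim0: "uniform_limit K (\<lambda>n s. embed_cp2 (orb (c s) (Suc (2 * r n)), orb (c s) (2 * r n))) (g 0) sequentially"
      using lim[of 0, OF _ K(1,2)] by (simp add: funpow_F)
    define u where "u s = affine_coords i (g 0 s) $ q" for s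
    have ev: "\<forall>\<^sub>F n in sequentially. \<forall>s\<in>K. in_chart i (embed_cp2 (orb (c s) (Suc (2 * r n)), orb (c s) (2 * r n)))"
      by (rule uniform_limit_affine_coords(2)[OF lim0 K(1) cK K(3)])
    have "u holomorphic_on ball t \<rho>"
    proof (rule holomorphic_uniform_limit[of t \<rho>
        "\<lambda>n s. affine_coords i (embed_cp2 (orb (c s) (Suc (2 * r n)), orb (c s) (2 * r n))) $ q" sequentially u])
      show "uniform_limit (cball t \<rho>) (\<lambda>n s. affine_coords i (embed_cp2 (orb (c s) (Suc (2 * r n)), orb (c s) (2 * r n))) $ q) u sequentially"
        using uniform_limit_affine_coords(1)[OF lim0 K(1) cK K(3), of q] by (simp add: K_def u_def[abs_def])
      show "\<forall>\<^sub>F n in sequentially. continuous_on (cball t \<rho>) (\<lambda>s. affine_coords i (embed_cp2 (orb (c s) (Suc (2 * r n)), orb (c s) (2 * r n))) $ q) \<and>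
          (\<lambda>s. affine_coords i (embed_cp2 (orb (c s) (Suc (2 * r n)), orb (c s) (2 * r n))) $ q) holomorphic_on ball t \<rho>"
        using ev
      proof eventually_elim
        case (elim n)
        have "(\<lambda>s. affine_coords i (embed_cp2 (orb (c s) (Suc (2 * r n)), orb (c s) (2 * r n))) $ q) holomorphic_on K"
          using iq elim by (auto simp: embed_cp2_chart2 embed_cp2_chart3
              intro!: holomorphic_intros holomorphic_on_subset[OF holomorphic_orb K(2)])
        then show ?case
          using holomorphic_on_imp_continuous_on holomorphic_on_subset K(4) unfolding K_def by blast
      qed
    qed simp_all
    moreover have "u t = 0" using zero by (simp add: u_def)
    ultimately show False
    proof (rule no_isolated_zero_in_closure[OF _ _ \<rho>(1) open_T t(2), where \<kappa> = \<kappa>])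
      fix s assume s: "s \<in> T" "s \<in> ball t \<rho>"
      have "depth (2 * \<gamma>) (u s * \<kappa>) > 0"
        using iq quot[OF s(1)] by (auto simp: u_def g_on_T[OF s(1)] H_charts[OF T_\<Omega>[OF s(1)]])
      then show "Re (\<kappa> * u s) > 0" using Re by (simp only: mult.commute)
    next
      fix s assume s: "s \<in> closure T" "s \<in> ball t \<rho>" "u s \<noteq> 0"
      have sK: "s \<in> K" "s \<in> D" using s K by auto
      obtain x' y' where x': "x' \<noteq> 0 \<or> y' \<noteq> 0" "g 0 s = abs_cp2 (vector [0, x', y'])"
        using g0_in_line_at_infinity[OF sK(2) s(1)] line_at_infinity_cases by blast
      have nz': "vector [0, x', y'] \<noteq> (0 :: complex^3)" using x'(1) nz by blast
      have "x' \<noteq> 0" "y' \<noteq> 0"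
        using iq K(3)[OF sK(1)] s(3) nz' by (auto simp: u_def x'(2) in_chart_abs affine_coords_abs)
      then show "s \<in> T" by (rule closure_generic_point[OF sK(2) s(1) x'(2)])
    qed
  qed
  have nz': "vector [0, x, y] \<noteq> (0 :: complex^3)" using xy(1) nz by blast
  have "x \<noteq> 0"
  proof
    assume "x = 0"
    then show False using loc[of 3 2 "\<omega> (k - j)"] xy nz' by (simp add: in_chart_abs affine_coords_abs)
  qed
  moreover have "y \<noteq> 0"
  proof
    assume "y = 0"
    then show False using loc[of 2 3 "\<omega> (j - k)"] xy nz' by (simp add: in_chart_abs affine_coords_abs)
  qed
  ultimately show ?thesis by (rule closure_generic_point[OF t xy(2)])
qed

end

section \<open>From complex lines to whole Fatou components\<close>

context transcendental_henon
begin

text \<open>Normality is used three times, for shifts 0, 1 and 2 of the already thinned even times.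
  Even times are prescribed so that on the basin each of the three limits is a known limit
  function.\<close>

lemma normal_family_even_subsequence:
  assumes "normal_family U (range (\<lambda>n. F ^^ n))"
  obtains r h0 h1 h2 where "strict_mono r"
    "\<And>h. h \<in> {h0, h1, h2} \<Longrightarrow> continuous_on U h"
    "\<And>K. compact K \<Longrightarrow> K \<subseteq> U \<Longrightarrow> uniform_limit K (\<lambda>n p. embed_cp2 ((F ^^ (2 * r n)) p)) h0 sequentially"
    "\<And>K. compact K \<Longrightarrow> K \<subseteq> U \<Longrightarrow> uniform_limit K (\<lambda>n p. embed_cp2 ((F ^^ (2 * r n + 1)) p)) h1 sequentially"
    "\<And>K. compact K \<Longrightarrow> K \<subseteq> U \<Longrightarrow> uniform_limit K (\<lambda>n p. embed_cp2 ((F ^^ (2 * r n + 2)) p)) h2 sequentially"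
proof -
  have norm: "\<exists>r h. strict_mono r \<and> continuous_on U h \<and>
      (\<forall>K. compact K \<and> K \<subseteq> U \<longrightarrow> uniform_limit K (\<lambda>n p. embed_cp2 ((F ^^ s (r n)) p)) h sequentially)" for s :: "nat \<Rightarrow> nat"
  proof -
    have "range (\<lambda>n. F ^^ s n) \<subseteq> range (\<lambda>n. F ^^ n)" by blast
    then obtain r h where "strict_mono r" "holomorphic_into_cp2 U h" "uniform_limit_on_compacts U ((\<lambda>n. F ^^ s n) \<circ> r) h"
      using assms unfolding normal_family_def by meson
    then show ?thesis unfolding holomorphic_into_cp2_def uniform_limit_on_compacts_def comp_def by blast
  qed
  obtain r0 h0 where r0: "strict_mono r0" "continuous_on U h0"
    "\<And>K. compact K \<Longrightarrow> K \<subseteq> U \<Longrightarrow> uniform_limit K (\<lambda>n p. embed_cp2 ((F ^^ (2 * r0 n)) p)) h0 sequentially"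
    using norm[of "\<lambda>n. 2 * n"] by blast
  obtain r1 h1 where r1: "strict_mono r1" "continuous_on U h1"
    "\<And>K. compact K \<Longrightarrow> K \<subseteq> U \<Longrightarrow> uniform_limit K (\<lambda>n p. embed_cp2 ((F ^^ (2 * r0 (r1 n) + 1)) p)) h1 sequentially"
    using norm[of "\<lambda>n. 2 * r0 n + 1"] by blast
  obtain r2 h2 where r2: "strict_mono r2" "continuous_on U h2"
    "\<And>K. compact K \<Longrightarrow> K \<subseteq> U \<Longrightarrow> uniform_limit K (\<lambda>n p. embed_cp2 ((F ^^ (2 * r0 (r1 (r2 n)) + 2)) p)) h2 sequentially"
    using norm[of "\<lambda>n. 2 * r0 (r1 n) + 2"] by blast
  have r12: "strict_mono (\<lambda>n. r1 (r2 n))" using r1(1) r2(1) by (simp add: strict_mono_def)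
  show ?thesis
  proof (rule that[of "\<lambda>n. r0 (r1 (r2 n))" h0 h1 h2])
    show "strict_mono (\<lambda>n. r0 (r1 (r2 n)))" using r0(1) r12 by (simp add: strict_mono_def)
    show "continuous_on U h" if "h \<in> {h0, h1, h2}" for h using that r0 r1 r2 by blast
    show "uniform_limit K (\<lambda>n p. embed_cp2 ((F ^^ (2 * r0 (r1 (r2 n)))) p)) h0 sequentially" if "compact K" "K \<subseteq> U" for K
      by (rule filterlim_compose[OF r0(3)[OF that] filterlim_subseq[OF r12]])
    show "uniform_limit K (\<lambda>n p. embed_cp2 ((F ^^ (2 * r0 (r1 (r2 n)) + 1)) p)) h1 sequentially" if "compact K" "K \<subseteq> U" for K
      by (rule filterlim_compose[OF r1(3)[OF that] filterlim_subseq[OF r2(1)]])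
    show "uniform_limit K (\<lambda>n p. embed_cp2 ((F ^^ (2 * r0 (r1 (r2 n)) + 2)) p)) h2 sequentially" if "compact K" "K \<subseteq> U" for K
      by (rule r2(3)[OF that])
  qed
qed

lemma A_closed_in_Fatou_set:
  assumes "p \<in> Fatou_set F" "p \<in> closure (A j k)"
  shows "p \<in> A j k"
proof (rule ccontr)
  assume pA: "p \<notin> A j k"
  obtain U where U: "open U" "p \<in> U" "normal_family U (range (\<lambda>n. F ^^ n))" using assms(1) by (auto simp: Fatou_set_def)
  obtain \<rho> where \<rho>: "\<rho> > 0" "ball p \<rho> \<subseteq> U" using U open_contains_ball by blast
  obtain q where q: "q \<in> A j k" "dist q p < \<rho>" using assms(2) \<rho>(1) by (auto simp: closure_approachable)
  have qp: "q \<noteq> p" using q pA by blast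
  define v where "v = q - p"
  have v: "norm v > 0" "norm v < \<rho>" using q qp by (auto simp: v_def dist_norm)
  \<comment> \<open>The line has c 0 = p and c 1 = q. As norm v < \<rho>, the disc of radius \<rho>
    / norm v contains both parameters, and its image stays in the ball.\<close>
  define c where "c t = (fst p + t * fst v, snd p + t * snd v)" for t :: complex
  define D where "D = ball (0 :: complex) (\<rho> / norm v)"
  have cD: "c t \<in> U" if "t \<in> D" for t
  proof -
    have "c t - p = (t * fst v, t * snd v)" by (simp add: c_def prod_eq_iff)
    then have "norm (c t - p) = cmod t * norm v"
      by (simp add: norm_prod_def norm_mult power_mult_distrib real_sqrt_mult flip: distrib_left)
    also have "\<dots> < \<rho>" using that v by (simp add: D_def field_simps)
    finally show ?thesis using \<rho>(2) by (auto simp: dist_norm norm_minus_commute)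
  qed
  have cont_c: "continuous_on K c" for K unfolding c_def by (intro continuous_intros)
  obtain r h0 h1 h2 where r: "strict_mono r" and
    ch: "\<And>h. h \<in> {h0, h1, h2} \<Longrightarrow> continuous_on U h" and
    lim: "\<And>K. compact K \<Longrightarrow> K \<subseteq> U \<Longrightarrow> uniform_limit K (\<lambda>n p. embed_cp2 ((F ^^ (2 * r n)) p)) h0 sequentially"
    "\<And>K. compact K \<Longrightarrow> K \<subseteq> U \<Longrightarrow> uniform_limit K (\<lambda>n p. embed_cp2 ((F ^^ (2 * r n + 1)) p)) h1 sequentially"
    "\<And>K. compact K \<Longrightarrow> K \<subseteq> U \<Longrightarrow> uniform_limit K (\<lambda>n p. embed_cp2 ((F ^^ (2 * r n + 2)) p)) h2 sequentially"
    by (rule normal_family_even_subsequence[OF U(3)]) blast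
  define g where "g i t = (if i = 0 then h0 (c t) else if i = 1 then h1 (c t) else h2 (c t))" for i :: nat and t
  interpret S: transcendental_henon_slice m \<delta> c D r g j k
  proof
    show "open D" by (simp add: D_def)
    show "(\<lambda>t. fst (c t)) holomorphic_on D" "(\<lambda>t. snd (c t)) holomorphic_on D"
      unfolding c_def fst_conv snd_conv by (intro holomorphic_intros)+
    show "strict_mono r" by (rule r)
    fix i :: nat assume "i \<le> 2"
    then consider "i = 0" | "i = 1" | "i = 2" by linarith
    note i = this
    have "c ` D \<subseteq> U" using cD by blast
    then have cc: "continuous_on D (\<lambda>t. h (c t))" if "h \<in> {h0, h1, h2}" for h
      by (rule continuous_on_compose2[OF ch[OF that] cont_c])
    show "continuous_on D (g i)"
      using i cc by cases (simp_all add: g_def)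
    fix K assume K: "compact K" "K \<subseteq> D"
    have cK: "compact (c ` K)" "c ` K \<subseteq> U" using K cD cont_c by (auto intro: compact_continuous_image)
    show "uniform_limit K (\<lambda>n t. embed_cp2 ((F ^^ (2 * r n + i)) (c t))) (g i) sequentially"
      using i
    proof cases
      case 1 then show ?thesis using lim(1)[OF cK] by (simp add: uniform_limit_iff g_def)
    next
      case 2 then show ?thesis using lim(2)[OF cK] by (simp add: uniform_limit_iff g_def)
    next
      case 3 then show ?thesis using lim(3)[OF cK] by (simp add: uniform_limit_iff g_def)
    qed
  qed
  have "c 1 = q" by (simp add: c_def v_def prod_eq_iff)
  moreover have "1 \<in> D" using v by (simp add: D_def)
  ultimately have "1 \<in> D \<inter> S.T" using q(1) by (simp add: S.T_def)
  then have meet: "D \<inter> S.T \<noteq> {}" by blast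
  have "connected D" by (simp add: D_def)
  then have "D \<subseteq> S.T"
    by (rule connected_subset_of_clopen[OF _ S.open_T meet S.closed_in_D])
  moreover have "0 \<in> D" using v \<rho> by (simp add: D_def)
  ultimately have "c 0 \<in> A j k" by (auto simp: S.T_def)
  then show False using pA by (simp add: c_def)
qed

text \<open>A basin is open, and closed relative to the Fatou set, so no connected subset of the
  Fatou set can extend it.\<close>

lemma A_in_Fatou_components: "A j k \<in> Fatou_components F"
  unfolding Fatou_components_def in_components_maximal
proof (intro conjI allI impI)
  show "A j k \<noteq> {}" by (rule A_nonempty)
  show sub: "A j k \<subseteq> Fatou_set F" using A_subset_\<Omega> \<Omega>_subset_Fatou_set by blast
  show "connected (A j k)" by (rule connected_A)
  fix d assume d: "d \<noteq> {} \<and> A j k \<subseteq> d \<and> d \<subseteq> Fatou_set F \<and> connected d"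
  then have "connected d" "d \<inter> A j k \<noteq> {}" using A_nonempty[of j k] by blast+
  then have "d \<subseteq> A j k"
    by (rule connected_subset_of_clopen[OF _ open_A]) (use d A_closed_in_Fatou_set in blast)
  then show "d = A j k" using d by blast
qed

end

section \<open>Cycles\<close>

lemma dvd_mod_minus: "(n :: int) dvd x mod n - x"
  by (subst dvd_diff_commute) (rule dvd_minus_mod)

lemma is_cycle_range:
  assumes p: "p > 0" and V: "\<And>i. V i \<in> Fatou_components F" "\<And>i. F ` V i = V (Suc i)"
    and per: "V p = V 0" and inj: "inj_on V {..<p}"
  shows "is_cycle F p (range V)"
proof -
  have step: "V (i + p) = V i" for i
    by (induction i) (simp_all add: per flip: V(2))
  have "V (i mod p) = V i" for i
  proof (induction i rule: less_induct)
    case (less i)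
    show ?case
    proof (cases "i < p")
      case False
      then have "V (i mod p) = V ((i - p) mod p)" by (simp add: le_mod_geq)
      also have "\<dots> = V (i - p)" using less False p by simp
      also have "\<dots> = V i" using step[of "i - p"] False by simp
      finally show ?thesis .
    qed simp
  qed
  then have V_mod: "V i = V (i mod p)" for i by simp
  have "range V = V ` {..<p}"
  proof
    show "range V \<subseteq> V ` {..<p}"
    proof
      fix X assume "X \<in> range V"
      then obtain i where "X = V i" by blast
      then have "X = V (i mod p)" using V_mod by simp
      then show "X \<in> V ` {..<p}" using p by simp
    qed
  qed blast
  moreover have "\<forall>i<p. V i \<in> Fatou_components F \<and> F ` V i = V (Suc i mod p)"
    using V(1) trans[OF V(2) V_mod] by blast
  ultimately have "inj_on V {..<p} \<and> range V = V ` {..<p} \<and>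
      (\<forall>i<p. V i \<in> Fatou_components F \<and> F ` V i = V (Suc i mod p))"
    using inj by (intro conjI)
  then have "\<exists>V'. inj_on V' {..<p} \<and> range V = V' ` {..<p} \<and>
      (\<forall>i<p. V' i \<in> Fatou_components F \<and> F ` V' i = V' (Suc i mod p))"
    by (rule exI[of _ V])
  with p show ?thesis unfolding is_cycle_def by (rule conjI)
qed

lemma card_is_cycle: "is_cycle F p \<C> \<Longrightarrow> card \<C> = p"
proof -
  assume "is_cycle F p \<C>"
  then obtain V where "inj_on V {..<p}" "\<C> = V ` {..<p}" unfolding is_cycle_def by blast
  then show ?thesis by (simp add: card_image)
qed

context transcendental_henon
begin

text \<open>The i-th image of \<open>A d 0\<close> in closed form: the indices go (j, k) -> (k + 1,
  j) -> (j + 1, k + 1), so the parity of i tells whether they are exchanged.\<close>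

definition orbit_component :: "int \<Rightarrow> nat \<Rightarrow> (complex \<times> complex) set" where
  "orbit_component d i = (if even i then A (d + int (i div 2)) (int (i div 2)) else A (int (i div 2) + 1) (d + int (i div 2)))"

definition cycle :: "int \<Rightarrow> (complex \<times> complex) set set" where "cycle d = range (orbit_component d)"

text \<open>Since \<open>F\<close> maps \<open>A j k\<close> to \<open>A (k + 1) j\<close>, the difference of the indices alternates between \<open>d\<close>
  and \<open>1 - d\<close> along a cycle, so \<open>1 \<le> d \<le> (m + 1) / 2\<close> represents each cycle once.\<close>

definition cycles :: "(complex \<times> complex) set set set" where
  "cycles = cycle ` {1..(int m + 1) div 2}"

lemma F_image_orbit_component: "F ` orbit_component d i = orbit_component d (Suc i)"
proof (cases "even i")
  case True
  then show ?thesis by (simp add: orbit_component_def F_image_A)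
next
  case False
  then have "int (Suc i div 2) = int (i div 2) + 1" by (simp add: odd_Suc_div_two)
  moreover have "d + int (i div 2) + 1 = d + (int (i div 2) + 1)" by (rule add.assoc)
  ultimately show ?thesis using False by (simp only: orbit_component_def F_image_A if_False even_Suc simp_thms if_True)
qed

lemma orbit_component_eq_iff:
  "orbit_component d (2 * l) = orbit_component d' (2 * l') \<longleftrightarrow> int m dvd (d + int l) - (d' + int l') \<and> int m dvd int l - int l'"
  "orbit_component d (2 * l + 1) = orbit_component d' (2 * l' + 1) \<longleftrightarrow> int m dvd int l - int l' \<and> int m dvd (d + int l) - (d' + int l')"
  "orbit_component d (2 * l) = orbit_component d' (2 * l' + 1) \<longleftrightarrow> int m dvd (d + int l) - (int l' + 1) \<and> int m dvd int l - (d' + int l')"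
  by (simp_all add: orbit_component_def A_eq_iff)

lemma dvd_imp_zero: "int m dvd x \<Longrightarrow> \<bar>x\<bar> < int m \<Longrightarrow> x = 0"
proof (rule ccontr)
  assume h: "int m dvd x" "\<bar>x\<bar> < int m" "x \<noteq> 0"
  then show False using dvd_imp_le_int[OF h(3,1)] by simp
qed

lemma orbit_component_in_Fatou_components: "orbit_component d i \<in> Fatou_components F"
  by (simp add: orbit_component_def A_in_Fatou_components)

lemma is_cycle_cycle:
  assumes n: "0 < n" "n \<le> 2 * m" and per: "orbit_component d n = orbit_component d 0"
    and eo: "\<And>l l'. 2 * l < n \<Longrightarrow> 2 * l' + 1 < n \<Longrightarrow> orbit_component d (2 * l) \<noteq> orbit_component d (2 * l' + 1)"
  shows "is_cycle F n (cycle d)"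
  unfolding cycle_def
proof (rule is_cycle_range[OF n(1) orbit_component_in_Fatou_components F_image_orbit_component per])
  show "inj_on (orbit_component d) {..<n}"
  proof (rule inj_onI)
    fix i i' assume i: "i \<in> {..<n}" "i' \<in> {..<n}" and eq: "orbit_component d i = orbit_component d i'"
    have same: "l = l'" if "int m dvd int l - int l'" "l < m" "l' < m" for l l'
      using dvd_imp_zero[OF that(1)] that(2,3) by linarith
    consider l l' where "i = 2 * l" "i' = 2 * l'" | l l' where "i = 2 * l + 1" "i' = 2 * l' + 1"
      | l l' where "i = 2 * l" "i' = 2 * l' + 1" | l l' where "i = 2 * l + 1" "i' = 2 * l'"
      by (metis evenE oddE)
    then show "i = i'"
    proof cases
      case 1 then show ?thesis using eq i n(2) same[of l l'] orbit_component_eq_iff(1)[of d l d l'] by auto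
    next
      case 2 then show ?thesis using eq i n(2) same[of l l'] orbit_component_eq_iff(2)[of d l d l'] by auto
    next
      case 3 then show ?thesis using eq i eo[of l l'] by auto
    next
      case 4 then show ?thesis using eq i eo[of l' l] by auto
    qed
  qed
qed

lemma is_cycle_double:
  assumes "1 \<le> d" "2 * d \<le> int m"
  shows "is_cycle F (2 * m) (cycle d)"
proof (rule is_cycle_cycle)
  show "orbit_component d (2 * m) = orbit_component d 0"
    using orbit_component_eq_iff(1)[of d m d 0] by simp
  show "orbit_component d (2 * l) \<noteq> orbit_component d (2 * l' + 1)" for l l'
  proof
    assume "orbit_component d (2 * l) = orbit_component d (2 * l' + 1)"
    then have "int m dvd (d + int l) - (int l' + 1)" "int m dvd int l - (d + int l')" using orbit_component_eq_iff(3) by blast+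
    \<comment> \<open>Subtracting the congruences eliminates l and l' and leaves the difference
      between d and 1 - d, namely 2 d - 1, which lies strictly between 0 and m.\<close>
    then have "int m dvd ((d + int l) - (int l' + 1)) - (int l - (d + int l'))" by (rule dvd_diff)
    moreover have "((d + int l) - (int l' + 1)) - (int l - (d + int l')) = 2 * d - 1" by simp
    ultimately have "int m dvd 2 * d - 1" by (simp only:)
    then have "2 * d - 1 = 0" by (rule dvd_imp_zero) (use assms in linarith)
    then show False by presburger
  qed
qed (use m_ge_2 in auto)

text \<open>Here d and 1 - d agree modulo m, and the orbit closes at the odd step m: with m = 2 n +
  1 and d = n + 1, the indices (n + 1, d + n) equal (d, m), that is (d, 0) modulo m.\<close>

lemma is_cycle_single:
  assumes "2 * d = int m + 1"
  shows "is_cycle F m (cycle d)"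
proof (rule is_cycle_cycle)
  have "0 \<le> d - 1" using assms m_ge_2 by linarith
  then obtain n where "d - 1 = int n" using zero_le_imp_eq_int by blast
  then have d: "d = int n + 1" by simp
  then have n: "m = 2 * n + 1" using assms by linarith
  show "orbit_component d m = orbit_component d 0"
  proof -
    have "(d + int 0) - (int n + 1) = 0" "int 0 - (d + int n) = - int m" using d n by simp_all
    then have "int m dvd (d + int 0) - (int n + 1)" "int m dvd int 0 - (d + int n)"
      by (metis dvd_0_right, metis dvd_minus_iff dvd_refl)
    then have "orbit_component d (2 * 0) = orbit_component d (2 * n + 1)"
      using orbit_component_eq_iff(3)[of d 0 d n] by blast
    moreover have "orbit_component d m = orbit_component d (2 * n + 1)" by (rule arg_cong[OF n])
    ultimately show ?thesis by simp
  qed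
  show "orbit_component d (2 * l) \<noteq> orbit_component d (2 * l' + 1)" if "2 * l < m" "2 * l' + 1 < m" for l l'
  proof
    assume "orbit_component d (2 * l) = orbit_component d (2 * l' + 1)"
    then have "int m dvd (d + int l) - (int l' + 1)" using orbit_component_eq_iff(3) by blast
    then have "d + int l - (int l' + 1) = 0" by (rule dvd_imp_zero) (use d n that in linarith)
    then show False using d n that by linarith
  qed
qed (use m_ge_2 in auto)

lemma inj_on_cycle: "inj_on cycle {1..(int m + 1) div 2}"
proof (rule inj_onI)
  fix d d' assume d: "d \<in> {1..(int m + 1) div 2}" "d' \<in> {1..(int m + 1) div 2}" and eq: "cycle d = cycle d'"
  then have b: "1 \<le> d" "1 \<le> d'" "2 * d \<le> int m + 1" "2 * d' \<le> int m + 1" by auto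
  have "orbit_component d (2 * 0) \<in> cycle d'" using eq unfolding cycle_def by blast
  then obtain i where i: "orbit_component d (2 * 0) = orbit_component d' i" unfolding cycle_def by blast
  consider l where "i = 2 * l" | l where "i = 2 * l + 1" by (metis evenE oddE)
  then show "d = d'"
  proof cases
    case 1
    then have "int m dvd (d + int 0) - (d' + int l)" "int m dvd int 0 - int l"
      using i orbit_component_eq_iff(1)[of d 0 d' l] by auto
    then have "int m dvd ((d + int 0) - (d' + int l)) - (int 0 - int l)" by (rule dvd_diff)
    then have "int m dvd d - d'" by simp
    then have "d - d' = 0" by (rule dvd_imp_zero) (use b m_ge_2 in linarith)
    then show ?thesis by simp
  next
    case 2
    then have "int m dvd (d + int 0) - (int l + 1)" "int m dvd int 0 - (d' + int l)"
      using i orbit_component_eq_iff(3)[of d 0 d' l] by auto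
    then have "int m dvd ((d + int 0) - (int l + 1)) - (int 0 - (d' + int l))" by (rule dvd_diff)
    then have dv: "int m dvd d + d' - 1" by (simp add: algebra_simps)
    \<comment> \<open>The number d + d' - 1 lies between 1 and m, so divisibility makes it m. Since
      neither d nor d' exceeds (m + 1)/2, both equal it.\<close>
    have "int m dvd (d + d' - 1) - int m" using dvd_diff[OF dv dvd_refl] .
    moreover have "\<bar>(d + d' - 1) - int m\<bar> < int m" using b m_ge_2 by linarith
    ultimately have "(d + d' - 1) - int m = 0" by (rule dvd_imp_zero)
    then show ?thesis using b by linarith
  qed
qed

lemma A_in_cycles: "A j k \<in> \<Union>cycles"
proof -
  have m: "int m > 0" using m_pos by simp
  \<comment> \<open>The residue of j - k is taken in 1..m to match the range of d. If it exceeds (m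
    + 1)/2, its partner m + 1 - e, congruent to 1 - e, names the cycle, and the basin occurs at an
    odd position.\<close>
  define e where "e = (j - k - 1) mod int m + 1"
  have e: "1 \<le> e" "e \<le> int m" "int m dvd e - (j - k)"
  proof -
    have "0 \<le> (j - k - 1) mod int m" by (rule pos_mod_sign[OF m])
    moreover have "(j - k - 1) mod int m < int m" by (rule pos_mod_bound[OF m])
    ultimately show "1 \<le> e" "e \<le> int m" by (simp_all add: e_def)
    have "int m dvd (j - k - 1) mod int m - (j - k - 1)" by (rule dvd_mod_minus)
    then show "int m dvd e - (j - k)" by (simp add: e_def algebra_simps)
  qed
  have red: "\<exists>l :: nat. int m dvd int l - x" for x
  proof -
    have "int m dvd x mod int m - x" by (rule dvd_mod_minus)
    moreover have "int (nat (x mod int m)) = x mod int m" using pos_mod_sign[OF m, of x] by (rule int_nat_eq[THEN trans, OF if_P])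
    ultimately show ?thesis by (intro exI[of _ "nat (x mod int m)"]) simp
  qed
  show ?thesis
  proof (cases "2 * e \<le> int m + 1")
    case True
    obtain l where l: "int m dvd int l - k" using red by blast
    have "int m dvd (e - (j - k)) + (int l - k)" using e(3) l by (rule dvd_add)
    then have "int m dvd (e + int l) - j" by (simp add: algebra_simps)
    then have "orbit_component e (2 * l) = A j k" using l by (simp add: orbit_component_def A_eq_iff)
    then have "A j k \<in> cycle e" using rangeI[of "orbit_component e" "2 * l"] by (simp add: cycle_def)
    moreover have "cycle e \<in> cycles" unfolding cycles_def using e True by auto
    ultimately show ?thesis by blast
  next
    case False
    define d where "d = int m + 1 - e"
    obtain l where l: "int m dvd int l - (j - 1)" using red by blast
    have "int m dvd (int l - (j - 1)) - (e - (j - k))" using l e(3) by (rule dvd_diff)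
    then have "int m dvd ((int l - (j - 1)) - (e - (j - k))) + int m" by simp
    moreover have "((int l - (j - 1)) - (e - (j - k))) + int m = (d + int l) - k" by (simp add: d_def)
    ultimately have "int m dvd (d + int l) - k" by (simp only:)
    moreover have "int m dvd (int l + 1) - j" using l by (simp add: algebra_simps)
    ultimately have "orbit_component d (2 * l + 1) = A j k" by (simp add: orbit_component_def A_eq_iff)
    then have "A j k \<in> cycle d" using rangeI[of "orbit_component d" "2 * l + 1"] by (simp add: cycle_def)
    moreover have "cycle d \<in> cycles" unfolding cycles_def using e False by (auto simp: d_def)
    ultimately show ?thesis by blast
  qed
qed

lemma cycle_cases:
  assumes "V \<in> cycle d"
  obtains j k where "V = A j k" "j - k = d \<or> j - k = 1 - d"
proof -
  obtain i where "V = orbit_component d i" using assms unfolding cycle_def by blast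
  then show ?thesis
    using that[of "d + int (i div 2)" "int (i div 2)"] that[of "int (i div 2) + 1" "d + int (i div 2)"]
    by (cases "even i") (auto simp: orbit_component_def)
qed

lemma Union_cycles: "\<Union>cycles = {A j k | j k. True}"
proof
  show "\<Union>cycles \<subseteq> {A j k | j k. True}"
  proof
    fix V assume "V \<in> \<Union>cycles"
    then obtain d where "V \<in> cycle d" unfolding cycles_def by blast
    then show "V \<in> {A j k | j k. True}" using cycle_cases by blast
  qed
  show "{A j k | j k. True} \<subseteq> \<Union>cycles" using A_in_cycles by blast
qed

lemma card_Union_cycles: "card (\<Union>cycles) = m\<^sup>2"
proof -
  have m: "int m > 0" using m_pos by simp
  define I where "I = {0..<int m} \<times> {0..<int m}"
  have "\<Union>cycles = (\<lambda>(j, k). A j k) ` I"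
  proof
    show "\<Union>cycles \<subseteq> (\<lambda>(j, k). A j k) ` I"
    proof
      fix V assume "V \<in> \<Union>cycles"
      then obtain j k where V: "V = A j k" using Union_cycles by blast
      have "A j k = A (j mod int m) (k mod int m)" unfolding A_eq_iff by (intro conjI dvd_minus_mod)
      moreover have "(j mod int m, k mod int m) \<in> I"
        using pos_mod_sign[OF m] pos_mod_bound[OF m] by (simp add: I_def)
      ultimately show "V \<in> (\<lambda>(j, k). A j k) ` I" using V by (auto intro!: image_eqI[of _ _ "(j mod int m, k mod int m)"])
    qed
    show "(\<lambda>(j, k). A j k) ` I \<subseteq> \<Union>cycles" using A_in_cycles by (auto simp del: Union_iff)
  qed
  moreover have "inj_on (\<lambda>(j, k). A j k) I"
  proof (rule inj_onI, clarify)
    fix j k j' k' assume "(j, k) \<in> I" "(j', k') \<in> I" "A j k = A j' k'"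
    then have "int m dvd j - j'" "int m dvd k - k'" "\<bar>j - j'\<bar> < int m" "\<bar>k - k'\<bar> < int m"
      by (auto simp: I_def A_eq_iff)
    then show "j = j' \<and> k = k'" using dvd_imp_zero[of "j - j'"] dvd_imp_zero[of "k - k'"] by simp
  qed
  ultimately have "card (\<Union>cycles) = card I" by (simp add: card_image)
  then show ?thesis by (simp add: I_def card_cartesian_product power2_eq_square)
qed

lemma cycle_period:
  assumes "d \<in> {1..(int m + 1) div 2}"
  shows "is_cycle F (2 * m) (cycle d) \<longleftrightarrow> 2 * d \<le> int m" "is_cycle F m (cycle d) \<longleftrightarrow> 2 * d = int m + 1"
proof -
  have d: "1 \<le> d" "2 * d \<le> int m + 1" using assms by auto
  \<comment> \<open>A cycle of period p has p elements, so the two periods exclude each other; this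
    turns the two implications already shown into equivalences.\<close>
  have ne: "\<not> (is_cycle F (2 * m) (cycle d) \<and> is_cycle F m (cycle d))"
  proof (intro notI, elim conjE)
    assume "is_cycle F (2 * m) (cycle d)" "is_cycle F m (cycle d)"
    then have "2 * m = m" using card_is_cycle[of F "2 * m" "cycle d"] card_is_cycle[of F m "cycle d"] by simp
    then show False using m_ge_2 by simp
  qed
  consider "2 * d \<le> int m" | "2 * d = int m + 1" using d(2) by linarith
  then show "is_cycle F (2 * m) (cycle d) \<longleftrightarrow> 2 * d \<le> int m" "is_cycle F m (cycle d) \<longleftrightarrow> 2 * d = int m + 1"
    using is_cycle_double[OF d(1)] is_cycle_single ne by (cases; auto)+
qed

lemma limit_functions_of_cycle:
  assumes d: "d \<in> {1..(int m + 1) div 2}"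
  defines "U \<equiv> \<Union>(cycle d)"
  shows "\<exists>h1 h2. h1 \<noteq> h2 \<and> limit_functions F U = {h1, h2} \<and>
    generic_rank U h1 = 1 \<and> generic_rank U h2 = 1 \<and>
    (\<forall>V\<in>cycle d.
       (is_cycle F (2 * m) (cycle d) \<longrightarrow> h1 ` V \<inter> h2 ` V = {} \<and>
          hyperbolic_at_infinity (h1 ` V) \<and> hyperbolic_at_infinity (h2 ` V)) \<and>
       (is_cycle F m (cycle d) \<longrightarrow> h1 ` V = h2 ` V \<and> hyperbolic_at_infinity (h1 ` V)))"
proof (intro exI conjI)
  define h1 where "h1 = restrict H U"
  define h2 where "h2 = restrict (\<lambda>p. H (F p)) U"
  have AU: "A d 0 \<subseteq> U"
  proof -
    have "orbit_component d 0 = A d 0" by (simp add: orbit_component_def)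
    then have "A d 0 \<in> cycle d" using rangeI[of "orbit_component d" 0] by (simp add: cycle_def)
    then show ?thesis unfolding U_def by blast
  qed
  have U: "open U" "U \<subseteq> \<Omega>" "U \<noteq> {}"
  proof -
    have "open V \<and> V \<subseteq> \<Omega>" if "V \<in> cycle d" for V
    proof -
      obtain j k where "V = A j k" using \<open>V \<in> cycle d\<close> by (rule cycle_cases)
      then show ?thesis using open_A A_subset_\<Omega> by simp
    qed
    then show "open U" "U \<subseteq> \<Omega>" unfolding U_def by (auto intro: open_Union)
    show "U \<noteq> {}" using AU A_nonempty by blast
  qed
  show "limit_functions F U = {h1, h2}" unfolding h1_def h2_def by (rule limit_functions_eq[OF U(1,2)])
  show "generic_rank U h1 = 1" "generic_rank U h2 = 1"
    unfolding h1_def h2_def by (rule generic_rank_H[OF U])+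
  show "h1 \<noteq> h2"
  proof
    assume "h1 = h2"
    \<comment> \<open>Equal limit functions would give [x : y] = [a y : x], hence the quadratic
      relation, throughout the product of sectors. Doubling x stays inside that product but breaks
      the relation.\<close>
    have sq: "x\<^sup>2 = a * y\<^sup>2 \<and> x \<noteq> 0" if "(x, y) \<in> W 0 d 0" for x y
    proof -
      define p where "p = \<psi> (x, y)"
      have p: "p \<in> A d 0" "\<phi> p = (x, y)" using that by (simp_all add: p_def \<psi>_in_A \<phi>_\<psi>)
      have pU: "p \<in> U" "p \<in> \<Omega>" using p(1) AU U(2) by auto
      have xy: "x \<noteq> 0" "y \<noteq> 0" using \<phi>_nonzero[OF pU(2)] p(2) by auto
      have "H p = H (F p)" using fun_cong[OF \<open>h1 = h2\<close>, of p] pU by (simp add: h1_def h2_def)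
      then have "abs_cp2 (vector [0, x, y]) = abs_cp2 (vector [0, a * y, x])"
        using H_F[OF pU(2)] p(2) by (simp add: H_def)
      moreover have "vector [0, x, y] \<noteq> (0 :: complex^3)" "vector [0, a * y, x] \<noteq> (0 :: complex^3)"
        using xy by (auto simp: vector_eq_0_iff)
      ultimately obtain s where "vector [0, a * y, x] = s *s (vector [0, x, y] :: complex^3)"
        by (auto simp: abs_cp2_eq_iff)
      then have "a * y = s * x" "x = s * y" by (auto simp: vec_eq_iff forall_3)
      then have "x\<^sup>2 = a * y\<^sup>2" using xy by (simp add: power2_eq_square)
      then show ?thesis using xy by blast
    qed
    obtain q where "q \<in> W 0 d 0" using W_nonempty by blast
    then obtain x y where xy: "(x, y) \<in> W 0 d 0" by (cases q) blast
    have "dep d (2 * x) = 2 * dep d x"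
      using depth_scaleR[of 2 \<gamma> "x * \<omega> (- d)"] by (simp add: dep_def mult.assoc)
    then have "(2 * x, y) \<in> W 0 d 0" using xy by (simp add: W_def)
    from sq[OF this] sq[OF xy] show False by (simp add: power2_eq_square)
  qed
  show "\<forall>V\<in>cycle d.
       (is_cycle F (2 * m) (cycle d) \<longrightarrow> h1 ` V \<inter> h2 ` V = {} \<and>
          hyperbolic_at_infinity (h1 ` V) \<and> hyperbolic_at_infinity (h2 ` V)) \<and>
       (is_cycle F m (cycle d) \<longrightarrow> h1 ` V = h2 ` V \<and> hyperbolic_at_infinity (h1 ` V))"
  proof
    fix V assume V: "V \<in> cycle d"
    then obtain j k where jk: "V = A j k" "j - k = d \<or> j - k = 1 - d" by (rule cycle_cases)
    have VU: "V \<subseteq> U" using V unfolding U_def by blast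
    have "h1 ` V = H ` V" "h2 ` V = (\<lambda>p. H (F p)) ` V"
      by (rule image_cong; use VU in \<open>auto simp: h1_def h2_def\<close>)+
    then have im: "h1 ` V = Sig (j - k)" "h2 ` V = Sig (k + 1 - j)"
      using H_image_A H_F_image_A by (simp_all add: jk(1))
    \<comment> \<open>The two limit sets are the slope sectors of j - k and k + 1 - j, whose indices
      differ by 2 d - 1 up to sign. Sectors with congruent indices coincide and all others are
      disjoint.\<close>
    have dv: "int m dvd (j - k) - (k + 1 - j) \<longleftrightarrow> int m dvd 2 * d - 1"
    proof -
      have "(j - k) - (k + 1 - j) = 2 * d - 1 \<or> (j - k) - (k + 1 - j) = - (2 * d - 1)" using jk(2) by auto
      then show ?thesis by (metis dvd_minus_iff)
    qed
    have d1: "1 \<le> d" using d by simp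
    have "h1 ` V \<inter> h2 ` V = {}" if "is_cycle F (2 * m) (cycle d)"
    proof -
      have "2 * d \<le> int m" using that cycle_period(1)[OF d] by blast
      have "\<not> int m dvd 2 * d - 1"
      proof
        assume "int m dvd 2 * d - 1"
        then have "2 * d - 1 = 0" by (rule dvd_imp_zero) (use \<open>2 * d \<le> int m\<close> d1 in linarith)
        then show False by presburger
      qed
      then show ?thesis unfolding im using Sig_disjoint dv by blast
    qed
    moreover have "h1 ` V = h2 ` V" if "is_cycle F m (cycle d)"
    proof -
      have "2 * d - 1 = int m" using that cycle_period(2)[OF d] by linarith
      then have "int m dvd 2 * d - 1" by simp
      then show ?thesis unfolding im using Sig_cong dv by blast
    qed
    ultimately show "(is_cycle F (2 * m) (cycle d) \<longrightarrow> h1 ` V \<inter> h2 ` V = {} \<and>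
          hyperbolic_at_infinity (h1 ` V) \<and> hyperbolic_at_infinity (h2 ` V)) \<and>
       (is_cycle F m (cycle d) \<longrightarrow> h1 ` V = h2 ` V \<and> hyperbolic_at_infinity (h1 ` V))"
      using hyperbolic_Sig by (simp add: im)
  qed
qed

lemma escaping_A: "escaping F (A j k)"
  unfolding escaping_def limit_functions_eq[OF open_A A_subset_\<Omega>]
  using H_in_line_at_infinity A_subset_\<Omega> F_in_\<Omega> by (fastforce simp: image_subset_iff)

lemma card_cycles:
  "even m \<Longrightarrow> card cycles = m div 2"
  "odd m \<Longrightarrow> card {\<C> \<in> cycles. is_cycle F (2 * m) \<C>} = (m - 1) div 2"
  "odd m \<Longrightarrow> card {\<C> \<in> cycles. is_cycle F m \<C>} = 1"
proof -
  have sub: "card (cycle ` S) = card S" if "S \<subseteq> {1..(int m + 1) div 2}" for S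
    using inj_on_subset[OF inj_on_cycle that] by (rule card_image)
  show "card cycles = m div 2" if "even m"
  proof -
    have "(int m + 1) div 2 = int (m div 2)" using that by (auto elim: evenE)
    then show ?thesis unfolding cycles_def sub[OF order_refl] by simp
  qed
  show "card {\<C> \<in> cycles. is_cycle F (2 * m) \<C>} = (m - 1) div 2" if "odd m"
  proof -
    have "{\<C> \<in> cycles. is_cycle F (2 * m) \<C>} = cycle ` {1..int m div 2}"
    proof
      show "{\<C> \<in> cycles. is_cycle F (2 * m) \<C>} \<subseteq> cycle ` {1..int m div 2}"
        using cycle_period(1) unfolding cycles_def by fastforce
      show "cycle ` {1..int m div 2} \<subseteq> {\<C> \<in> cycles. is_cycle F (2 * m) \<C>}"
        using cycle_period(1) unfolding cycles_def by fastforce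
    qed
    also have "card \<dots> = card {1..int m div 2}" by (rule sub) auto
    also have "\<dots> = (m - 1) div 2" using that by (auto elim: oddE)
    finally show ?thesis .
  qed
  show "card {\<C> \<in> cycles. is_cycle F m \<C>} = 1" if "odd m"
  proof -
    define h where "h = (int m + 1) div 2"
    have h: "2 * h = int m + 1" using that by (auto simp: h_def elim: oddE)
    have hI: "h \<in> {1..(int m + 1) div 2}" using h m_pos by (auto simp: h_def)
    have "{\<C> \<in> cycles. is_cycle F m \<C>} = {cycle h}"
    proof
      show "{\<C> \<in> cycles. is_cycle F m \<C>} \<subseteq> {cycle h}"
      proof
        fix \<C> assume "\<C> \<in> {\<C> \<in> cycles. is_cycle F m \<C>}"
        then obtain d where d: "d \<in> {1..(int m + 1) div 2}" "\<C> = cycle d" "is_cycle F m (cycle d)"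
          unfolding cycles_def by blast
        then have "2 * d = int m + 1" using cycle_period(2) by blast
        then have "d = h" using h by linarith
        then show "\<C> \<in> {cycle h}" using d(2) by simp
      qed
      show "{cycle h} \<subseteq> {\<C> \<in> cycles. is_cycle F m \<C>}"
        using hI cycle_period(2)[OF hI] h unfolding cycles_def by blast
    qed
    then show ?thesis by simp
  qed
qed

lemma cycles_period:
  assumes "\<C> \<in> cycles"
  shows "is_cycle F (2 * m) \<C> \<or> is_cycle F m \<C>" "even m \<Longrightarrow> is_cycle F (2 * m) \<C>"
proof -
  obtain d where d: "d \<in> {1..(int m + 1) div 2}" "\<C> = cycle d" using assms unfolding cycles_def by blast
  have "2 * d \<le> int m + 1" using d(1) by auto
  then consider "2 * d \<le> int m" | "2 * d = int m + 1" by linarith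
  then show "is_cycle F (2 * m) \<C> \<or> is_cycle F m \<C>"
    using cycle_period[OF d(1)] d(2) by cases auto
  have "2 * d \<noteq> int m + 1" if "even m" using that by presburger
  then show "is_cycle F (2 * m) \<C>" if "even m"
    using that cycle_period(1)[OF d(1)] d(2) \<open>2 * d \<le> int m + 1\<close> by auto
qed

lemma Union_Union_cycles: "\<Union>(\<Union>cycles) = \<Omega>"
  unfolding Union_cycles \<Omega>_def by blast

end

theorem theorem1p1:
  fixes m :: nat and \<delta> :: real and F L :: self_map
  assumes "m \<ge> 2" and "\<delta> > 2"
    and F_def: "F = henon_map m \<delta>"
    and L_def: "L = linear_part m \<delta>"
  shows "\<exists>cycles :: (complex \<times> complex) set set set.
      finite cycles \<and>
      card (\<Union>cycles) = m\<^sup>2 \<and>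
      (\<forall>V\<in>\<Union>cycles. V \<in> Fatou_components F \<and> escaping F V) \<and>
      \<comment> \<open>the cycles and their periods\<close>
      (even m \<longrightarrow> card cycles = m div 2 \<and> (\<forall>\<C>\<in>cycles. is_cycle F (2 * m) \<C>)) \<and>
      (odd m \<longrightarrow>
         (\<forall>\<C>\<in>cycles. is_cycle F (2 * m) \<C> \<or> is_cycle F m \<C>) \<and>
         card {\<C>\<in>cycles. is_cycle F (2 * m) \<C>} = (m - 1) div 2 \<and>
         card {\<C>\<in>cycles. is_cycle F m \<C>} = 1) \<and>
      \<comment> \<open>limit functions and limit sets\<close>
      (\<forall>\<C>\<in>cycles. \<exists>h1 h2. h1 \<noteq> h2 \<and> limit_functions F (\<Union>\<C>) = {h1, h2} \<and>
         generic_rank (\<Union>\<C>) h1 = 1 \<and> generic_rank (\<Union>\<C>) h2 = 1 \<and>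
         (\<forall>V\<in>\<C>.
            (is_cycle F (2 * m) \<C> \<longrightarrow>
               h1 ` V \<inter> h2 ` V = {} \<and>
               hyperbolic_at_infinity (h1 ` V) \<and> hyperbolic_at_infinity (h2 ` V)) \<and>
            (is_cycle F m \<C> \<longrightarrow>
               h1 ` V = h2 ` V \<and> hyperbolic_at_infinity (h1 ` V)))) \<and>
      \<comment> \<open>linearisation on the union of the components\<close>
      (\<exists>\<phi> \<psi>. biholomorphism (\<Union>(\<Union>cycles)) (\<phi> ` \<Union>(\<Union>cycles)) \<phi> \<psi> \<and>
         (\<forall>p\<in>\<Union>(\<Union>cycles). \<phi> (F p) = L (\<phi> p))) \<and>
      (\<forall>V\<in>\<Union>cycles. \<exists>\<phi> \<psi>. biholomorphism V (half_plane \<times> half_plane) \<phi> \<psi>)"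
proof -
  interpret T: transcendental_henon m \<delta> by unfold_locales fact+
  show ?thesis
    unfolding F_def L_def
  proof (intro exI[of _ T.cycles] conjI impI ballI)
    show "finite T.cycles" by (simp add: T.cycles_def)
    show "card (\<Union>T.cycles) = m\<^sup>2" by (rule T.card_Union_cycles)
    fix V assume "V \<in> \<Union>T.cycles"
    then obtain j k where V: "V = T.A j k" using T.Union_cycles by blast
    show "V \<in> Fatou_components (henon_map m \<delta>)" unfolding V by (rule T.A_in_Fatou_components)
    show "escaping (henon_map m \<delta>) V" unfolding V by (rule T.escaping_A)
    show "\<exists>\<phi> \<psi>. biholomorphism V (half_plane \<times> half_plane) \<phi> \<psi>"
      unfolding V by (rule T.biholomorphism_A_half_planes)
  next
    assume m: "even m"
    show "card T.cycles = m div 2" by (rule T.card_cycles(1)[OF m])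
    show "is_cycle (henon_map m \<delta>) (2 * m) \<C>" if "\<C> \<in> T.cycles" for \<C> by (rule T.cycles_period(2)[OF that m])
  next
    assume m: "odd m"
    show "is_cycle (henon_map m \<delta>) (2 * m) \<C> \<or> is_cycle (henon_map m \<delta>) m \<C>" if "\<C> \<in> T.cycles" for \<C>
      by (rule T.cycles_period(1)[OF that])
    show "card {\<C> \<in> T.cycles. is_cycle (henon_map m \<delta>) (2 * m) \<C>} = (m - 1) div 2" by (rule T.card_cycles(2)[OF m])
    show "card {\<C> \<in> T.cycles. is_cycle (henon_map m \<delta>) m \<C>} = 1" by (rule T.card_cycles(3)[OF m])
  next
    fix \<C> assume "\<C> \<in> T.cycles"
    then obtain d where d: "d \<in> {1..(int m + 1) div 2}" "\<C> = T.cycle d" unfolding T.cycles_def by blast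
    show "\<exists>h1 h2. h1 \<noteq> h2 \<and> limit_functions (henon_map m \<delta>) (\<Union>\<C>) = {h1, h2} \<and>
         generic_rank (\<Union>\<C>) h1 = 1 \<and> generic_rank (\<Union>\<C>) h2 = 1 \<and>
         (\<forall>V\<in>\<C>.
            (is_cycle (henon_map m \<delta>) (2 * m) \<C> \<longrightarrow>
               h1 ` V \<inter> h2 ` V = {} \<and>
               hyperbolic_at_infinity (h1 ` V) \<and> hyperbolic_at_infinity (h2 ` V)) \<and>
            (is_cycle (henon_map m \<delta>) m \<C> \<longrightarrow>
               h1 ` V = h2 ` V \<and> hyperbolic_at_infinity (h1 ` V)))"
      unfolding d(2) by (rule T.limit_functions_of_cycle[OF d(1)])
  next
    show "\<exists>\<phi> \<psi>. biholomorphism (\<Union>(\<Union>T.cycles)) (\<phi> ` \<Union>(\<Union>T.cycles)) \<phi> \<psi> \<and>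
         (\<forall>p\<in>\<Union>(\<Union>T.cycles). \<phi> (henon_map m \<delta> p) = linear_part m \<delta> (\<phi> p))"
      unfolding T.Union_Union_cycles using T.biholomorphism_\<phi> T.\<phi>_F by blast
  qed
qed

end
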